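(* Let $n\ge 1$ be an integer, let $\overrightarrow{p}=(p_1,\dots,p_n)$ and $\overrightarrow{q}=(q_1,\dots,q_n)$ satisfy $1<p_i<\infty$ and $1<q_i<\infty$ for $i=1,\dots,n$, and let $s$ be a real number with $0<s<\frac{n}{p_i}$ for every $i=1,\dots,n$. Then there exists a positive constant $C$, independent of $f$, such that for all Schwartz functions $f$ on $\mathbb{R}^n$ $$\left\|\frac{f(x)}{|x|^{s}}\right\|_{L^{\overrightarrow{p},\overrightarrow{q}}(\mathbb{R}^{n})}\leq C\,\|\Lambda^{s}f\|_{L^{\overrightarrow{p},\overrightarrow{q}}(\mathbb{R}^{n})}.$$
   Context: Fourier transform: $\hat f(\xi)=(2\pi)^{-n/2}\int_{\mathbb{R}^n}f(x)e^{-i\xi\cdot x}\,dx$. For $s\ge 0$, $\Lambda^s f$ is defined by $\widehat{\Lambda^s f}(\xi)=|\xi|^s\hat f(\xi)$, i.e. $\Lambda=(-\Delta)^{1/2}$. Lorentz spaces: for a measurable $g$ on $\mathbb{R}^m$, let $g_*(\alpha)=|\{x:|g(x)|>\alpha\}|$ and $g^*(t)=\inf\{\alpha>0: g_*(\alpha)\le t\}$. For $p,q\in(0,\infty]$, $\|g\|_{L^{p,q}(\mathbb{R}^m)}=\left(\int_0^\infty (t^{1/p}g^*(t))^q\frac{dt}{t}\right)^{1/q}$ if $q<\infty$, and $\|g\|_{L^{p,\infty}(\mathbb{R}^m)}=\sup_{t>0}t^{1/p}g^*(t)$. Mixed Lorentz norm: for $\overrightarrow{p}=(p_1,\dots,p_n)$,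 $\overrightarrow{q}=(q_1,\dots,q_n)$, $$\|f\|_{L^{\overrightarrow{p},\overrightarrow{q}}(\mathbb{R}^n)}=\Big\|\cdots\big\|\,\|f\|_{L^{p_1,q_1}_{x_1}(\mathbb{R})}\big\|_{L^{p_2,q_2}_{x_2}(\mathbb{R})}\cdots\Big\|_{L^{p_n,q_n}_{x_n}(\mathbb{R})},$$ the $x_1$-norm being taken first (innermost) and the $x_n$-norm last. *)

theory Defs
  imports "HOL-Analysis.Analysis"
begin

subsection \<open>Schwartz functions\<close>

definition pderiv_dir :: "'n::finite \<Rightarrow> (real^'n \<Rightarrow> complex) \<Rightarrow> real^'n \<Rightarrow> complex" where
  "pderiv_dir i f = (\<lambda>x. frechet_derivative f (at x) (axis i 1))"

text \<open>A multi-index derivative is given by the list of the directions of differentiation, so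
  \<open>foldr pderiv_dir is f\<close>, with \<open>is\<close> ranging over all lists, covers all iterated partial
  derivatives.  Demanding that each of them is (totally) differentiable everywhere is smoothness.\<close>

definition schwartz :: "(real^'n::finite \<Rightarrow> complex) \<Rightarrow> bool" where
  "schwartz f \<longleftrightarrow>
     (\<forall>is. (\<forall>x. foldr pderiv_dir is f differentiable (at x)) \<and>
           (\<forall>\<beta> :: 'n \<Rightarrow> nat. bounded (range (\<lambda>x.
               complex_of_real (\<Prod>j\<in>UNIV. (x $ j) ^ \<beta> j) * foldr pderiv_dir is f x))))"


subsection \<open>Fourier transform and fractional Laplacian\<close>

definition fourier :: "(real^'n::finite \<Rightarrow> complex) \<Rightarrow> real^'n \<Rightarrow> complex" where
  "fourier f \<xi> = complex_of_real ((2 * pi) powr (- (real CARD('n) / 2))) *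
     (LINT x|lborel. f x * exp (- \<i> * complex_of_real (\<xi> \<bullet> x)))"

definition inv_fourier :: "(real^'n::finite \<Rightarrow> complex) \<Rightarrow> real^'n \<Rightarrow> complex" where
  "inv_fourier F x = complex_of_real ((2 * pi) powr (- (real CARD('n) / 2))) *
     (LINT \<xi>|lborel. F \<xi> * exp (\<i> * complex_of_real (\<xi> \<bullet> x)))"

text \<open>The function with Fourier transform \<open>|\<xi>|^s f^(\<xi>)\<close>.  For Schwartz \<open>f\<close> and \<open>s \<ge> 0\<close> that
  product is integrable, so the inversion integral is absolutely convergent and selects the
  continuous representative.  (For \<open>s = 0\<close> the convention \<open>0 powr 0 = 0\<close> only changes the
  integrand at the origin.)\<close>

definition Lambda :: "real \<Rightarrow> (real^'n::finite \<Rightarrow> complex) \<Rightarrow> real^'n \<Rightarrow> complex" where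
  "Lambda s f = inv_fourier (\<lambda>\<xi>. complex_of_real (norm \<xi> powr s) * fourier f \<xi>)"


subsection \<open>Lorentz norms\<close>

text \<open>All norms are taken of \<open>[0,\<infinity>]\<close>-valued functions (apply them to \<open>|g|\<close>): the inner norms
  of an iterated norm may be infinite.\<close>

definition distr_fun :: "('a::euclidean_space \<Rightarrow> ennreal) \<Rightarrow> ennreal \<Rightarrow> ennreal" where
  "distr_fun g \<alpha> = emeasure lebesgue {x. g x > \<alpha>}"

text \<open>As an infimum in \<open>[0,\<infinity>]\<close>, this is \<open>\<infinity>\<close> when no admissible \<open>\<alpha>\<close> exists.\<close>

definition rearrangement :: "('a::euclidean_space \<Rightarrow> ennreal) \<Rightarrow> real \<Rightarrow> ennreal" where
  "rearrangement g t = (INF \<alpha>\<in>{\<alpha>::real. \<alpha> > 0 \<and> distr_fun g (ennreal \<alpha>) \<le> ennreal t}. ennreal \<alpha>)"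

text \<open>Only used for exponents \<open>a > 0\<close>.\<close>

definition ennreal_rpow :: "ennreal \<Rightarrow> real \<Rightarrow> ennreal" where
  "ennreal_rpow x a = (if x = \<infinity> then \<infinity> else ennreal (enn2real x powr a))"

text \<open>For finite positive exponents \<open>p\<close>, \<open>q\<close>.\<close>

definition lorentz_norm :: "real \<Rightarrow> real \<Rightarrow> ('a::euclidean_space \<Rightarrow> ennreal) \<Rightarrow> ennreal" where
  "lorentz_norm p q g = ennreal_rpow
     (\<integral>\<^sup>+ t\<in>{0<..}. ennreal_rpow (ennreal (t powr (1 / p)) * rearrangement g t) q / ennreal t \<partial>lborel)
     (1 / q)"

text \<open>The norm in the single variable \<open>x\<^sub>i\<close>, as a function of the remaining variables; it is kept
  as a function on the full space that no longer depends on \<open>x\<^sub>i\<close>.\<close>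

definition lorentz_in_coord ::
    "real \<Rightarrow> real \<Rightarrow> 'n::finite \<Rightarrow> (real^'n \<Rightarrow> ennreal) \<Rightarrow> real^'n \<Rightarrow> ennreal" where
  "lorentz_in_coord p q i F = (\<lambda>x. lorentz_norm p q (\<lambda>t::real. F (\<chi> j. if j = i then t else x $ j)))"

text \<open>The coordinates are processed in increasing order of their index, the smallest one innermost.
  After all of them the result is a constant function, evaluated here at \<open>0\<close>.\<close>

definition mixed_lorentz_norm ::
    "('n \<Rightarrow> real) \<Rightarrow> ('n \<Rightarrow> real) \<Rightarrow> (real^'n::{finite,linorder} \<Rightarrow> complex) \<Rightarrow> ennreal" where
  "mixed_lorentz_norm p q f =
     fold (\<lambda>i. lorentz_in_coord (p i) (q i) i) (sorted_list_of_set UNIV)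
       (\<lambda>x. ennreal (norm (f x))) 0"

end

theory Submission
  imports Defs "HOL-Probability.Probability"
begin

text \<open>
  Write \<open>n\<close> for the dimension and \<open>\<sigma> = s / n\<close>, so that \<open>0 < \<sigma> < 1 / p i < 1\<close>.  The function
  \<open>f\<close> is the Riesz potential of order \<open>s\<close> of \<open>\<Lambda>\<^sup>s f\<close>, hence
  \<open>|f x| / |x|^s \<le> c \<integral> |x|^(-s) |z - x|^(s-n) |\<Lambda>\<^sup>s f z| dz\<close>.  The two powers are negative and every
  coordinate of a vector is at most its norm, so the kernel is bounded by the product over the
  coordinates of \<open>|x\<^sub>i|^(-\<sigma>) |z\<^sub>i - x\<^sub>i|^(\<sigma>-1)\<close>.  This is homogeneous of degree \<open>-1\<close> in each
  coordinate; the substitution \<open>z\<^sub>i = u\<^sub>i x\<^sub>i\<close> turns the integral into a superposition of dilates,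
  \<open>\<integral> (\<Prod>i. |1 - u\<^sub>i|^(\<sigma>-1)) |\<Lambda>\<^sup>s f (u\<^sub>1 x\<^sub>1, \<dots>, u\<^sub>n x\<^sub>n)| du\<close>, which is the content of
  \<open>hardy_quotient_le_dilates\<close>.

  A dilation of the \<open>i\<close>-th variable by \<open>u\<^sub>i\<close> multiplies the norm of \<open>L^(p,q)\<close> in that variable by
  \<open>|u\<^sub>i|^(-1/p i)\<close> (\<open>lorentz_norm_dilate\<close>).  Since Minkowski's integral inequality holds in \<open>L^(p,q)\<close> up to
  a constant (\<open>lorentz_norm_nn_integral_le\<close>), it can be applied to one variable after another, and the
  mixed norm of the superposition is at most a constant times
  \<open>\<Prod>i. \<integral> |1 - u|^(\<sigma>-1) |u|^(-1/p i) du\<close> times the mixed norm of \<open>\<Lambda>\<^sup>s f\<close>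
  (\<open>mixed_lorentz_dilates_bounded\<close>).  These one-dimensional integrals converge because
  \<open>0 < \<sigma> < 1 / p i < 1\<close>.

  The Riesz representation is obtained from Gaussian averages (\<open>schwartz_le_gauss_averages\<close>): averaging
  with a Gaussian of width \<open>r\<close> multiplies the Fourier transform by \<open>exp (-r\<^sup>2 |\<xi>|\<^sup>2 / 2)\<close>, and
  the integral of this factor against \<open>r^(s-1) dr\<close> is a constant times \<open>|\<xi>|^(-s)\<close>.  The result then
  follows from Fourier inversion, while in space the same superposition of Gaussians is a multiple of the
  kernel \<open>|z - x|^(s-n)\<close> (\<open>gauss_averages_eq_riesz\<close>).
\<close>

section \<open>Real powers of extended nonnegative numbers\<close>

lemma rpow_top [simp]: "ennreal_rpow top a = top"
  by (auto simp: ennreal_rpow_def)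

lemma rpow_0 [simp]: "ennreal_rpow 0 a = 0"
  by (auto simp: ennreal_rpow_def)

lemma rpow_1 [simp]: "ennreal_rpow x 1 = x"
  by (cases x) (auto simp: ennreal_rpow_def)

lemma rpow_ennreal: "0 \<le> c \<Longrightarrow> ennreal_rpow (ennreal c) a = ennreal (c powr a)"
  by (auto simp: ennreal_rpow_def)

lemma rpow_eq_0_iff [simp]: "ennreal_rpow x a = 0 \<longleftrightarrow> x = 0"
  by (cases x) (auto simp: ennreal_rpow_def)

lemma rpow_mono:
  assumes "0 < a" "x \<le> y" shows "ennreal_rpow x a \<le> ennreal_rpow y a"
proof (cases y)
  case (real r)
  then obtain u where "x = ennreal u" "0 \<le> u" "u \<le> r"
    using assms by (cases x) (auto simp: top_unique)
  then show ?thesis using real assms by (auto simp: rpow_ennreal intro!: ennreal_leI powr_mono2)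
qed auto

lemma rpow_mult:
  assumes "0 < a" shows "ennreal_rpow (x * y) a = ennreal_rpow x a * ennreal_rpow y a"
proof (cases "x = top \<or> y = top")
  case True
  then show ?thesis using assms
    by (cases "x = 0"; cases "y = 0") (auto simp: ennreal_mult_top ennreal_top_mult)
next
  case False
  then obtain u v where "x = ennreal u" "0 \<le> u" "y = ennreal v" "0 \<le> v"
    by (metis ennreal_cases)
  then show ?thesis using assms
    by (simp add: rpow_ennreal ennreal_mult'[symmetric] powr_mult)
qed

lemma rpow_rpow:
  assumes "0 < a" "0 < b" shows "ennreal_rpow (ennreal_rpow x a) b = ennreal_rpow x (a * b)"
  using assms by (cases x) (auto simp: rpow_ennreal powr_powr)

lemma rpow_add:
  assumes "0 < a" "0 < b" shows "ennreal_rpow x (a + b) = ennreal_rpow x a * ennreal_rpow x b"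
  using assms by (cases x) (auto simp: rpow_ennreal powr_add ennreal_mult)

lemma measurable_rpow [measurable (raw)]:
  assumes [measurable]: "f \<in> borel_measurable M"
  shows "(\<lambda>x. ennreal_rpow (f x) a) \<in> borel_measurable M"
  unfolding ennreal_rpow_def by measurable

section \<open>Minkowski's integral inequality\<close>

lemma Young_ennreal:
  fixes b q :: real and x :: ennreal
  assumes "1 < q" "0 \<le> b"
  shows "ennreal (q * b powr (q - 1)) * x \<le> ennreal_rpow x q + ennreal ((q - 1) * b powr q)"
proof (cases x)
  case (real a)
  have "1 < q / (q - 1)" using assms by (simp add: field_simps)
  from Youngs_inequality[OF \<open>1 < q\<close> this, of a "b powr (q - 1)"]
  have "a * b powr (q - 1) \<le> a powr q / q + (b powr (q - 1)) powr (q / (q - 1)) / (q / (q - 1))"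
    using assms real by (simp add: field_simps)
  also have "(b powr (q - 1)) powr (q / (q - 1)) = b powr q"
    using assms by (simp add: powr_powr)
  finally have "q * b powr (q - 1) * a \<le> a powr q + (q - 1) * b powr q"
    using assms by (simp add: field_simps)
  then show ?thesis using real assms
    by (simp add: rpow_ennreal ennreal_mult'[symmetric] ennreal_plus[symmetric] ennreal_leI del: ennreal_plus)
qed simp

text \<open>Jensen's inequality for the convex function \<open>x \<mapsto> x\<^sup>q\<close> and the measure of density \<open>w\<close>, which
  has total mass \<open>A = \<integral> w\<close>.  Integrating Young's inequality, the tangent-line form of convexity, against
  \<open>w\<close> gives a bound with a free parameter \<open>b\<close>; the tangent at the mean \<open>b = (\<integral> w K) / A\<close> yields
  the claim.\<close>

lemma weighted_Jensen_rpow: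
  fixes K w :: "'a \<Rightarrow> ennreal" and q :: real
  assumes q: "1 < q" and [measurable]: "K \<in> borel_measurable M" "w \<in> borel_measurable M"
    and fin: "(\<integral>\<^sup>+m. w m \<partial>M) < \<infinity>"
  shows "ennreal_rpow (\<integral>\<^sup>+m. w m * K m \<partial>M) q
    \<le> ennreal_rpow (\<integral>\<^sup>+m. w m \<partial>M) (q - 1) * (\<integral>\<^sup>+m. w m * ennreal_rpow (K m) q \<partial>M)"
proof -
  define J where "J = (\<integral>\<^sup>+m. w m * ennreal_rpow (K m) q \<partial>M)"
  obtain A where A: "(\<integral>\<^sup>+m. w m \<partial>M) = ennreal A" "0 \<le> A"
    using fin by (cases "\<integral>\<^sup>+m. w m \<partial>M") auto
  have main: "ennreal (q * b powr (q - 1)) * (\<integral>\<^sup>+m. w m * K m \<partial>M) \<le> J + ennreal ((q - 1) * b powr q * A)"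
    if "0 \<le> b" for b
  proof -
    have "ennreal (q * b powr (q - 1)) * (\<integral>\<^sup>+m. w m * K m \<partial>M)
        = (\<integral>\<^sup>+m. w m * (ennreal (q * b powr (q - 1)) * K m) \<partial>M)"
      by (subst nn_integral_cmult[symmetric]) (auto simp: mult_ac)
    also have "\<dots> \<le> (\<integral>\<^sup>+m. w m * (ennreal_rpow (K m) q + ennreal ((q - 1) * b powr q)) \<partial>M)"
      by (intro nn_integral_mono mult_left_mono Young_ennreal q that) auto
    also have "\<dots> = J + ennreal ((q - 1) * b powr q) * (\<integral>\<^sup>+m. w m \<partial>M)"
      unfolding J_def
      by (subst nn_integral_cmult[symmetric], simp, subst nn_integral_add[symmetric])
         (auto simp: distrib_left mult_ac intro!: nn_integral_cong)
    finally show ?thesis using A q that by (simp add: ennreal_mult'[symmetric])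
  qed
  show ?thesis
  proof (cases "A = 0")
    case True
    then have "AE m in M. w m = 0" using A by (simp add: nn_integral_0_iff_AE)
    then have "(\<integral>\<^sup>+m. w m * K m \<partial>M) = 0" by (subst nn_integral_0_iff_AE) auto
    then show ?thesis by simp
  next
    case False
    then have Apos: "0 < A" using A by simp
    show ?thesis
    proof (cases "\<integral>\<^sup>+m. w m * K m \<partial>M")
      case (real h)
      \<comment> \<open>The parameter of \<open>main\<close> is the mean value \<open>h / A\<close> here.  If the mean is infinite, any positive
        parameter forces the right-hand side to be infinite as well.\<close>
      let ?c = "(h / A) powr q * A"
      have "(h / A) powr (q - 1) * h = ?c"
        using real Apos by (cases "h = 0") (auto simp: powr_diff field_simps)
      then have split: "q * (h / A) powr (q - 1) * h = ?c + (q - 1) * (h / A) powr q * A"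
        by (simp add: algebra_simps)
      have "ennreal (q * (h / A) powr (q - 1)) * ennreal h \<le> J + ennreal ((q - 1) * (h / A) powr q * A)"
        using main[of "h / A"] real Apos by simp
      then have "ennreal (?c + (q - 1) * (h / A) powr q * A) \<le> J + ennreal ((q - 1) * (h / A) powr q * A)"
        using q real(1) by (subst (asm) ennreal_mult'[symmetric]) (auto simp: split)
      moreover have "ennreal (?c + (q - 1) * (h / A) powr q * A) = ennreal ?c + ennreal ((q - 1) * (h / A) powr q * A)"
        using Apos q by (intro ennreal_plus) auto
      ultimately have "ennreal ((q - 1) * (h / A) powr q * A) + ennreal ?c \<le> ennreal ((q - 1) * (h / A) powr q * A) + J"
        by (metis add.commute)
      then have "ennreal ?c \<le> J"
        unfolding ennreal_add_left_cancel_le by simp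
      then have "ennreal (A powr (q - 1)) * ennreal ((h / A) powr q * A) \<le> ennreal (A powr (q - 1)) * J"
        by (rule mult_left_mono) simp
      also have "ennreal (A powr (q - 1)) * ennreal ((h / A) powr q * A) = ennreal (h powr q)"
        using Apos real by (subst ennreal_mult'[symmetric]) (auto simp: powr_divide powr_diff)
      finally show ?thesis using A real by (simp add: rpow_ennreal J_def)
    next
      case top
      then have "J = top" using main[of 1] q A by (auto simp: ennreal_mult_top top_unique)
      then show ?thesis using Apos A by (simp add: rpow_ennreal J_def[symmetric] ennreal_mult_top)
    qed
  qed
qed

text \<open>After division of each \<open>H m\<close> by its \<open>L\<^sup>q\<close> norm \<open>n m\<close>, the integral over \<open>m\<close> is an average
  of functions of norm \<open>1\<close> with weights \<open>n m\<close>.  Jensen's inequality bounds the \<open>q\<close>-th power of this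
  average pointwise, and Tonelli's theorem integrates the bound.\<close>

lemma Minkowski_nn_integral:
  fixes H :: "'a \<Rightarrow> 'b \<Rightarrow> ennreal" and q :: real
  assumes q: "1 < q" and M: "sigma_finite_measure M" and N: "sigma_finite_measure N"
    and H [measurable]: "(\<lambda>(m, t). H m t) \<in> borel_measurable (M \<Otimes>\<^sub>M N)"
  shows "ennreal_rpow (\<integral>\<^sup>+t. ennreal_rpow (\<integral>\<^sup>+m. H m t \<partial>M) q \<partial>N) (1 / q)
    \<le> (\<integral>\<^sup>+m. ennreal_rpow (\<integral>\<^sup>+t. ennreal_rpow (H m t) q \<partial>N) (1 / q) \<partial>M)"
proof -
  interpret M: sigma_finite_measure M by fact
  interpret N: sigma_finite_measure N by fact
  interpret P: pair_sigma_finite M N ..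
  define n where "n m = ennreal_rpow (\<integral>\<^sup>+t. ennreal_rpow (H m t) q \<partial>N) (1 / q)" for m
  have n_meas [measurable]: "n \<in> borel_measurable M" unfolding n_def by measurable
  define A where "A = (\<integral>\<^sup>+m. n m \<partial>M)"
  have n_pow: "ennreal_rpow (n m) q = (\<integral>\<^sup>+t. ennreal_rpow (H m t) q \<partial>N)" for m
    unfolding n_def using q by (simp add: rpow_rpow)
  show ?thesis
  proof (cases "A = top")
    case True
    then show ?thesis unfolding A_def n_def by simp
  next
    case False
    have AEfin: "AE m in M. n m \<noteq> top"
      using False nn_integral_PInf_AE[of n M] unfolding A_def by simp
    \<comment> \<open>The quotient of \<open>H\<close> by its norm; parameters of norm \<open>0\<close> or \<open>\<infinity>\<close> carry no mass.\<close>
    define K where "K m t = H m t / n m" for m t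
    have K_meas [measurable]: "(\<lambda>(m, t). K m t) \<in> borel_measurable (M \<Otimes>\<^sub>M N)"
      unfolding K_def by measurable
    have zero: "AE t in N. H m t = 0" if "n m = 0" "m \<in> space M" for m
    proof -
      have "(\<integral>\<^sup>+t. ennreal_rpow (H m t) q \<partial>N) = 0" using n_pow[of m] that by simp
      then show ?thesis using that by (subst (asm) nn_integral_0_iff_AE) auto
    qed
    have "AE m in M. AE t in N. H m t = n m * K m t"
      using AEfin AE_space
    proof eventually_elim
      case (elim m)
      show ?case
      proof (cases "n m = 0")
        case True
        then show ?thesis using zero[OF True] elim by (auto simp: elim: eventually_mono)
      next
        case False
        then show ?thesis using elim
          by (auto simp: K_def ennreal_times_divide intro!: AE_I2) (metis ennreal_mult_divide_eq mult.commute)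
      qed
    qed
    then have "AE t in N. AE m in M. H m t = n m * K m t"
      by (subst P.AE_commute[symmetric]) auto
    then have h: "AE t in N. (\<integral>\<^sup>+m. H m t \<partial>M) = (\<integral>\<^sup>+m. n m * K m t \<partial>M)"
      by eventually_elim (rule nn_integral_cong_AE)
    have "(\<integral>\<^sup>+t. ennreal_rpow (\<integral>\<^sup>+m. H m t \<partial>M) q \<partial>N) = (\<integral>\<^sup>+t. ennreal_rpow (\<integral>\<^sup>+m. n m * K m t \<partial>M) q \<partial>N)"
      using h by (intro nn_integral_cong_AE) auto
    also have "\<dots> \<le> (\<integral>\<^sup>+t. ennreal_rpow A (q - 1) * (\<integral>\<^sup>+m. n m * ennreal_rpow (K m t) q \<partial>M) \<partial>N)"
      unfolding A_def
      by (intro nn_integral_mono weighted_Jensen_rpow q) (use False in \<open>auto simp: A_def less_top\<close>)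
    also have "\<dots> = ennreal_rpow A (q - 1) * (\<integral>\<^sup>+t. (\<integral>\<^sup>+m. n m * ennreal_rpow (K m t) q \<partial>M) \<partial>N)"
      by (intro nn_integral_cmult) measurable
    also have "(\<integral>\<^sup>+t. (\<integral>\<^sup>+m. n m * ennreal_rpow (K m t) q \<partial>M) \<partial>N) =
        (\<integral>\<^sup>+m. (\<integral>\<^sup>+t. n m * ennreal_rpow (K m t) q \<partial>N) \<partial>M)"
      by (rule P.Fubini') measurable
    also have "\<dots> \<le> (\<integral>\<^sup>+m. n m \<partial>M)"
    proof (intro nn_integral_mono_AE)
      show "AE m in M. (\<integral>\<^sup>+t. n m * ennreal_rpow (K m t) q \<partial>N) \<le> n m"
        using AEfin AE_space
      proof eventually_elim
        case (elim m)
        have [measurable]: "K m \<in> borel_measurable N" "H m \<in> borel_measurable N"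
          using elim by measurable
        show ?case
        proof (cases "n m = 0")
          case False
          have "ennreal_rpow (K m t) q = ennreal_rpow (H m t) q * ennreal_rpow (inverse (n m)) q" for t
            unfolding K_def divide_ennreal_def using q by (simp add: rpow_mult)
          then have "(\<integral>\<^sup>+t. ennreal_rpow (K m t) q \<partial>N) = ennreal_rpow (n m) q * ennreal_rpow (inverse (n m)) q"
            by (simp add: nn_integral_multc n_pow)
          also have "\<dots> = ennreal_rpow (n m * inverse (n m)) q" using q by (simp add: rpow_mult)
          also have "n m * inverse (n m) = 1"
            using False elim by (metis ennreal_divide_self divide_ennreal_def less_top zero_less_iff_neq_zero)
          also have "ennreal_rpow 1 q = 1" using rpow_ennreal[of 1 q] by simp
          finally show ?thesis by (simp add: nn_integral_cmult)
        qed simp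
      qed
    qed
    also have "(\<integral>\<^sup>+m. n m \<partial>M) = A" by (simp add: A_def)
    also have "ennreal_rpow A (q - 1) * A = ennreal_rpow A q"
      using rpow_add[of "q - 1" 1 A] q by simp
    finally have "(\<integral>\<^sup>+t. ennreal_rpow (\<integral>\<^sup>+m. H m t \<partial>M) q \<partial>N) \<le> ennreal_rpow A q"
      by (simp add: mult_left_mono)
    then have "ennreal_rpow (\<integral>\<^sup>+t. ennreal_rpow (\<integral>\<^sup>+m. H m t \<partial>M) q \<partial>N) (1 / q) \<le> ennreal_rpow (ennreal_rpow A q) (1 / q)"
      using q by (intro rpow_mono) auto
    also have "\<dots> = A" using q by (simp add: rpow_rpow)
    finally show ?thesis unfolding A_def n_def .
  qed
qed

section \<open>One-dimensional integrals of powers\<close>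

lemma nn_integral_lborel_stretch:
  fixes f :: "real \<Rightarrow> ennreal"
  assumes [measurable]: "f \<in> borel_measurable borel" and "c \<noteq> 0"
  shows "(\<integral>\<^sup>+x. f x \<partial>lborel) = ennreal \<bar>c\<bar> * (\<integral>\<^sup>+x. f (c * x) \<partial>lborel)"
  using nn_integral_real_affine[of f c 0] assms by simp

lemma nn_integral_powr_near_0_finite:
  fixes a c :: real
  assumes "-1 < a" "0 \<le> c"
  shows "(\<integral>\<^sup>+x\<in>{0..c}. ennreal (x powr a) \<partial>lborel) < \<infinity>"
  by (subst nn_integral_has_integral_lebesgue'[OF _ has_integral_powr_from_0[OF assms]]) auto

lemma nn_integral_powr_near_infinity_finite:
  fixes a c :: real
  assumes "a < -1" "0 < c"
  shows "(\<integral>\<^sup>+x\<in>{c..}. ennreal (x powr a) \<partial>lborel) < \<infinity>"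
  by (subst nn_integral_has_integral_lebesgue'[OF _ has_integral_powr_to_inf[OF assms]]) auto

lemma nn_integral_even_le:
  fixes f :: "real \<Rightarrow> ennreal"
  assumes [measurable]: "f \<in> borel_measurable borel"
  shows "(\<integral>\<^sup>+x. f \<bar>x\<bar> \<partial>lborel) \<le> 2 * (\<integral>\<^sup>+x. f x \<partial>lborel)"
proof -
  let ?g = "\<lambda>x. f x * indicator {0..} x"
  have "(\<integral>\<^sup>+x. f \<bar>x\<bar> \<partial>lborel) \<le> (\<integral>\<^sup>+x. ?g x + ?g (-1 * x) \<partial>lborel)"
    by (intro nn_integral_mono) (auto simp: indicator_def abs_if)
  also have "\<dots> = (\<integral>\<^sup>+x. ?g x \<partial>lborel) + (\<integral>\<^sup>+x. ?g (-1 * x) \<partial>lborel)"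
    by (intro nn_integral_add) auto
  also have "(\<integral>\<^sup>+x. ?g (-1 * x) \<partial>lborel) = (\<integral>\<^sup>+x. ?g x \<partial>lborel)"
    using nn_integral_lborel_stretch[of ?g "-1"] by simp
  also have "(\<integral>\<^sup>+x. ?g x \<partial>lborel) \<le> (\<integral>\<^sup>+x. f x \<partial>lborel)"
    by (intro nn_integral_mono) (auto simp: indicator_def)
  finally show ?thesis by (simp add: mult_2 add_mono order_trans)
qed

lemma powr_minus_le_2:
  fixes x a :: real assumes "1/2 \<le> x" "0 \<le> a" "a \<le> 1"
  shows "x powr (-a) \<le> 2"
proof -
  have "x powr (-a) \<le> (1/2) powr (-a)" using assms by (intro powr_mono2') auto
  also have "\<dots> = 2 powr a" by (simp add: powr_divide powr_minus_divide)
  also have "\<dots> \<le> 2 powr 1" using assms by (intro powr_mono) auto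
  finally show ?thesis by simp
qed

text \<open>Up to a constant, this integral bounds the norm on \<open>L^(1/b,q)\<close> of the one-dimensional operator with kernel
  \<open>|x|^(-\<sigma>) |x - y|^(\<sigma>-1)\<close>.  The three singularities of the integrand, at \<open>1\<close>, \<open>0\<close> and
  \<open>\<infinity>\<close>, are harmless because \<open>\<sigma> > 0\<close>, \<open>b < 1\<close> and \<open>\<sigma> < b\<close>, respectively.\<close>

lemma nn_integral_two_powers_finite:
  fixes \<sigma> b :: real
  assumes \<sigma>: "0 < \<sigma>" "\<sigma> < b" and b: "b < 1"
  shows "(\<integral>\<^sup>+u. ennreal (\<bar>1 - u\<bar> powr (\<sigma> - 1) * \<bar>u\<bar> powr (-b)) \<partial>lborel) < \<infinity>"
proof -
  let ?f1 = "\<lambda>u::real. ennreal (u powr (-b)) * indicator {0..3} u"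
  let ?f2 = "\<lambda>u::real. ennreal (u powr (\<sigma>-1)) * indicator {0..3} u"
  let ?f3 = "\<lambda>u::real. ennreal (u powr (\<sigma>-1-b)) * indicator {2..} u"
  have pw: "ennreal (\<bar>1 - u\<bar> powr (\<sigma> - 1) * \<bar>u\<bar> powr (-b)) \<le> 2 * ?f1 \<bar>u\<bar> + 2 * ?f2 \<bar>1 + (-1) * u\<bar> + 2 * ?f3 \<bar>u\<bar>" for u
  proof (cases "\<bar>u\<bar> < 2")
    case True
    show ?thesis
    proof (cases "1/2 \<le> \<bar>1 - u\<bar>")
      case h: True
      have "\<bar>1 - u\<bar> powr (\<sigma> - 1) \<le> 2"
        using powr_minus_le_2[OF h, of "1 - \<sigma>"] assms by simp
      then have "ennreal (\<bar>1 - u\<bar> powr (\<sigma> - 1) * \<bar>u\<bar> powr (-b)) \<le> ennreal (2 * \<bar>u\<bar> powr (-b))"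
        by (intro ennreal_leI mult_right_mono) auto
      also have "\<dots> = 2 * ?f1 \<bar>u\<bar>" using True by (simp add: ennreal_mult')
      finally show ?thesis by (simp add: add_increasing2 add.assoc)
    next
      case False
      then have h: "1/2 \<le> \<bar>u\<bar>" by linarith
      have "\<bar>u\<bar> powr (-b) \<le> 2"
        using powr_minus_le_2[OF h, of b] assms by simp
      then have "ennreal (\<bar>1 - u\<bar> powr (\<sigma> - 1) * \<bar>u\<bar> powr (-b)) \<le> ennreal (\<bar>1 - u\<bar> powr (\<sigma> - 1) * 2)"
        by (intro ennreal_leI mult_left_mono) auto
      also have "\<dots> = 2 * ?f2 \<bar>1 + (-1) * u\<bar>" using False
        by (simp add: ennreal_mult' mult.commute)
      finally show ?thesis by (meson add_increasing add_increasing2 zero_le order_trans)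
    qed
  next
    case False
    then have "\<bar>u\<bar> / 2 \<le> \<bar>1 - u\<bar>" by linarith
    then have "\<bar>1 - u\<bar> powr (\<sigma> - 1) \<le> (\<bar>u\<bar> / 2) powr (\<sigma> - 1)"
      using False assms by (intro powr_mono2') auto
    also have "\<dots> = \<bar>u\<bar> powr (\<sigma> - 1) * (1/2) powr (-(1-\<sigma>))"
      by (simp add: powr_divide)
    also have "\<dots> \<le> \<bar>u\<bar> powr (\<sigma> - 1) * 2"
      using assms by (intro mult_left_mono powr_minus_le_2) auto
    finally have "ennreal (\<bar>1 - u\<bar> powr (\<sigma> - 1) * \<bar>u\<bar> powr (-b)) \<le> ennreal (\<bar>u\<bar> powr (\<sigma> - 1) * 2 * \<bar>u\<bar> powr (-b))"
      by (intro ennreal_leI mult_right_mono) auto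
    also have "\<bar>u\<bar> powr (\<sigma> - 1) * 2 * \<bar>u\<bar> powr (-b) = 2 * \<bar>u\<bar> powr (\<sigma>-1-b)"
      using False by (simp add: powr_diff powr_minus_divide)
    also have "ennreal \<dots> = 2 * ?f3 \<bar>u\<bar>" using False by (simp add: ennreal_mult')
    finally show ?thesis by (simp add: add_increasing)
  qed
  have i1: "(\<integral>\<^sup>+u. ?f1 u \<partial>lborel) < \<infinity>" and i2: "(\<integral>\<^sup>+u. ?f2 u \<partial>lborel) < \<infinity>"
    and i3: "(\<integral>\<^sup>+u. ?f3 u \<partial>lborel) < \<infinity>"
    using assms nn_integral_powr_near_0_finite[of "-b" 3] nn_integral_powr_near_0_finite[of "\<sigma>-1" 3]
      nn_integral_powr_near_infinity_finite[of "\<sigma>-1-b" 2] by simp_all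
  have e1: "(\<integral>\<^sup>+u. ?f1 \<bar>u\<bar> \<partial>lborel) < \<infinity>" and e3: "(\<integral>\<^sup>+u. ?f3 \<bar>u\<bar> \<partial>lborel) < \<infinity>"
    and e2: "(\<integral>\<^sup>+u. ?f2 \<bar>u\<bar> \<partial>lborel) < \<infinity>"
    by (rule le_less_trans[OF nn_integral_even_le], measurable,
        use i1 i2 i3 in \<open>simp add: ennreal_mult_less_top\<close>)+
  have "(\<integral>\<^sup>+u. ennreal (\<bar>1 - u\<bar> powr (\<sigma> - 1) * \<bar>u\<bar> powr (-b)) \<partial>lborel)
      \<le> (\<integral>\<^sup>+u. 2 * ?f1 \<bar>u\<bar> + 2 * ?f2 \<bar>1 + (-1) * u\<bar> + 2 * ?f3 \<bar>u\<bar> \<partial>lborel)"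
    by (intro nn_integral_mono pw)
  also have "\<dots> = 2 * (\<integral>\<^sup>+u. ?f1 \<bar>u\<bar> \<partial>lborel) + 2 * (\<integral>\<^sup>+u. ?f2 \<bar>1 + (-1) * u\<bar> \<partial>lborel) + 2 * (\<integral>\<^sup>+u. ?f3 \<bar>u\<bar> \<partial>lborel)"
    by (subst nn_integral_cmult[symmetric], measurable)+
       (subst nn_integral_add[symmetric], measurable)+
  also have "(\<integral>\<^sup>+u. ?f2 \<bar>1 + (-1) * u\<bar> \<partial>lborel) = (\<integral>\<^sup>+u. ?f2 \<bar>u\<bar> \<partial>lborel)"
    by (subst (2) nn_integral_real_affine[where c="-1" and t=1]) auto
  also have "2 * (\<integral>\<^sup>+u. ?f1 \<bar>u\<bar> \<partial>lborel) + 2 * (\<integral>\<^sup>+u. ?f2 \<bar>u\<bar> \<partial>lborel) + 2 * (\<integral>\<^sup>+u. ?f3 \<bar>u\<bar> \<partial>lborel) < \<infinity>"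
    using e1 e2 e3 by (simp only: ennreal_mult_less_top ennreal_add_less_top infinity_ennreal_def) simp
  finally show ?thesis .
qed

lemma exp_minus_le_powr:
  fixes x a :: real assumes "0 < x" "0 < a"
  shows "exp (- x) \<le> a powr a * x powr (- a)"
proof -
  have "x / a \<le> exp (x / a)" using exp_ge_add_one_self[of "x / a"] by linarith
  then have "(x / a) powr a \<le> exp (x / a) powr a" using assms by (intro powr_mono2) auto
  also have "\<dots> = exp x" using assms by (simp add: powr_def)
  finally have "x powr a \<le> a powr a * exp x" using assms by (simp add: powr_divide field_simps)
  then show ?thesis using assms by (simp add: exp_minus powr_minus field_simps)
qed

lemma nn_integral_powr_exp_finite:
  fixes s :: real assumes "0 < s"
  shows "(\<integral>\<^sup>+r\<in>{0<..}. ennreal (r powr (s - 1) * exp (- (r\<^sup>2 / 2))) \<partial>lborel) < \<infinity>"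
proof -
  define C where "C = s powr s * (1/2) powr (- s)"
  have C: "0 \<le> C" by (simp add: C_def)
  have "(\<integral>\<^sup>+r\<in>{0<..}. ennreal (r powr (s - 1) * exp (- (r\<^sup>2 / 2))) \<partial>lborel)
    \<le> (\<integral>\<^sup>+r. ennreal (r powr (s - 1)) * indicator {0..1} r
         + ennreal C * (ennreal (r powr (- s - 1)) * indicator {1..} r) \<partial>lborel)"
  proof (intro nn_integral_mono)
    fix r :: real
    show "ennreal (r powr (s - 1) * exp (- (r\<^sup>2 / 2))) * indicator {0<..} r
      \<le> ennreal (r powr (s - 1)) * indicator {0..1} r
         + ennreal C * (ennreal (r powr (- s - 1)) * indicator {1..} r)"
    proof (cases "0 < r \<and> r \<le> 1")
      case True
      then have "ennreal (r powr (s - 1) * exp (- (r\<^sup>2 / 2))) \<le> ennreal (r powr (s - 1))"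
        by (intro ennreal_leI) (auto intro!: mult_left_le)
      then show ?thesis using True by (auto simp: indicator_def intro: add_increasing2)
    next
      case False
      show ?thesis
      proof (cases "0 < r")
        case pos: True
        have "r powr (s - 1) * exp (- (r\<^sup>2 / 2)) \<le> r powr (s - 1) * (s powr s * (r\<^sup>2 / 2) powr (- s))"
          using pos assms by (intro mult_left_mono exp_minus_le_powr) auto
        also have "(r\<^sup>2 / 2) powr (- s) = (1/2) powr (- s) * r powr (- 2 * s)"
          using pos by (simp add: powr_divide powr_powr powr_numeral[symmetric] del: powr_numeral)
        also have "r powr (s - 1) * (s powr s * ((1/2) powr (- s) * r powr (- 2 * s)))
            = C * (r powr (s - 1) * r powr (- 2 * s))" by (simp add: C_def)
        also have "r powr (s - 1) * r powr (- 2 * s) = r powr (- s - 1)"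
          by (simp add: powr_add[symmetric])
        finally have "ennreal (r powr (s - 1) * exp (- (r\<^sup>2 / 2))) \<le> ennreal (C * r powr (- s - 1))"
          by (rule ennreal_leI)
        then show ?thesis using False pos C by (simp add: ennreal_mult')
      qed simp
    qed
  qed
  also have "\<dots> = (\<integral>\<^sup>+r\<in>{0..1}. ennreal (r powr (s - 1)) \<partial>lborel)
      + ennreal C * (\<integral>\<^sup>+r\<in>{1..}. ennreal (r powr (- s - 1)) \<partial>lborel)"
    by (subst nn_integral_cmult[symmetric], measurable) (rule nn_integral_add, auto)
  also have "\<dots> < \<infinity>"
    using nn_integral_powr_near_0_finite[of "s - 1" 1] nn_integral_powr_near_infinity_finite[of "- s - 1" 1] assms
    by (auto simp: ennreal_mult_less_top)
  finally show ?thesis .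
qed

lemma nn_integral_powr_exp_inverse_finite:
  fixes a :: real assumes "a < - 1"
  shows "(\<integral>\<^sup>+r\<in>{0<..}. ennreal (r powr a * exp (- (1 / (2 * r\<^sup>2)))) \<partial>lborel) < \<infinity>"
proof -
  define b where "b = - a / 2"
  define C where "C = b powr b * (1/2) powr (- b)"
  have b: "0 < b" using assms by (simp add: b_def)
  have C: "0 \<le> C" by (simp add: C_def)
  have "(\<integral>\<^sup>+r\<in>{0<..}. ennreal (r powr a * exp (- (1 / (2 * r\<^sup>2)))) \<partial>lborel)
    \<le> (\<integral>\<^sup>+r. ennreal C * indicator {0..1} r + ennreal (r powr a) * indicator {1..} r \<partial>lborel)"
  proof (intro nn_integral_mono)
    fix r :: real
    show "ennreal (r powr a * exp (- (1 / (2 * r\<^sup>2)))) * indicator {0<..} r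
      \<le> ennreal C * indicator {0..1} r + ennreal (r powr a) * indicator {1..} r"
    proof (cases "1 \<le> r")
      case True
      then have "ennreal (r powr a * exp (- (1 / (2 * r\<^sup>2)))) \<le> ennreal (r powr a)"
        by (intro ennreal_leI) (auto intro!: mult_left_le)
      then show ?thesis using True by (auto simp: indicator_def intro: add_increasing)
    next
      case False
      show ?thesis
      proof (cases "0 < r")
        case pos: True
        have "r powr a * exp (- (1 / (2 * r\<^sup>2))) \<le> r powr a * (b powr b * (1 / (2 * r\<^sup>2)) powr (- b))"
          using pos b by (intro mult_left_mono exp_minus_le_powr) auto
        also have "(1 / (2 * r\<^sup>2)) powr (- b) = (1/2) powr (- b) * r powr (2 * b)"
          using pos by (simp add: powr_divide powr_mult powr_powr powr_minus_divide powr_numeral[symmetric] del: powr_numeral)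
        also have "r powr a * (b powr b * ((1/2) powr (- b) * r powr (2 * b)))
            = C * (r powr a * r powr (2 * b))" by (simp add: C_def)
        also have "r powr a * r powr (2 * b) = 1"
          using pos by (simp add: powr_add[symmetric] b_def)
        finally have "ennreal (r powr a * exp (- (1 / (2 * r\<^sup>2)))) \<le> ennreal C"
          by (intro ennreal_leI) simp
        then show ?thesis using False pos C by (simp add: ennreal_mult')
      qed simp
    qed
  qed
  also have "\<dots> = ennreal C * (\<integral>\<^sup>+r. indicator {0..1::real} r \<partial>lborel)
      + (\<integral>\<^sup>+r\<in>{1..}. ennreal (r powr a) \<partial>lborel)"
    by (subst nn_integral_cmult[symmetric], measurable) (rule nn_integral_add, auto)
  also have "\<dots> < \<infinity>"
    using nn_integral_powr_near_infinity_finite[of a 1] assms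
    by (auto simp: ennreal_mult_less_top)
  finally show ?thesis .
qed

section \<open>Integration over vectors, coordinate by coordinate\<close>

lemma borel_measurable_vec_nth [measurable (raw)]:
  fixes f :: "'a \<Rightarrow> real^'n::finite"
  assumes "f \<in> borel_measurable M"
  shows "(\<lambda>x. f x $ i) \<in> borel_measurable M"
  by (rule measurable_compose[OF assms]) (intro borel_measurable_continuous_onI continuous_intros)

lemma borel_measurable_vec_lambda [measurable (raw)]:
  fixes f :: "'n::finite \<Rightarrow> 'a \<Rightarrow> real"
  assumes "\<And>i. f i \<in> borel_measurable M"
  shows "(\<lambda>x. \<chi> i. f i x) \<in> borel_measurable M"
  using assms by (subst borel_measurable_euclidean_space) (auto simp: Basis_vec_def inner_axis)

lemma AE_lborel_nth_neq: "AE x in lborel. (x :: real^'n::finite) $ i \<noteq> c"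
proof -
  have "negligible {x :: real^'n. x \<bullet> axis i 1 = c}"
    by (intro negligible_standard_hyperplane) (auto simp: axis_in_Basis_iff)
  then have "{x :: real^'n. x $ i = c} \<in> null_sets lebesgue"
    by (simp add: inner_axis negligible_iff_null_sets)
  moreover have "{x :: real^'n. x $ i = c} \<in> sets lborel" by simp
  ultimately have "{x :: real^'n. x $ i = c} \<in> null_sets lborel"
    by (simp add: null_sets_completion_iff)
  from AE_not_in[OF this] show ?thesis by simp
qed

lemma prod_Basis_vec:
  "(\<Prod>b\<in>(Basis :: (real^'n::finite) set). h b) = (\<Prod>i\<in>UNIV. h (axis i 1))"
proof -
  have B: "(Basis :: (real^'n) set) = range (\<lambda>i. axis i 1)"
    by (auto simp: Basis_vec_def)
  show ?thesis unfolding B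
    by (simp add: prod.reindex inj_on_def axis_eq_axis)
qed

lemma nn_integral_lborel_prod_vec:
  fixes f :: "'n::finite \<Rightarrow> real \<Rightarrow> ennreal"
  assumes [measurable]: "\<And>i. f i \<in> borel_measurable borel"
  shows "(\<integral>\<^sup>+x. (\<Prod>i\<in>UNIV. f i ((x :: real^'n) $ i)) \<partial>lborel) = (\<Prod>i\<in>UNIV. (\<integral>\<^sup>+t. f i t \<partial>lborel))"
proof -
  let ?ix = "\<lambda>b :: real^'n. SOME i. b = axis i 1"
  have ix: "?ix (axis i 1) = i" for i :: 'n
    by (simp add: axis_eq_axis)
  have "(\<integral>\<^sup>+x. (\<Prod>b\<in>Basis. f (?ix b) ((x :: real^'n) \<bullet> b)) \<partial>lborel) = (\<Prod>b\<in>Basis. (\<integral>\<^sup>+t. f (?ix b) t \<partial>lborel))"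
    by (rule nn_integral_lborel_prod) auto
  then show ?thesis by (simp add: prod_Basis_vec ix inner_axis)
qed


lemma lborel_integral_prod_vec:
  fixes f :: "'n::finite \<Rightarrow> real \<Rightarrow> complex"
  assumes int: "\<And>i. integrable lborel (f i)"
  shows "(LINT x|lborel. (\<Prod>i\<in>UNIV. f i ((x :: real^'n) $ i))) = (\<Prod>i\<in>UNIV. LINT t|lborel. f i t)"
proof -
  interpret product_sigma_finite "\<lambda>_ :: real^'n. lborel :: real measure" ..
  let ?ix = "\<lambda>b :: real^'n. SOME i. b = axis i 1"
  have ix: "?ix (axis i 1) = i" for i :: 'n
    by (simp add: axis_eq_axis)
  have [measurable]: "f i \<in> borel_measurable borel" for i
    using int[of i] by auto
  have "(LINT x|lborel. (\<Prod>i\<in>UNIV. f i ((x :: real^'n) $ i))) =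
      (LINT x|lborel. (\<Prod>b\<in>Basis. f (?ix b) ((x :: real^'n) \<bullet> b)))"
    by (simp add: prod_Basis_vec ix inner_axis)
  also have "\<dots> = (LINT x|(\<Pi>\<^sub>M b\<in>(Basis :: (real^'n) set). lborel). (\<Prod>b\<in>Basis. f (?ix b) ((\<Sum>c\<in>Basis. x c *\<^sub>R c) \<bullet> b)))"
    by (subst lborel_eq, subst integral_distr) auto
  also have "\<dots> = (LINT x|(\<Pi>\<^sub>M b\<in>(Basis :: (real^'n) set). lborel). (\<Prod>b\<in>Basis. f (?ix b) (x b)))"
    by (intro Bochner_Integration.integral_cong refl prod.cong) simp
  also have "\<dots> = (\<Prod>b\<in>(Basis :: (real^'n) set). LINT t|lborel. f (?ix b) t)"
    by (rule product_integral_prod) (auto simp: int)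
  also have "\<dots> = (\<Prod>i\<in>UNIV. LINT t|lborel. f i t)"
    by (simp add: prod_Basis_vec ix)
  finally show ?thesis .
qed

definition scale_coords :: "real^'n::finite \<Rightarrow> real^'n \<Rightarrow> real^'n" where
  "scale_coords u x = (\<chi> j. u $ j * x $ j)"

lemma scale_coords_nth [simp]: "scale_coords u x $ j = u $ j * x $ j"
  by (simp add: scale_coords_def)

lemma scale_coords_0 [simp]: "scale_coords u 0 = 0"
  by (simp add: vec_eq_iff)

lemma measurable_scale_coords [measurable (raw)]:
  assumes [measurable]: "f \<in> borel_measurable M" "g \<in> borel_measurable M"
  shows "(\<lambda>x. scale_coords (f x) (g x)) \<in> borel_measurable M"
  unfolding scale_coords_def by measurable

lemma nn_integral_lborel_scale_coords:
  fixes h :: "real^'n::finite \<Rightarrow> ennreal"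
  assumes [measurable]: "h \<in> borel_measurable borel" and x: "\<And>j. x $ j \<noteq> 0"
  shows "(\<integral>\<^sup>+z. h z \<partial>lborel) = ennreal (\<Prod>j\<in>UNIV. \<bar>x $ j\<bar>) * (\<integral>\<^sup>+u. h (scale_coords u x) \<partial>lborel)"
proof -
  have T: "0 + (\<Sum>j\<in>Basis. (x \<bullet> j * (u \<bullet> j)) *\<^sub>R j) = scale_coords u x" for u
  proof (rule euclidean_eqI)
    fix b :: "real^'n" assume b: "b \<in> Basis"
    then obtain i where i: "b = axis i 1" by (auto simp: Basis_vec_def)
    have "(0 + (\<Sum>j\<in>Basis. (x \<bullet> j * (u \<bullet> j)) *\<^sub>R j)) \<bullet> b = x \<bullet> b * (u \<bullet> b)"
      using b by (simp add: inner_sum_left inner_Basis if_distrib cong: if_cong)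
    then show "(0 + (\<Sum>j\<in>Basis. (x \<bullet> j * (u \<bullet> j)) *\<^sub>R j)) \<bullet> b = scale_coords u x \<bullet> b"
      by (simp add: i inner_axis)
  qed
  have "(\<Prod>j\<in>Basis. \<bar>x \<bullet> j\<bar>) = (\<Prod>j\<in>UNIV. \<bar>x $ j\<bar>)"
    by (simp add: prod_Basis_vec inner_axis)
  moreover have "lborel = density (distr lborel borel (\<lambda>u. 0 + (\<Sum>j\<in>Basis. (x \<bullet> j * (u \<bullet> j)) *\<^sub>R j))) (\<lambda>_. (\<Prod>j\<in>Basis. \<bar>x \<bullet> j\<bar>))"
    by (rule lborel_affine_euclidean) (use x in \<open>auto simp: Basis_vec_def inner_axis\<close>)
  ultimately have "lborel = density (distr lborel borel (\<lambda>u. scale_coords u x)) (\<lambda>_. ennreal (\<Prod>j\<in>UNIV. \<bar>x $ j\<bar>))"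
    unfolding T by simp
  then have "(\<integral>\<^sup>+z. h z \<partial>lborel) = (\<integral>\<^sup>+z. h z \<partial>density (distr lborel borel (\<lambda>u. scale_coords u x)) (\<lambda>_. ennreal (\<Prod>j\<in>UNIV. \<bar>x $ j\<bar>)))"
    by (rule arg_cong)
  then show ?thesis
    by (simp add: nn_integral_density nn_integral_distr nn_integral_cmult)
qed

section \<open>Decreasing rearrangements\<close>

lemma distr_fun_antimono:
  assumes [measurable]: "g \<in> borel_measurable borel" and "a \<le> b"
  shows "distr_fun g b \<le> distr_fun g a"
  unfolding distr_fun_def using assms(2) by (intro emeasure_mono) auto

lemma distr_fun_eq_lborel:
  assumes [measurable]: "g \<in> borel_measurable borel"
  shows "distr_fun g a = emeasure lborel {x. a < g x}"
  unfolding distr_fun_def by (subst emeasure_completion) auto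

text \<open>By monotonicity of the distribution function, rational levels suffice in the infimum; this is
  what makes the rearrangement of a parametrised function jointly measurable.\<close>

lemma rearrangement_countable:
  assumes g: "g \<in> borel_measurable borel"
  shows "rearrangement g t =
    (INF r\<in>{r::rat. 0 < r}. if distr_fun g (ennreal (of_rat r)) \<le> ennreal t then ennreal (of_rat r) else top)"
    (is "_ = ?R")
proof (rule antisym)
  show "rearrangement g t \<le> ?R"
    unfolding rearrangement_def
  proof (rule INF_greatest)
    fix r :: rat assume "r \<in> {r. 0 < r}"
    then show "(INF \<alpha>\<in>{\<alpha>::real. 0 < \<alpha> \<and> distr_fun g (ennreal \<alpha>) \<le> ennreal t}. ennreal \<alpha>)
      \<le> (if distr_fun g (ennreal (of_rat r)) \<le> ennreal t then ennreal (of_rat r) else top)"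
      by (auto intro!: INF_lower)
  qed
  show "?R \<le> rearrangement g t"
    unfolding rearrangement_def
  proof (rule INF_greatest)
    fix a :: real assume "a \<in> {\<alpha>. 0 < \<alpha> \<and> distr_fun g (ennreal \<alpha>) \<le> ennreal t}"
    then have a: "0 < a" "distr_fun g (ennreal a) \<le> ennreal t" by auto
    show "?R \<le> ennreal a"
    proof (rule ennreal_le_epsilon)
      fix e :: real assume "0 < e"
      then obtain r where r: "a < of_rat r" "of_rat r < a + e"
        using of_rat_dense[of a "a + e"] by auto
      then have r0: "0 < r" using a by (metis less_trans of_rat_0 of_rat_less)
      have "distr_fun g (ennreal (of_rat r)) \<le> distr_fun g (ennreal a)"
        using g r a by (intro distr_fun_antimono ennreal_leI) auto
      then have "distr_fun g (ennreal (of_rat r)) \<le> ennreal t" using a by simp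
      then have "?R \<le> ennreal (of_rat r)"
        using r0 by (intro INF_lower2[of r]) auto
      also have "\<dots> \<le> ennreal (a + e)" using r by (intro ennreal_leI) auto
      also have "\<dots> = ennreal a + ennreal e" using a \<open>0 < e\<close> by simp
      finally show "?R \<le> ennreal a + ennreal e" .
    qed
  qed
qed

lemma measurable_rearrangement [measurable (raw)]:
  fixes H :: "'m \<Rightarrow> 'a::euclidean_space \<Rightarrow> ennreal"
  assumes H: "(\<lambda>(m, x). H m x) \<in> borel_measurable (M \<Otimes>\<^sub>M borel)"
    and f [measurable]: "f \<in> borel_measurable M"
  shows "(\<lambda>m. rearrangement (H m) (f m)) \<in> borel_measurable M"
proof -
  have H' [measurable]: "(\<lambda>(m, x). H m x) \<in> borel_measurable (M \<Otimes>\<^sub>M lborel)"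
    using H by (simp cong: measurable_cong_sets)
  have sec: "H m \<in> borel_measurable borel" if "m \<in> space M" for m
    using measurable_compose[OF measurable_Pair1'[OF that] H] by simp
  have d [measurable]: "(\<lambda>m. emeasure lborel {x. a < H m x}) \<in> borel_measurable M" for a
  proof -
    have "(\<lambda>m. emeasure lborel {x \<in> space lborel. a < H m x}) \<in> borel_measurable M"
      by measurable
    then show ?thesis by simp
  qed
  have "(\<lambda>m. INF r\<in>{r::rat. 0 < r}. if emeasure lborel {x. ennreal (of_rat r) < H m x} \<le> ennreal (f m)
      then ennreal (of_rat r) else top) \<in> borel_measurable M"
    by measurable
  also have "?this \<longleftrightarrow> ?thesis"
    by (intro measurable_cong) (simp add: rearrangement_countable distr_fun_eq_lborel sec)
  finally show ?thesis .
qed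

lemma rearrangement_antimono:
  "s \<le> t \<Longrightarrow> rearrangement g t \<le> rearrangement g s"
  unfolding rearrangement_def
  by (intro INF_superset_mono) (auto intro: order_trans ennreal_leI)

lemma distr_fun_gt_if_lt_rearrangement:
  assumes [measurable]: "g \<in> borel_measurable borel"
    and a: "0 \<le> a" "ennreal a < rearrangement g t"
  shows "ennreal t < distr_fun g (ennreal a)"
proof (rule ccontr)
  assume "\<not> ?thesis"
  then have le: "distr_fun g (ennreal a) \<le> ennreal t" by simp
  have "rearrangement g t \<le> ennreal a"
  proof (rule ennreal_le_epsilon)
    fix e :: real assume "0 < e"
    have "distr_fun g (ennreal (a + e)) \<le> distr_fun g (ennreal a)"
      using \<open>0 < e\<close> by (intro distr_fun_antimono ennreal_leI) auto
    then have "rearrangement g t \<le> ennreal (a + e)"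
      unfolding rearrangement_def using le a \<open>0 < e\<close> by (intro INF_lower) auto
    then show "rearrangement g t \<le> ennreal a + ennreal e" using a \<open>0 < e\<close> by simp
  qed
  then show False using a by simp
qed

lemma le_rearrangement_if_distr_fun_gt:
  assumes [measurable]: "g \<in> borel_measurable borel"
    and "ennreal t < distr_fun g (ennreal a)"
  shows "ennreal a \<le> rearrangement g t"
  unfolding rearrangement_def
proof (rule INF_greatest)
  fix b :: real assume "b \<in> {\<alpha>. 0 < \<alpha> \<and> distr_fun g (ennreal \<alpha>) \<le> ennreal t}"
  then have "distr_fun g (ennreal b) < distr_fun g (ennreal a)" using assms(2) by (auto intro: le_less_trans)
  then show "ennreal a \<le> ennreal b"
    using distr_fun_antimono[of g "ennreal a" "ennreal b"] by (meson assms(1) leD linear distr_fun_antimono)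
qed

lemma nn_integral_layer:
  "(\<integral>\<^sup>+a. indicator {a. 0 < a \<and> ennreal a < c} a \<partial>lborel) = c"
proof (cases c)
  case (real r)
  then have "{a. 0 < a \<and> ennreal a < c} = {0<..<r}" by (auto simp: ennreal_less_iff)
  then show ?thesis using real by simp
next
  case top
  then have "{a. 0 < a \<and> ennreal a < c} = {0<..}" by auto
  moreover have "emeasure lborel {0::real<..} = top"
  proof (rule ccontr)
    assume "emeasure lborel {0::real<..} \<noteq> top"
    then obtain r where r: "emeasure lborel {0::real<..} = ennreal r" "0 \<le> r"
      by (cases "emeasure lborel {0::real<..}") auto
    have "emeasure lborel {0<..<r + 1} \<le> emeasure lborel {0::real<..}"
      by (intro emeasure_mono) auto
    then show False using r by simp
  qed
  ultimately show ?thesis using top by simp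
qed

text \<open>The easy half of the Hardy--Littlewood inequality: write both sides as integrals over the
  levels of \<open>F\<close>; at each level \<open>a\<close>, the set \<open>E \<inter> {F > a}\<close> has measure at most
  \<open>min |E| |{F > a}|\<close>.\<close>

lemma nn_integral_le_rearrangement:
  fixes F :: "'a::euclidean_space \<Rightarrow> ennreal"
  assumes F [measurable]: "F \<in> borel_measurable borel" and E [measurable]: "E \<in> sets borel"
    and v: "emeasure lborel E = ennreal v" "0 \<le> v"
  shows "(\<integral>\<^sup>+x\<in>E. F x \<partial>lborel) \<le> (\<integral>\<^sup>+t\<in>{0<..<v}. rearrangement F t \<partial>lborel)"
proof -
  have [measurable]: "rearrangement F \<in> borel_measurable borel"
    using measurable_rearrangement[of "\<lambda>_. F" borel "\<lambda>t. t"] by simp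
  have "(\<integral>\<^sup>+x\<in>E. F x \<partial>lborel) =
      (\<integral>\<^sup>+x. (\<integral>\<^sup>+a. indicator E x * indicator {a. 0 < a \<and> ennreal a < F x} a \<partial>lborel) \<partial>lborel)"
    by (simp add: nn_integral_cmult nn_integral_layer mult.commute del: nn_integral_indicator)
  also have "\<dots> = (\<integral>\<^sup>+a. (\<integral>\<^sup>+x. indicator E x * indicator {a. 0 < a \<and> ennreal a < F x} a \<partial>lborel) \<partial>lborel)"
    by (rule lborel_pair.Fubini'[symmetric]) measurable
  also have "\<dots> \<le> (\<integral>\<^sup>+a. (\<integral>\<^sup>+t. indicator {0<..<v} t * indicator {a. 0 < a \<and> ennreal a \<le> rearrangement F t} a \<partial>lborel) \<partial>lborel)"
  proof (intro nn_integral_mono)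
    fix a :: real
    show "(\<integral>\<^sup>+x. indicator E x * indicator {a. 0 < a \<and> ennreal a < F x} a \<partial>lborel)
      \<le> (\<integral>\<^sup>+t. indicator {0<..<v} t * indicator {a. 0 < a \<and> ennreal a \<le> rearrangement F t} a \<partial>lborel)"
    proof (cases "0 < a")
      case True
      have "(\<integral>\<^sup>+x. indicator E x * indicator {a. 0 < a \<and> ennreal a < F x} a \<partial>lborel)
          = (\<integral>\<^sup>+x. indicator (E \<inter> {x. ennreal a < F x}) x \<partial>lborel)"
        using True by (intro nn_integral_cong) (auto simp: indicator_def)
      also have "\<dots> = emeasure lborel (E \<inter> {x. ennreal a < F x})" by simp
      also have "\<dots> \<le> min (ennreal v) (distr_fun F (ennreal a))"
        by (auto simp: v(1)[symmetric] distr_fun_eq_lborel intro!: emeasure_mono)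
      also have "\<dots> = (\<integral>\<^sup>+t. indicator {t. 0 < t \<and> ennreal t < min (ennreal v) (distr_fun F (ennreal a))} t \<partial>lborel)"
        by (simp only: nn_integral_layer)
      also have "\<dots> \<le> (\<integral>\<^sup>+t. indicator {0<..<v} t * indicator {a. 0 < a \<and> ennreal a \<le> rearrangement F t} a \<partial>lborel)"
        using True le_rearrangement_if_distr_fun_gt[OF F, of _ a]
        by (intro nn_integral_mono) (auto simp: indicator_def ennreal_less_iff)
      finally show ?thesis .
    qed simp
  qed
  also have "\<dots> = (\<integral>\<^sup>+t. (\<integral>\<^sup>+a. indicator {0<..<v} t * indicator {a. 0 < a \<and> ennreal a \<le> rearrangement F t} a \<partial>lborel) \<partial>lborel)"
    by (rule lborel_pair.Fubini') measurable
  also have "\<dots> = (\<integral>\<^sup>+t\<in>{0<..<v}. rearrangement F t \<partial>lborel)"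
  proof (intro nn_integral_cong)
    fix t :: real
    have "(\<integral>\<^sup>+a. indicator {a. 0 < a \<and> ennreal a \<le> rearrangement F t} a \<partial>lborel)
        = (\<integral>\<^sup>+a. indicator {a. 0 < a \<and> ennreal a < rearrangement F t} a \<partial>lborel)"
    proof (rule nn_integral_cong_AE)
      have "AE a in lborel. a \<noteq> enn2real (rearrangement F t)" by (rule AE_lborel_singleton)
      then show "AE a in lborel. (indicator {a. 0 < a \<and> ennreal a \<le> rearrangement F t} a :: ennreal)
          = indicator {a. 0 < a \<and> ennreal a < rearrangement F t} a"
        by eventually_elim (auto simp: indicator_def less_le dest!: arg_cong[where f = enn2real])
    qed
    also have "\<dots> = rearrangement F t" by (rule nn_integral_layer)
    finally show "(\<integral>\<^sup>+a. indicator {0<..<v} t * indicator {a. 0 < a \<and> ennreal a \<le> rearrangement F t} a \<partial>lborel)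
        = rearrangement F t * indicator {0<..<v} t"
      by (subst nn_integral_cmult) (auto simp: mult.commute)
  qed
  finally show ?thesis .
qed

text \<open>On the level set \<open>{f > a}\<close> of \<open>f = \<integral> H m\<close>, of measure \<open>v > t\<close>, the mean value of \<open>f\<close> is at
  least \<open>a\<close>.  It is the integral of the mean values of the \<open>H m\<close>, each of which is at most the mean of
  the rearrangement of \<open>H m\<close> over \<open>(0, v)\<close>, hence over \<open>(0, t)\<close>, as rearrangements decrease.  The
  mean over \<open>(0, t)\<close> is written as an integral over dilations \<open>\<theta> \<in> (0, 1)\<close>, whose effect on the
  Lorentz norm is explicit.\<close>

lemma rearrangement_nn_integral_le:
  fixes H :: "'m \<Rightarrow> 'a::euclidean_space \<Rightarrow> ennreal"
  assumes M: "sigma_finite_measure M"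
    and H [measurable]: "(\<lambda>(m, x). H m x) \<in> borel_measurable (M \<Otimes>\<^sub>M borel)" and t: "0 < t"
  shows "rearrangement (\<lambda>x. \<integral>\<^sup>+m. H m x \<partial>M) t
    \<le> (\<integral>\<^sup>+\<theta>\<in>{0<..<1}. (\<integral>\<^sup>+m. rearrangement (H m) (t * \<theta>) \<partial>M) \<partial>lborel)" (is "rearrangement ?f t \<le> ?R")
proof -
  interpret M: sigma_finite_measure M by fact
  have H' [measurable]: "(\<lambda>(m, x). H m x) \<in> borel_measurable (M \<Otimes>\<^sub>M lborel)"
    using H by (simp cong: measurable_cong_sets)
  have sec [measurable]: "H m \<in> borel_measurable borel" if "m \<in> space M" for m
    using measurable_compose[OF measurable_Pair1'[OF that] H] by simp
  interpret P: pair_sigma_finite M "lborel :: 'a measure" ..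
  interpret Q: pair_sigma_finite M "lborel :: real measure" ..
  have Hs [measurable]: "(\<lambda>(x, m). H m x) \<in> borel_measurable (borel \<Otimes>\<^sub>M M)"
    using measurable_compose[OF measurable_pair_swap' H] by (simp add: case_prod_beta')
  have f [measurable]: "?f \<in> borel_measurable borel"
    by measurable
  have rm: "(\<lambda>(m, \<theta>). rearrangement (H m) (t * \<theta>)) \<in> borel_measurable (M \<Otimes>\<^sub>M lborel)"
    unfolding split_beta' by (rule measurable_rearrangement) measurable
  show ?thesis
  proof (rule dense_le)
    fix y assume y: "y < rearrangement ?f t"
    then obtain a where a: "y = ennreal a" "0 \<le> a" by (cases y) auto
    define L where "L = {x. ennreal a < ?f x}"
    have L [measurable]: "L \<in> sets borel" unfolding L_def by measurable
    have "ennreal t < emeasure lborel L"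
      using distr_fun_gt_if_lt_rearrangement[OF f, of a t] y a by (simp add: L_def distr_fun_eq_lborel)
    \<comment> \<open>Cutting off with a large ball gives a level set of finite measure \<open>v \<ge> t\<close>.\<close>
    moreover have "(\<lambda>n. emeasure lborel (L \<inter> ball 0 (real n))) \<longlonglongrightarrow> emeasure lborel (\<Union>n. L \<inter> ball 0 (real n))"
      by (intro Lim_emeasure_incseq) (auto simp: incseq_def)
    moreover have "(\<Union>n. L \<inter> ball 0 (real n)) = L"
      by (auto intro: reals_Archimedean2)
    ultimately obtain n where n: "ennreal t < emeasure lborel (L \<inter> ball 0 (real n))"
      by (metis (no_types, lifting) eventually_sequentially order_refl order_tendstoD(1))
    define E where "E = L \<inter> ball 0 (real n)"
    have E [measurable]: "E \<in> sets borel" unfolding E_def by measurable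
    have "emeasure lborel E \<le> emeasure lborel (ball (0::'a) (real n))" 
      unfolding E_def by (intro emeasure_mono) auto
    also have "\<dots> < \<infinity>" by (rule emeasure_lborel_ball_finite)
    finally obtain v where v: "emeasure lborel E = ennreal v" "0 \<le> v"
      by (cases "emeasure lborel E") auto
    have tv: "t < v" using n t unfolding E_def[symmetric] v by (simp add: ennreal_less_iff)
    have one: "(\<integral>\<^sup>+x\<in>E. H m x \<partial>lborel) \<le> ennreal v * (\<integral>\<^sup>+\<theta>\<in>{0<..<1}. rearrangement (H m) (t * \<theta>) \<partial>lborel)"
      if m: "m \<in> space M" for m
    proof -
      have [measurable]: "rearrangement (H m) \<in> borel_measurable borel"
        using measurable_rearrangement[of "\<lambda>_. H m" borel "\<lambda>t. t"] m by simp
      have "(\<integral>\<^sup>+x\<in>E. H m x \<partial>lborel) \<le> (\<integral>\<^sup>+t\<in>{0<..<v}. rearrangement (H m) t \<partial>lborel)"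
        using m v by (intro nn_integral_le_rearrangement) auto
      also have "\<dots> = ennreal v * (\<integral>\<^sup>+\<theta>. rearrangement (H m) (v * \<theta>) * indicator {0<..<v} (v * \<theta>) \<partial>lborel)"
        using tv t by (subst nn_integral_lborel_stretch[where c=v]) auto
      also have "\<dots> \<le> ennreal v * (\<integral>\<^sup>+\<theta>\<in>{0<..<1}. rearrangement (H m) (t * \<theta>) \<partial>lborel)"
        using tv t
        by (intro mult_left_mono nn_integral_mono)
           (auto simp: indicator_def zero_less_mult_iff intro!: rearrangement_antimono)
      finally show ?thesis .
    qed
    have "ennreal v * ennreal a = (\<integral>\<^sup>+x\<in>E. ennreal a \<partial>lborel)"
      using v by (simp add: nn_integral_cmult_indicator mult.commute)
    also have "\<dots> \<le> (\<integral>\<^sup>+x\<in>E. ?f x \<partial>lborel)"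
      by (intro nn_integral_mono) (auto simp: indicator_def E_def L_def less_imp_le)
    also have "\<dots> = (\<integral>\<^sup>+x. (\<integral>\<^sup>+m. H m x * indicator E x \<partial>M) \<partial>lborel)"
      by (intro nn_integral_cong) (simp add: indicator_def)
    also have "\<dots> = (\<integral>\<^sup>+m. (\<integral>\<^sup>+x\<in>E. H m x \<partial>lborel) \<partial>M)"
      by (rule P.Fubini') measurable
    also have "\<dots> \<le> (\<integral>\<^sup>+m. ennreal v * (\<integral>\<^sup>+\<theta>\<in>{0<..<1}. rearrangement (H m) (t * \<theta>) \<partial>lborel) \<partial>M)"
      using one by (intro nn_integral_mono) auto
    also have "\<dots> = ennreal v * (\<integral>\<^sup>+m. (\<integral>\<^sup>+\<theta>\<in>{0<..<1}. rearrangement (H m) (t * \<theta>) \<partial>lborel) \<partial>M)"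
      using rm by (intro nn_integral_cmult) measurable
    also have "(\<integral>\<^sup>+m. (\<integral>\<^sup>+\<theta>\<in>{0<..<1}. rearrangement (H m) (t * \<theta>) \<partial>lborel) \<partial>M)
        = (\<integral>\<^sup>+\<theta>. (\<integral>\<^sup>+m. rearrangement (H m) (t * \<theta>) * indicator {0<..<1} \<theta> \<partial>M) \<partial>lborel)"
      using rm by (intro Q.Fubini'[symmetric]) measurable
    also have "\<dots> = ?R"
      by (intro nn_integral_cong) (simp add: indicator_def)
    finally have "ennreal v * ennreal a \<le> ennreal v * ?R" .
    then show "y \<le> ?R"
      using tv t a by (subst (asm) ennreal_mult_le_mult_iff) auto
  qed
qed

section \<open>Lorentz norms\<close>

text \<open>With this weight the \<open>L^(p,q)\<close> norm is an \<open>L\<^sup>q\<close> norm with respect to \<open>dt\<close> rather than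
  \<open>dt / t\<close>; the value \<open>0\<close> on the negative half-line absorbs the restriction to \<open>t > 0\<close>.\<close>

definition lorentz_weight :: "real \<Rightarrow> real \<Rightarrow> real \<Rightarrow> real" where
  "lorentz_weight p q t = (if 0 < t then t powr (1 / p - 1 / q) else 0)"

lemma measurable_lorentz_weight [measurable]: "lorentz_weight p q \<in> borel_measurable borel"
  unfolding lorentz_weight_def by measurable

lemma lorentz_weight_nonneg [simp]: "0 \<le> lorentz_weight p q t"
  by (simp add: lorentz_weight_def)

lemma lorentz_norm_weighted_Lq:
  assumes "0 < q"
  shows "lorentz_norm p q g = ennreal_rpow
    (\<integral>\<^sup>+t. ennreal_rpow (ennreal (lorentz_weight p q t) * rearrangement g t) q \<partial>lborel) (1 / q)"
proof -
  have "ennreal_rpow (ennreal (t powr (1 / p)) * rearrangement g t) q / ennreal t * indicator {0<..} t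
      = ennreal_rpow (ennreal (lorentz_weight p q t) * rearrangement g t) q" for t
  proof (cases "0 < t")
    case True
    have "t powr (q / p) / t = t powr ((1 / p - 1 / q) * q)"
      using True assms by (simp add: left_diff_distrib powr_diff)
    then have "ennreal (t powr (q / p)) / ennreal t = ennreal (t powr ((1 / p - 1 / q) * q))"
      using True by (simp add: divide_ennreal)
    then show ?thesis using True assms
      by (simp add: rpow_mult rpow_ennreal powr_powr lorentz_weight_def)
         (metis divide_ennreal_def mult.assoc mult.commute)
  qed (simp add: lorentz_weight_def)
  then show ?thesis unfolding lorentz_norm_def by simp
qed

lemma weighted_Lq_dilate:
  fixes R :: "real \<Rightarrow> ennreal"
  assumes [measurable]: "R \<in> borel_measurable borel" and q: "0 < q" and c: "0 < c"
  shows "ennreal_rpow (\<integral>\<^sup>+t. ennreal_rpow (ennreal (lorentz_weight p q t) * R (t * c)) q \<partial>lborel) (1 / q)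
    = ennreal (c powr (- (1 / p))) *
      ennreal_rpow (\<integral>\<^sup>+t. ennreal_rpow (ennreal (lorentz_weight p q t) * R t) q \<partial>lborel) (1 / q)"
proof -
  let ?w = "lorentz_weight p q"
  define I where "I = (\<integral>\<^sup>+t. ennreal_rpow (ennreal (?w t) * R (t * c)) q \<partial>lborel)"
  have w: "?w (c * t) = c powr (1 / p - 1 / q) * ?w t" for t
    using c by (auto simp: lorentz_weight_def powr_mult zero_less_mult_iff)
  have "(\<integral>\<^sup>+t. ennreal_rpow (ennreal (?w t) * R t) q \<partial>lborel)
      = ennreal c * (\<integral>\<^sup>+t. ennreal_rpow (ennreal (?w (c * t)) * R (c * t)) q \<partial>lborel)"
    using c by (subst nn_integral_lborel_stretch[where c=c]) auto
  also have "(\<integral>\<^sup>+t. ennreal_rpow (ennreal (?w (c * t)) * R (c * t)) q \<partial>lborel)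
      = (\<integral>\<^sup>+t. ennreal_rpow (ennreal (c powr (1 / p - 1 / q))) q * ennreal_rpow (ennreal (?w t) * R (t * c)) q \<partial>lborel)"
    using q by (intro nn_integral_cong) (simp only: w, simp add: ennreal_mult' rpow_mult mult_ac)
  also have "\<dots> = ennreal_rpow (ennreal (c powr (1 / p - 1 / q))) q * I"
    unfolding I_def by (rule nn_integral_cmult) measurable
  also have "ennreal c * (ennreal_rpow (ennreal (c powr (1 / p - 1 / q))) q * I)
      = ennreal (c * c powr ((1 / p - 1 / q) * q)) * I"
    using c by (simp add: rpow_ennreal powr_powr ennreal_mult' mult.assoc)
  also have "c * c powr ((1 / p - 1 / q) * q) = c powr (q / p)"
    using c q by (simp add: left_diff_distrib powr_diff)
  finally have eq: "(\<integral>\<^sup>+t. ennreal_rpow (ennreal (?w t) * R t) q \<partial>lborel) = ennreal (c powr (q / p)) * I" .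
  have "ennreal (c powr (- (1 / p))) * ennreal_rpow (ennreal (c powr (q / p)) * I) (1 / q)
      = ennreal (c powr (- (1 / p))) * ennreal (c powr (1 / p)) * ennreal_rpow I (1 / q)"
    using q by (simp add: rpow_mult rpow_ennreal powr_powr mult.assoc)
  also have "ennreal (c powr (- (1 / p))) * ennreal (c powr (1 / p)) = 1"
    using c by (simp add: ennreal_mult'[symmetric] powr_add[symmetric])
  finally show ?thesis unfolding eq by (simp add: I_def)
qed

lemma measurable_rearrangement_section:
  fixes g :: "'a::euclidean_space \<Rightarrow> ennreal"
  assumes [measurable]: "g \<in> borel_measurable borel"
  shows "rearrangement g \<in> borel_measurable borel"
  using measurable_rearrangement[of "\<lambda>_. g" borel "\<lambda>t. t"] by simp

lemma measurable_lorentz_norm: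
  fixes H :: "'m \<Rightarrow> 'a::euclidean_space \<Rightarrow> ennreal"
  assumes H [measurable]: "(\<lambda>(m, x). H m x) \<in> borel_measurable (M \<Otimes>\<^sub>M borel)"
  shows "(\<lambda>m. lorentz_norm p q (H m)) \<in> borel_measurable M"
proof -
  have "(\<lambda>(m, t). rearrangement (H m) t) \<in> borel_measurable (M \<Otimes>\<^sub>M lborel)"
    unfolding split_beta' by (rule measurable_rearrangement) measurable
  then show ?thesis unfolding lorentz_norm_def by measurable
qed

text \<open>Minkowski's inequality in \<open>L^(p,q)\<close>, up to a constant.  The rearrangement of an integral is
  bounded by averages of dilated rearrangements, so that Minkowski's inequality in the weighted
  \<open>L^q\<close>, applied to the integral over \<open>\<theta>\<close> and \<open>m\<close> together, also takes the place of Hardy's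
  inequality; the constant is \<open>\<integral>\<^sub>0\<^sup>1 \<theta>^(-1/p) d\<theta>\<close>.\<close>

lemma lorentz_norm_nn_integral_le:
  fixes H :: "'m \<Rightarrow> 'a::euclidean_space \<Rightarrow> ennreal"
  assumes M: "sigma_finite_measure M"
    and H [measurable]: "(\<lambda>(m, x). H m x) \<in> borel_measurable (M \<Otimes>\<^sub>M borel)" and q: "1 < q"
  shows "lorentz_norm p q (\<lambda>x. \<integral>\<^sup>+m. H m x \<partial>M)
    \<le> (\<integral>\<^sup>+\<theta>\<in>{0<..<1}. ennreal (\<theta> powr (- (1 / p))) \<partial>lborel) * (\<integral>\<^sup>+m. lorentz_norm p q (H m) \<partial>M)"
proof -
  interpret M: sigma_finite_measure M by fact
  interpret Q: pair_sigma_finite "lborel :: real measure" M ..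
  let ?w = "lorentz_weight p q"
  define G where "G = (\<lambda>(\<theta>, m) t. indicator {0<..<1} \<theta> * (ennreal (?w t) * rearrangement (H m) (t * \<theta>)))"
  have rm: "(\<lambda>y. rearrangement (H (snd (fst y))) (snd y * fst (fst y))) \<in> borel_measurable ((lborel \<Otimes>\<^sub>M M) \<Otimes>\<^sub>M lborel)"
    by (rule measurable_rearrangement) measurable
  have G [measurable]: "(\<lambda>(m, t). G m t) \<in> borel_measurable ((lborel \<Otimes>\<^sub>M M) \<Otimes>\<^sub>M lborel)"
    unfolding G_def split_beta' using rm by measurable
  have rm2: "(\<lambda>y. rearrangement (H (snd y)) (t * fst y)) \<in> borel_measurable (lborel \<Otimes>\<^sub>M M)" for t
    by (rule measurable_rearrangement) measurable
  have ln [measurable]: "(\<lambda>m. lorentz_norm p q (H m)) \<in> borel_measurable M"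
    by (rule measurable_lorentz_norm) measurable
  have sec: "H m \<in> borel_measurable borel" if "m \<in> space M" for m
    using measurable_compose[OF measurable_Pair1'[OF that] H] by simp
  have pw: "ennreal (?w t) * rearrangement (\<lambda>x. \<integral>\<^sup>+m. H m x \<partial>M) t \<le> (\<integral>\<^sup>+y. G y t \<partial>(lborel \<Otimes>\<^sub>M M))" for t
  proof (cases "0 < t")
    case True
    have "ennreal (?w t) * rearrangement (\<lambda>x. \<integral>\<^sup>+m. H m x \<partial>M) t
        \<le> ennreal (?w t) * (\<integral>\<^sup>+\<theta>\<in>{0<..<1}. (\<integral>\<^sup>+m. rearrangement (H m) (t * \<theta>) \<partial>M) \<partial>lborel)"
      using M H True by (intro mult_left_mono rearrangement_nn_integral_le) auto
    also have "(\<integral>\<^sup>+\<theta>\<in>{0<..<1}. (\<integral>\<^sup>+m. rearrangement (H m) (t * \<theta>) \<partial>M) \<partial>lborel)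
        = (\<integral>\<^sup>+\<theta>. (\<integral>\<^sup>+m. indicator {0<..<1} \<theta> * rearrangement (H m) (t * \<theta>) \<partial>M) \<partial>lborel)"
      by (intro nn_integral_cong) (simp add: indicator_def)
    also have "\<dots> = (\<integral>\<^sup>+y. indicator {0<..<1} (fst y) * rearrangement (H (snd y)) (t * fst y) \<partial>(lborel \<Otimes>\<^sub>M M))"
      by (subst M.nn_integral_fst[symmetric]) (use rm2 in \<open>auto\<close>)
    also have "ennreal (?w t) * \<dots> = (\<integral>\<^sup>+y. ennreal (?w t) * (indicator {0<..<1} (fst y) * rearrangement (H (snd y)) (t * fst y)) \<partial>(lborel \<Otimes>\<^sub>M M))"
      using rm2 by (intro nn_integral_cmult[symmetric]) measurable
    also have "\<dots> = (\<integral>\<^sup>+y. G y t \<partial>(lborel \<Otimes>\<^sub>M M))"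
      by (intro nn_integral_cong) (simp add: G_def split_beta' mult_ac)
    finally show ?thesis .
  qed (simp add: lorentz_weight_def)
  have "lorentz_norm p q (\<lambda>x. \<integral>\<^sup>+m. H m x \<partial>M)
     \<le> ennreal_rpow (\<integral>\<^sup>+t. ennreal_rpow (\<integral>\<^sup>+y. G y t \<partial>(lborel \<Otimes>\<^sub>M M)) q \<partial>lborel) (1 / q)"
    using q by (subst lorentz_norm_weighted_Lq) (auto intro!: rpow_mono nn_integral_mono pw)
  also have "\<dots> \<le> (\<integral>\<^sup>+y. ennreal_rpow (\<integral>\<^sup>+t. ennreal_rpow (G y t) q \<partial>lborel) (1 / q) \<partial>(lborel \<Otimes>\<^sub>M M))"
    using q G by (intro Minkowski_nn_integral) (auto simp: sigma_finite_lborel Q.sigma_finite_measure_axioms)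
  also have "\<dots> = (\<integral>\<^sup>+y. (indicator {0<..<1} (fst y) * ennreal (fst y powr (- (1 / p)))) * lorentz_norm p q (H (snd y)) \<partial>(lborel \<Otimes>\<^sub>M M))"
  proof (intro nn_integral_cong)
    fix y assume y: "y \<in> space (lborel \<Otimes>\<^sub>M M :: (real \<times> 'm) measure)"
    then have m: "snd y \<in> space M" by (auto simp: space_pair_measure)
    show "ennreal_rpow (\<integral>\<^sup>+t. ennreal_rpow (G y t) q \<partial>lborel) (1 / q) =
      (indicator {0<..<1} (fst y) * ennreal (fst y powr (- (1 / p)))) * lorentz_norm p q (H (snd y))"
    proof (cases "fst y \<in> {0<..<1}")
      case True
      then show ?thesis
        using weighted_Lq_dilate[OF measurable_rearrangement_section[OF sec[OF m]], of q "fst y" p] q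
        by (simp add: G_def split_beta' lorentz_norm_weighted_Lq)
    qed (simp add: G_def split_beta')
  qed
  also have "\<dots> = (\<integral>\<^sup>+\<theta>. (\<integral>\<^sup>+m. (indicator {0<..<1} \<theta> * ennreal (\<theta> powr (- (1 / p)))) * lorentz_norm p q (H m) \<partial>M) \<partial>lborel)"
    by (subst M.nn_integral_fst[symmetric]) auto
  also have "\<dots> = (\<integral>\<^sup>+\<theta>\<in>{0<..<1}. ennreal (\<theta> powr (- (1 / p))) \<partial>lborel) * (\<integral>\<^sup>+m. lorentz_norm p q (H m) \<partial>M)"
    by (subst nn_integral_cmult, measurable, subst nn_integral_multc, measurable, simp add: mult.commute)
  finally show ?thesis .
qed

lemma lorentz_norm_mono_AE:
  fixes g h :: "'a::euclidean_space \<Rightarrow> ennreal"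
  assumes q: "0 < q" and h [measurable]: "h \<in> borel_measurable borel"
    and le: "AE x in lborel. g x \<le> h x"
  shows "lorentz_norm p q g \<le> lorentz_norm p q h"
proof -
  have d: "distr_fun g a \<le> distr_fun h a" for a
    unfolding distr_fun_def
  proof (rule emeasure_mono_AE)
    have "AE x in lebesgue. g x \<le> h x" using le by (rule AE_completion)
    then show "AE x in lebesgue. x \<in> {x. a < g x} \<longrightarrow> x \<in> {x. a < h x}"
      by eventually_elim auto
    show "{x. a < h x} \<in> sets lebesgue" by (rule sets_completionI_sets) measurable
  qed
  have "rearrangement g t \<le> rearrangement h t" for t
    unfolding rearrangement_def using d by (intro INF_superset_mono) (auto intro: order_trans)
  then show ?thesis unfolding lorentz_norm_weighted_Lq[OF q] using q
    by (intro rpow_mono nn_integral_mono mult_left_mono) auto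
qed

lemma lorentz_norm_cmult_le:
  fixes g :: "'a::euclidean_space \<Rightarrow> ennreal"
  assumes q: "0 < q" and g [measurable]: "g \<in> borel_measurable borel" and c: "0 \<le> c"
  shows "lorentz_norm p q (\<lambda>x. ennreal c * g x) \<le> ennreal c * lorentz_norm p q g"
proof -
  have r: "rearrangement (\<lambda>x. ennreal c * g x) t \<le> ennreal c * rearrangement g t" for t
  proof (cases "c = 0")
    case True
    have "rearrangement (\<lambda>x. ennreal c * g x) t \<le> 0"
    proof (rule ennreal_le_epsilon)
      fix e :: real assume "0 < e"
      then show "rearrangement (\<lambda>x. ennreal c * g x) t \<le> 0 + ennreal e"
        unfolding rearrangement_def add_0_left True by (intro INF_lower) (simp add: distr_fun_def)
    qed
    then show ?thesis by (simp add: True)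
  next
    case False
    then have c: "0 < c" using assms by simp
    have "rearrangement (\<lambda>x. ennreal c * g x) t / ennreal c \<le> rearrangement g t"
      unfolding rearrangement_def[of g]
    proof (rule INF_greatest)
      fix b :: real assume "b \<in> {\<alpha>. 0 < \<alpha> \<and> distr_fun g (ennreal \<alpha>) \<le> ennreal t}"
      then have b: "0 < b" "distr_fun g (ennreal b) \<le> ennreal t" by auto
      have "{x. ennreal (c * b) < ennreal c * g x} = {x. ennreal b < g x}"
        using c b ennreal_mult_le_mult_iff[of "ennreal c" _ "ennreal b"]
        by (auto simp: ennreal_mult' not_le[symmetric] simp del: not_le)
      then have "distr_fun (\<lambda>x. ennreal c * g x) (ennreal (c * b)) \<le> ennreal t"
        using b by (simp add: distr_fun_def)
      then have "rearrangement (\<lambda>x. ennreal c * g x) t \<le> ennreal (c * b)"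
        unfolding rearrangement_def using b c by (intro INF_lower) auto
      then have "rearrangement (\<lambda>x. ennreal c * g x) t / ennreal c \<le> ennreal (c * b) / ennreal c"
        by (rule divide_right_mono_ennreal)
      also have "\<dots> = ennreal b" using c b by (simp add: divide_ennreal)
      finally show "rearrangement (\<lambda>x. ennreal c * g x) t / ennreal c \<le> ennreal b" .
    qed
    then have "ennreal c * (rearrangement (\<lambda>x. ennreal c * g x) t / ennreal c) \<le> ennreal c * rearrangement g t"
      by (rule mult_left_mono) simp
    then show ?thesis using c
      by (simp add: ennreal_times_divide mult.commute[of "ennreal c"] ennreal_mult_divide_eq)
  qed
  have "lorentz_norm p q (\<lambda>x. ennreal c * g x)
      \<le> ennreal_rpow (\<integral>\<^sup>+t. ennreal_rpow (ennreal c * (ennreal (lorentz_weight p q t) * rearrangement g t)) q \<partial>lborel) (1 / q)"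
    unfolding lorentz_norm_weighted_Lq[OF q] using q r
    by (intro rpow_mono nn_integral_mono) (auto simp: mult.left_commute[of "ennreal c"] intro!: mult_left_mono)
  also have "\<dots> = ennreal c * lorentz_norm p q g"
    unfolding lorentz_norm_weighted_Lq[OF q] using q c measurable_rearrangement_section[OF g]
    by (simp add: rpow_mult nn_integral_cmult rpow_rpow)
  finally show ?thesis .
qed

lemma lorentz_norm_dilate:
  fixes g :: "real \<Rightarrow> ennreal"
  assumes q: "0 < q" and g [measurable]: "g \<in> borel_measurable borel" and u: "u \<noteq> 0"
  shows "lorentz_norm p q (\<lambda>t. g (u * t)) = ennreal (\<bar>u\<bar> powr (- (1 / p))) * lorentz_norm p q g"
proof -
  have d: "distr_fun g a = ennreal \<bar>u\<bar> * distr_fun (\<lambda>t. g (u * t)) a" for a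
  proof -
    have "distr_fun g a = (\<integral>\<^sup>+x. indicator {x. a < g x} x \<partial>lborel)"
      by (simp add: distr_fun_eq_lborel)
    also have "\<dots> = ennreal \<bar>u\<bar> * (\<integral>\<^sup>+x. indicator {x. a < g x} (u * x) \<partial>lborel)"
      using u by (intro nn_integral_lborel_stretch) measurable
    also have "(\<integral>\<^sup>+x. indicator {x. a < g x} (u * x) \<partial>lborel) = (\<integral>\<^sup>+x. indicator {x. a < g (u * x)} x \<partial>lborel)"
      by (intro nn_integral_cong) (simp add: indicator_def)
    also have "\<dots> = distr_fun (\<lambda>t. g (u * t)) a"
      by (simp add: distr_fun_eq_lborel)
    finally show ?thesis .
  qed
  have r: "rearrangement (\<lambda>t. g (u * t)) t = rearrangement g (t * \<bar>u\<bar>)" if "0 < t" for t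
  proof -
    have "distr_fun (\<lambda>t. g (u * t)) a \<le> ennreal t \<longleftrightarrow> distr_fun g a \<le> ennreal (t * \<bar>u\<bar>)" for a
      using u that unfolding d by (simp add: ennreal_mult' mult.commute[of t] ennreal_mult_le_mult_iff)
    then show ?thesis unfolding rearrangement_def by simp
  qed
  have "lorentz_norm p q (\<lambda>t. g (u * t)) = ennreal_rpow
    (\<integral>\<^sup>+t. ennreal_rpow (ennreal (lorentz_weight p q t) * rearrangement g (t * \<bar>u\<bar>)) q \<partial>lborel) (1 / q)"
    unfolding lorentz_norm_weighted_Lq[OF q]
    by (intro arg_cong[where f = "\<lambda>I. ennreal_rpow I (1 / q)"] nn_integral_cong)
       (auto simp: r lorentz_weight_def)
  also have "\<dots> = ennreal (\<bar>u\<bar> powr (- (1 / p))) * lorentz_norm p q g"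
    unfolding lorentz_norm_weighted_Lq[OF q]
    using u q by (intro weighted_Lq_dilate measurable_rearrangement_section) auto
  finally show ?thesis .
qed

section \<open>Mixed norms of integrals of dilates\<close>

lemma measurable_lorentz_in_coord [measurable]:
  assumes [measurable]: "F \<in> borel_measurable borel"
  shows "lorentz_in_coord p q i F \<in> borel_measurable borel"
proof -
  have "(\<lambda>(x, t). F (\<chi> j. if j = i then t else x $ j)) \<in> borel_measurable (borel \<Otimes>\<^sub>M borel)"
    unfolding split_beta' if_distrib by measurable
  then show ?thesis
    unfolding lorentz_in_coord_def by (rule measurable_lorentz_norm)
qed

definition hardy_const :: "real \<Rightarrow> real" where
  "hardy_const p = enn2real (\<integral>\<^sup>+\<theta>\<in>{0<..<1}. ennreal (\<theta> powr (- (1 / p))) \<partial>lborel)"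

lemma hardy_const:
  assumes "1 < p"
  shows "(\<integral>\<^sup>+\<theta>\<in>{0<..<1}. ennreal (\<theta> powr (- (1 / p))) \<partial>lborel) = ennreal (hardy_const p)"
proof -
  have "(\<integral>\<^sup>+\<theta>\<in>{0<..<1}. ennreal (\<theta> powr (- (1 / p))) \<partial>lborel) \<le> (\<integral>\<^sup>+\<theta>\<in>{0..1}. ennreal (\<theta> powr (- (1 / p))) \<partial>lborel)"
    by (intro nn_integral_mono) (auto simp: indicator_def)
  also have "\<dots> < \<infinity>" using assms by (intro nn_integral_powr_near_0_finite) auto
  finally show ?thesis by (simp add: hardy_const_def)
qed

lemma hardy_const_nonneg: "0 \<le> hardy_const p"
  by (simp add: hardy_const_def)

text \<open>One step of the iteration.  The norm in the \<open>i\<close>-th variable is moved inside the integral over the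
  dilations, where it commutes with the dilations of the other variables and turns the dilation of the
  \<open>i\<close>-th variable by \<open>u $ i\<close> into the factor \<open>\<bar>u $ i\<bar> powr (- (1 / p))\<close>.  The bound is only assumed off
  the coordinate hyperplanes: on the line through \<open>x\<close> in direction \<open>i\<close> this excludes one point, and
  the condition on that coordinate disappears with the variable.\<close>

lemma lorentz_in_coord_dilates_le:
  fixes F N :: "real^'n::finite \<Rightarrow> ennreal" and W :: "real^'n \<Rightarrow> real"
  assumes [measurable]: "N \<in> borel_measurable borel" "W \<in> borel_measurable borel"
    and W: "\<And>u. 0 \<le> W u" and C: "0 \<le> C" and p: "1 < p" and q: "1 < q"
    and bound: "\<And>x. (\<forall>j\<in>insert i S. x $ j \<noteq> 0) \<Longrightarrow>
      F x \<le> ennreal C * (\<integral>\<^sup>+u. ennreal (W u) * N (scale_coords u x) \<partial>lborel)"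
    and x: "\<forall>j\<in>S. x $ j \<noteq> 0"
  shows "lorentz_in_coord p q i F x \<le> ennreal (hardy_const p * C) *
    (\<integral>\<^sup>+u. ennreal (W u * \<bar>u $ i\<bar> powr (- (1 / p))) * lorentz_in_coord p q i N (scale_coords u x) \<partial>lborel)"
proof -
  let ?upd = "\<lambda>(y :: real^'n) t. \<chi> j. if j = i then t else y $ j"
  define H where "H u t = ennreal (C * W u) * N (scale_coords u (?upd x t))" for u t
  have H [measurable]: "(\<lambda>(u, t). H u t) \<in> borel_measurable (lborel \<Otimes>\<^sub>M borel)"
    unfolding H_def split_beta' by measurable
  have Hs [measurable]: "(\<lambda>(t, u). H u t) \<in> borel_measurable (borel \<Otimes>\<^sub>M lborel)"
    unfolding H_def split_beta' by measurable
  have "AE t in lborel. F (?upd x t) \<le> (\<integral>\<^sup>+u. H u t \<partial>lborel)"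
    using AE_lborel_singleton[of "0 :: real"]
  proof eventually_elim
    case (elim t)
    have "F (?upd x t) \<le> ennreal C * (\<integral>\<^sup>+u. ennreal (W u) * N (scale_coords u (?upd x t)) \<partial>lborel)"
      using x elim by (intro bound) auto
    also have "\<dots> = (\<integral>\<^sup>+u. H u t \<partial>lborel)"
      unfolding H_def using C W
      by (subst nn_integral_cmult[symmetric]) (auto simp: ennreal_mult mult.assoc)
    finally show ?case .
  qed
  then have "lorentz_in_coord p q i F x \<le> lorentz_norm p q (\<lambda>t. \<integral>\<^sup>+u. H u t \<partial>lborel)"
    unfolding lorentz_in_coord_def using q by (intro lorentz_norm_mono_AE) auto
  also have "\<dots> \<le> ennreal (hardy_const p) * (\<integral>\<^sup>+u. lorentz_norm p q (H u) \<partial>lborel)"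
    unfolding hardy_const[OF p, symmetric]
    using H q by (intro lorentz_norm_nn_integral_le sigma_finite_lborel) auto
  also have "(\<integral>\<^sup>+u. lorentz_norm p q (H u) \<partial>lborel) \<le> (\<integral>\<^sup>+u. ennreal C *
      (ennreal (W u * \<bar>u $ i\<bar> powr (- (1 / p))) * lorentz_in_coord p q i N (scale_coords u x)) \<partial>lborel)"
  proof (rule nn_integral_mono_AE)
    show "AE u in lborel. lorentz_norm p q (H u) \<le> ennreal C *
      (ennreal (W u * \<bar>u $ i\<bar> powr (- (1 / p))) * lorentz_in_coord p q i N (scale_coords u x))"
      using AE_lborel_nth_neq[of i 0]
    proof eventually_elim
      case (elim u)
      have upd: "scale_coords u (?upd x t) = ?upd (scale_coords u x) (u $ i * t)" for t
        by (simp add: vec_eq_iff)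
      have "lorentz_norm p q (H u) \<le> ennreal (C * W u) * lorentz_norm p q (\<lambda>t. N (scale_coords u (?upd x t)))"
        unfolding H_def using q C W by (intro lorentz_norm_cmult_le) auto
      also have "lorentz_norm p q (\<lambda>t. N (scale_coords u (?upd x t)))
          = ennreal (\<bar>u $ i\<bar> powr (- (1 / p))) * lorentz_in_coord p q i N (scale_coords u x)"
        unfolding upd lorentz_in_coord_def using q elim
        by (intro lorentz_norm_dilate[where g = "\<lambda>t. N (?upd (scale_coords u x) t)"]) auto
      finally show ?case using C W by (simp add: ennreal_mult mult.assoc)
    qed
  qed
  also have "\<dots> = ennreal C *
      (\<integral>\<^sup>+u. ennreal (W u * \<bar>u $ i\<bar> powr (- (1 / p))) * lorentz_in_coord p q i N (scale_coords u x) \<partial>lborel)"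
    by (intro nn_integral_cmult) measurable
  finally show ?thesis using C hardy_const_nonneg[of p] by (simp add: ennreal_mult mult.assoc mult_left_mono)
qed

lemma fold_lorentz_in_coord_dilates_le:
  fixes F N :: "real^'n::finite \<Rightarrow> ennreal" and W :: "real^'n \<Rightarrow> real" and p q :: "'n \<Rightarrow> real"
  assumes pq: "\<And>i. 1 < p i" "\<And>i. 1 < q i" and "distinct is"
    and "N \<in> borel_measurable borel" "W \<in> borel_measurable borel"
    and "\<And>u. 0 \<le> W u" and "0 \<le> C"
    and "\<And>x. (\<forall>j\<in>set is \<union> S. x $ j \<noteq> 0) \<Longrightarrow>
      F x \<le> ennreal C * (\<integral>\<^sup>+u. ennreal (W u) * N (scale_coords u x) \<partial>lborel)"
    and "\<forall>j\<in>S. x $ j \<noteq> 0"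
  shows "fold (\<lambda>i. lorentz_in_coord (p i) (q i) i) is F x \<le> ennreal (C * (\<Prod>i\<in>set is. hardy_const (p i))) *
    (\<integral>\<^sup>+u. ennreal (W u * (\<Prod>i\<in>set is. \<bar>u $ i\<bar> powr (- (1 / p i)))) *
       fold (\<lambda>i. lorentz_in_coord (p i) (q i) i) is N (scale_coords u x) \<partial>lborel)"
  using assms(3-)
proof (induction "is" arbitrary: F N W C)
  case Nil
  then show ?case by simp
next
  case (Cons i "is")
  note [measurable] = Cons.prems(2,3)
  have "fold (\<lambda>i. lorentz_in_coord (p i) (q i) i) is (lorentz_in_coord (p i) (q i) i F) x
    \<le> ennreal ((hardy_const (p i) * C) * (\<Prod>i\<in>set is. hardy_const (p i))) *
      (\<integral>\<^sup>+u. ennreal ((W u * \<bar>u $ i\<bar> powr (- (1 / p i))) * (\<Prod>i\<in>set is. \<bar>u $ i\<bar> powr (- (1 / p i)))) *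
        fold (\<lambda>i. lorentz_in_coord (p i) (q i) i) is (lorentz_in_coord (p i) (q i) i N) (scale_coords u x) \<partial>lborel)"
  proof (rule Cons.IH)
    fix y :: "real^'n" assume y: "\<forall>j\<in>set is \<union> S. y $ j \<noteq> 0"
    show "lorentz_in_coord (p i) (q i) i F y \<le> ennreal (hardy_const (p i) * C) *
      (\<integral>\<^sup>+u. ennreal (W u * \<bar>u $ i\<bar> powr (- (1 / p i))) * lorentz_in_coord (p i) (q i) i N (scale_coords u y) \<partial>lborel)"
      by (rule lorentz_in_coord_dilates_le[where S="set is \<union> S"])
         (use Cons.prems pq y in auto)
  qed (use Cons.prems hardy_const_nonneg in auto)
  then show ?case using Cons.prems(1) by (simp add: mult_ac)
qed

text \<open>The operator applied to \<open>h\<close> is a superposition of dilations, so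
  Minkowski's inequality in one variable after another bounds its norm by the integral of the norms of
  these dilations.  That integral factorises over the coordinates.\<close>

lemma mixed_lorentz_dilates_bounded:
  fixes p q :: "'n::{finite,linorder} \<Rightarrow> real"
  assumes pq: "\<And>i. 1 < p i" "\<And>i. 1 < q i" and \<sigma>: "0 < \<sigma>" "\<And>i. \<sigma> < 1 / p i" and C: "0 \<le> C"
  shows "\<exists>D::real. D > 0 \<and> (\<forall>f h :: real^'n::{finite,linorder} \<Rightarrow> complex. h \<in> borel_measurable borel \<longrightarrow>
     (\<forall>x. (\<forall>j. x $ j \<noteq> 0) \<longrightarrow> ennreal (norm (f x)) \<le> ennreal C *
       (\<integral>\<^sup>+u. ennreal (\<Prod>i\<in>UNIV. \<bar>1 - u $ i\<bar> powr (\<sigma> - 1)) * ennreal (norm (h (scale_coords u x))) \<partial>lborel)) \<longrightarrow>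
     mixed_lorentz_norm p q f \<le> ennreal D * mixed_lorentz_norm p q h)"
proof -
  define W where "W u = (\<Prod>i\<in>UNIV. \<bar>1 - u $ i\<bar> powr (\<sigma> - 1))" for u :: "real^'n::{finite,linorder}"
  define V where "V u = (\<Prod>i\<in>UNIV. \<bar>u $ i\<bar> powr (- (1 / p i)))" for u :: "real^'n::{finite,linorder}"
  define I where "I = (\<integral>\<^sup>+u. ennreal (W u * V u) \<partial>lborel)"
  have [measurable]: "W \<in> borel_measurable borel" "V \<in> borel_measurable borel"
    unfolding W_def V_def by measurable
  have "I = (\<integral>\<^sup>+u. (\<Prod>i\<in>UNIV. ennreal (\<bar>1 - u $ i\<bar> powr (\<sigma> - 1) * \<bar>u $ i\<bar> powr (- (1 / p i)))) \<partial>lborel)"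
    unfolding I_def W_def V_def by (simp add: prod.distrib[symmetric] prod_ennreal)
  also have "\<dots> = (\<Prod>i\<in>UNIV. (\<integral>\<^sup>+t. ennreal (\<bar>1 - t\<bar> powr (\<sigma> - 1) * \<bar>t\<bar> powr (- (1 / p i))) \<partial>lborel))"
    by (rule nn_integral_lborel_prod_vec) measurable
  also have "\<dots> < \<infinity>"
    using nn_integral_two_powers_finite[OF \<sigma>] pq(1)
    by (auto simp: less_top[symmetric] ennreal_prod_eq_top less_imp_neq divide_less_eq_1 order_less_trans[OF zero_less_one])
  finally obtain J where J: "I = ennreal J" "0 \<le> J" by (cases I) auto
  define E where "E = C * (\<Prod>i\<in>UNIV. hardy_const (p i))"
  have E: "0 \<le> E" unfolding E_def using C hardy_const_nonneg by (simp add: prod_nonneg)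
  show ?thesis
  proof (intro exI[of _ "E * J + 1"] conjI allI impI)
    show "0 < E * J + 1" using E J by (simp add: add_nonneg_pos)
    fix f h :: "real^'n::{finite,linorder} \<Rightarrow> complex"
    assume [measurable]: "h \<in> borel_measurable borel"
      and le: "\<forall>x. (\<forall>j. x $ j \<noteq> 0) \<longrightarrow> ennreal (norm (f x)) \<le> ennreal C *
       (\<integral>\<^sup>+u. ennreal (\<Prod>i\<in>UNIV. \<bar>1 - u $ i\<bar> powr (\<sigma> - 1)) * ennreal (norm (h (scale_coords u x))) \<partial>lborel)"
    let ?is = "sorted_list_of_set (UNIV :: 'n set)"
    let ?N = "fold (\<lambda>i. lorentz_in_coord (p i) (q i) i) ?is (\<lambda>x. ennreal (norm (h x)))"
    have "fold (\<lambda>i. lorentz_in_coord (p i) (q i) i) ?is (\<lambda>x. ennreal (norm (f x))) 0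
      \<le> ennreal (C * (\<Prod>i\<in>set ?is. hardy_const (p i))) *
        (\<integral>\<^sup>+u. ennreal (W u * (\<Prod>i\<in>set ?is. \<bar>u $ i\<bar> powr (- (1 / p i)))) * ?N (scale_coords u 0) \<partial>lborel)"
      using le C pq
      by (intro fold_lorentz_in_coord_dilates_le[where S="{}"]) (auto simp: W_def prod_nonneg)
    also have "\<dots> = ennreal E * (\<integral>\<^sup>+u. ennreal (W u * V u) * ?N 0 \<partial>lborel)"
      by (simp add: V_def E_def)
    also have "\<dots> = ennreal (E * J) * ?N 0"
      using E J by (simp add: nn_integral_multc I_def[symmetric] ennreal_mult mult.assoc)
    also have "\<dots> \<le> ennreal (E * J + 1) * ?N 0"
      by (intro mult_right_mono ennreal_leI) auto
    finally show "mixed_lorentz_norm p q f \<le> ennreal (E * J + 1) * mixed_lorentz_norm p q h"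
      unfolding mixed_lorentz_norm_def .
  qed
qed

section \<open>Decay of Schwartz functions and of their Fourier transforms\<close>

text \<open>The reciprocal of this weight is integrable because it factorises over the coordinates, and
  multiplication by the weight preserves boundedness of Schwartz functions because it is a sum of
  monomials.\<close>

definition quad_weight :: "real^'n::finite \<Rightarrow> real" where
  "quad_weight x = (\<Prod>j\<in>UNIV. 1 + (x $ j)\<^sup>2)"

lemma quad_weight_ge_1: "1 \<le> quad_weight x"
  unfolding quad_weight_def by (intro prod_ge_1) auto

lemma quad_weight_pos [simp]: "0 < quad_weight x"
  using quad_weight_ge_1[of x] by linarith

lemma measurable_quad_weight [measurable]: "quad_weight \<in> borel_measurable borel"
  unfolding quad_weight_def by measurable

lemma integrable_inverse_quad_weight:
  "integrable lborel (\<lambda>x :: real^'n::finite. 1 / quad_weight x)"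
proof -
  have "integrable lborel (\<lambda>t :: real. inverse (1 + t\<^sup>2))"
    using integrable_inverse_1_plus_square by (simp add: set_integrable_def einterval_def)
  then have fin: "(\<integral>\<^sup>+t. ennreal (inverse (1 + t\<^sup>2)) \<partial>lborel) < \<infinity>"
    by (simp add: integrable_iff_bounded)
  have "(\<integral>\<^sup>+x. ennreal (norm (1 / quad_weight (x :: real^'n))) \<partial>lborel)
      = (\<integral>\<^sup>+x. (\<Prod>j\<in>UNIV. ennreal (inverse (1 + ((x :: real^'n) $ j)\<^sup>2))) \<partial>lborel)"
    using quad_weight_pos
    by (intro nn_integral_cong)
       (simp add: less_imp_le quad_weight_def prod_ennreal prod_dividef inverse_eq_divide prod_nonneg)
  also have "\<dots> = (\<Prod>j\<in>(UNIV :: 'n set). \<integral>\<^sup>+t. ennreal (inverse (1 + t\<^sup>2)) \<partial>lborel)"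
    by (rule nn_integral_lborel_prod_vec) auto
  also have "\<dots> < \<infinity>" using fin by (simp add: power_less_top_ennreal)
  finally show ?thesis by (simp add: integrable_iff_bounded)
qed

text \<open>Unit shifts along an axis change the weight by a bounded factor, which makes the decay of a
  derivative pass to difference quotients of step at most \<open>1\<close>.\<close>

lemma quad_weight_shift_le:
  assumes "\<bar>\<theta>\<bar> \<le> 1"
  shows "quad_weight x \<le> 3 * quad_weight (x + \<theta> *\<^sub>R axis i 1)"
proof -
  have nth: "(x + \<theta> *\<^sub>R axis i 1) $ j = x $ j" if "j \<noteq> i" for j
    using that by (simp add: axis_def)
  have ith: "(x + \<theta> *\<^sub>R axis i 1) $ i = x $ i + \<theta>" by (simp add: axis_def)
  have "1 + a\<^sup>2 \<le> 3 * (1 + (a + \<theta>)\<^sup>2)" for a :: real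
  proof -
    have "\<theta>\<^sup>2 \<le> 1" using assms by (simp add: abs_square_le_1)
    moreover have "a\<^sup>2 \<le> 2 * (a + \<theta>)\<^sup>2 + 2 * \<theta>\<^sup>2"
      using zero_le_power2[of "a + 2 * \<theta>"] by (simp add: power2_eq_square algebra_simps)
    moreover have "1 + A \<le> 3 * (1 + X)" if "T \<le> 1" "A \<le> 2 * X + 2 * T" "0 \<le> X" for A X T :: real
      using that by argo
    ultimately show ?thesis using zero_le_power2 by blast
  qed
  then have "quad_weight x \<le> 3 * (1 + ((x + \<theta> *\<^sub>R axis i 1) $ i)\<^sup>2) * (\<Prod>j\<in>UNIV - {i}. 1 + (x $ j)\<^sup>2)"
    unfolding quad_weight_def by (subst prod.remove[of _ i]) (auto simp: ith intro!: mult_right_mono prod_nonneg)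
  also have "\<dots> = 3 * quad_weight (x + \<theta> *\<^sub>R axis i 1)"
  proof -
    have "(\<Prod>j\<in>UNIV - {i}. 1 + (x $ j)\<^sup>2) = (\<Prod>j\<in>UNIV - {i}. 1 + ((x + \<theta> *\<^sub>R axis i 1) $ j)\<^sup>2)"
      by (intro prod.cong refl) (metis nth DiffD2 singletonI)
    then show ?thesis
      unfolding quad_weight_def prod.remove[of UNIV i, OF finite UNIV_I] by (simp only: mult.assoc)
  qed
  finally show ?thesis .
qed

lemma schwartz_differentiable:
  "schwartz f \<Longrightarrow> f differentiable (at x)"
  unfolding schwartz_def by (drule spec[of _ "[]"]) auto

lemma schwartz_pderiv_dir:
  assumes "schwartz f" shows "schwartz (pderiv_dir i f)"
  unfolding schwartz_def
proof
  fix "is" :: "'a list"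
  show "(\<forall>x. foldr pderiv_dir is (pderiv_dir i f) differentiable (at x)) \<and>
           (\<forall>\<beta> :: 'a \<Rightarrow> nat. bounded (range (\<lambda>x.
               complex_of_real (\<Prod>j\<in>UNIV. (x $ j) ^ \<beta> j) * foldr pderiv_dir is (pderiv_dir i f) x)))"
    using assms unfolding schwartz_def by (drule_tac spec[of _ "is @ [i]"]) simp
qed

lemma schwartz_continuous:
  assumes "schwartz f" shows "continuous_on UNIV f"
  using schwartz_differentiable[OF assms]
  by (simp add: continuous_at_imp_continuous_on differentiable_imp_continuous_within)

lemma schwartz_measurable:
  assumes "schwartz f" shows "f \<in> borel_measurable borel"
  using schwartz_continuous[OF assms] by (rule borel_measurable_continuous_onI)

lemma schwartz_decay:
  fixes f :: "real^'n::finite \<Rightarrow> complex"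
  assumes "schwartz f"
  obtains C where "0 \<le> C" "\<And>x. norm (f x) \<le> C / quad_weight x"
proof -
  have "\<exists>B. \<forall>x. norm (complex_of_real (\<Prod>j\<in>A. (x $ j)\<^sup>2) * f x) \<le> B" for A :: "'n set"
  proof -
    have "(\<Prod>j\<in>UNIV. (x $ j) ^ (if j \<in> A then 2 else 0)) = (\<Prod>j\<in>A. (x $ j)\<^sup>2)" for x :: "real^'n"
      by (rule prod.mono_neutral_cong_right) auto
    moreover have "bounded (range (\<lambda>x. complex_of_real (\<Prod>j\<in>UNIV. (x $ j) ^ (if j \<in> A then 2 else 0)) * f x))"
      using assms unfolding schwartz_def by (drule_tac spec[of _ "[]"]) simp
    ultimately show ?thesis unfolding bounded_iff by auto
  qed
  then obtain B where B: "\<And>A x. norm (complex_of_real (\<Prod>j\<in>A. (x $ j)\<^sup>2) * f x) \<le> B A"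
    by metis
  define C where "C = (\<Sum>A\<in>Pow UNIV. B A)"
  have bd: "quad_weight x * norm (f x) \<le> C" for x
  proof -
    have "quad_weight x = (\<Sum>A\<in>Pow UNIV. (\<Prod>j\<in>A. (x $ j)\<^sup>2))"
      unfolding quad_weight_def by (subst add.commute, subst prod_add) auto
    then have "quad_weight x * norm (f x) = (\<Sum>A\<in>Pow UNIV. norm (complex_of_real (\<Prod>j\<in>A. (x $ j)\<^sup>2) * f x))"
      by (simp add: sum_distrib_right norm_mult prod_nonneg abs_prod del: of_real_prod)
    also have "\<dots> \<le> C" unfolding C_def by (intro sum_mono B)
    finally show ?thesis .
  qed
  have "0 \<le> quad_weight (0 :: real^'n) * norm (f 0)" by (simp add: less_imp_le)
  then have "0 \<le> C" using bd[of 0] by linarith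
  then show ?thesis using bd by (intro that) (auto simp: field_simps)
qed

lemma schwartz_integrable:
  fixes f :: "real^'n::finite \<Rightarrow> complex"
  assumes "schwartz f" shows "integrable lborel f"
proof -
  obtain C where C: "0 \<le> C" "\<And>x. norm (f x) \<le> C / quad_weight x"
    using schwartz_decay[OF assms] by blast
  show ?thesis
  proof (rule Bochner_Integration.integrable_bound)
    show "integrable lborel (\<lambda>x :: real^'n. C * (1 / quad_weight x))"
      by (intro integrable_mult_right integrable_inverse_quad_weight)
    show "f \<in> borel_measurable lborel" using schwartz_measurable[OF assms] by simp
    show "AE x in lborel. norm (f x) \<le> norm (C * (1 / quad_weight x))"
      using C by (auto simp: less_imp_le)
  qed
qed

text \<open>The normalising factor \<open>(2\<pi>)^(-n/2)\<close> is left out of the Fourier integrals; it reappears below as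
  the value of the Gaussian density at the origin.\<close>

definition fourier_raw :: "(real^'n::finite \<Rightarrow> complex) \<Rightarrow> real^'n \<Rightarrow> complex" where
  "fourier_raw f \<xi> = (LINT x|lborel. f x * iexp (- (\<xi> \<bullet> x)))"

lemma integrable_mult_iexp:
  fixes f :: "'a::euclidean_space \<Rightarrow> complex"
  assumes f: "integrable lborel f" and [measurable]: "g \<in> borel_measurable borel"
  shows "integrable lborel (\<lambda>x. f x * iexp (g x))"
proof -
  have [measurable]: "f \<in> borel_measurable borel" using f by auto
  show ?thesis
    by (rule Bochner_Integration.integrable_bound[OF f]) (auto simp: norm_mult)
qed

lemma measurable_fourier_raw:
  fixes f :: "real^'n::finite \<Rightarrow> complex"
  assumes [measurable]: "f \<in> borel_measurable borel"
  shows "fourier_raw f \<in> borel_measurable borel"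
  unfolding fourier_raw_def by measurable

lemma norm_fourier_raw_le:
  fixes f :: "real^'n::finite \<Rightarrow> complex"
  assumes "integrable lborel f"
  shows "norm (fourier_raw f \<xi>) \<le> (LINT x|lborel. norm (f x))"
  unfolding fourier_raw_def
  by (rule order_trans[OF integral_norm_bound]) (simp add: norm_mult)

lemma lborel_integral_shift:
  fixes f :: "'a::euclidean_space \<Rightarrow> complex"
  assumes [measurable]: "f \<in> borel_measurable borel"
  shows "(LINT x|lborel. f (c + x)) = (LINT x|lborel. f x)"
  by (subst (2) lborel_distr_plus[of c, symmetric], subst integral_distr) auto

lemma fourier_raw_shift:
  fixes f :: "real^'n::finite \<Rightarrow> complex"
  assumes [measurable]: "f \<in> borel_measurable borel"
  shows "fourier_raw (\<lambda>x. f (x + c)) \<xi> = iexp (\<xi> \<bullet> c) * fourier_raw f \<xi>"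
proof -
  have "fourier_raw (\<lambda>x. f (x + c)) \<xi> = (LINT x|lborel. iexp (\<xi> \<bullet> c) * (f (c + x) * iexp (- (\<xi> \<bullet> (c + x)))))"
    unfolding fourier_raw_def
    by (intro Bochner_Integration.integral_cong refl)
       (simp add: inner_add_right exp_add[symmetric] algebra_simps exp_minus)
  also have "\<dots> = iexp (\<xi> \<bullet> c) * (LINT x|lborel. f (c + x) * iexp (- (\<xi> \<bullet> (c + x))))"
    by simp
  also have "(LINT x|lborel. f (c + x) * iexp (- (\<xi> \<bullet> (c + x)))) = fourier_raw f \<xi>"
    unfolding fourier_raw_def by (rule lborel_integral_shift) measurable
  finally show ?thesis .
qed

lemma schwartz_line_derivative:
  assumes "schwartz f"
  shows "((\<lambda>\<theta>. f (x + \<theta> *\<^sub>R axis i 1)) has_vector_derivative pderiv_dir i f (x + \<theta> *\<^sub>R axis i 1)) (at \<theta>)"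
proof -
  let ?y = "x + \<theta> *\<^sub>R axis i 1"
  have f: "(f has_derivative frechet_derivative f (at ?y)) (at ?y)"
    using schwartz_differentiable[OF assms] frechet_derivative_works by blast
  have "((\<lambda>\<theta>. x + \<theta> *\<^sub>R axis i 1) has_derivative (\<lambda>h. h *\<^sub>R axis i 1)) (at \<theta>)"
    by (auto intro!: derivative_eq_intros)
  from has_derivative_compose[OF this f]
  have "((\<lambda>\<theta>. f (x + \<theta> *\<^sub>R axis i 1)) has_derivative (\<lambda>h. frechet_derivative f (at ?y) (h *\<^sub>R axis i 1))) (at \<theta>)" .
  moreover have "linear (frechet_derivative f (at ?y))"
    using f has_derivative_linear by blast
  ultimately show ?thesis
    by (simp add: has_vector_derivative_def pderiv_dir_def linear_scale)
qed

lemma has_vector_derivative_imp_quotient_limit: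
  fixes g :: "real \<Rightarrow> 'a::real_normed_vector"
  assumes "(g has_vector_derivative d) (at 0)"
  shows "((\<lambda>t. (g t - g 0) /\<^sub>R t) \<longlongrightarrow> d) (at 0)"
proof -
  have "((\<lambda>t. (g t - g 0 - t *\<^sub>R d) /\<^sub>R \<bar>t\<bar>) \<longlongrightarrow> 0) (at 0)"
    using assms by (simp add: has_vector_derivative_def has_derivative_def)
  then have "((\<lambda>t. norm ((g t - g 0 - t *\<^sub>R d) /\<^sub>R \<bar>t\<bar>)) \<longlongrightarrow> 0) (at 0)"
    by (rule tendsto_norm_zero)
  moreover have "\<forall>\<^sub>F t in at 0. norm ((g t - g 0 - t *\<^sub>R d) /\<^sub>R \<bar>t\<bar>) = norm ((g t - g 0) /\<^sub>R t - d)"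
  proof (rule eventually_at_ball'[of 1 0 UNIV, THEN eventually_mono])
    fix t :: real assume "t \<in> ball 0 1 \<and> t \<noteq> 0 \<and> t \<in> UNIV"
    then have "(g t - g 0) /\<^sub>R t - d = (g t - g 0 - t *\<^sub>R d) /\<^sub>R t"
      by (simp add: scaleR_diff_right)
    then show "norm ((g t - g 0 - t *\<^sub>R d) /\<^sub>R \<bar>t\<bar>) = norm ((g t - g 0) /\<^sub>R t - d)"
      by simp
  qed simp
  ultimately have "((\<lambda>t. norm ((g t - g 0) /\<^sub>R t - d)) \<longlongrightarrow> 0) (at 0)"
    by (rule Lim_transform_eventually)
  then show ?thesis
    by (rule LIM_zero_cancel[OF tendsto_norm_zero_cancel])
qed

text \<open>The Fourier integral of a difference quotient is, after a translation, a multiple of the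
  Fourier integral of the function.  Dominated convergence applies because the mean value theorem bounds
  all difference quotients by the decay of the derivative.\<close>

lemma fourier_raw_pderiv_dir:
  fixes f :: "real^'n::finite \<Rightarrow> complex"
  assumes f: "schwartz f"
  shows "fourier_raw (pderiv_dir i f) \<xi> = \<i> * (\<xi> $ i) * fourier_raw f \<xi>"
proof -
  define e where "e k = inverse (real (Suc k))" for k
  have e: "0 < e k" "e k \<le> 1" for k
    by (auto simp: e_def inverse_le_1_iff)
  have e0: "e \<longlonglongrightarrow> 0" unfolding e_def by (rule LIMSEQ_inverse_real_of_nat)
  have e0': "filterlim e (at 0) sequentially"
    using e0 e(1) by (simp add: filterlim_at less_imp_neq[symmetric] less_imp_neq[THEN not_sym])
  define D where "D k x = (f (x + e k *\<^sub>R axis i 1) - f x) /\<^sub>R e k" for k x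
  note [measurable] = schwartz_measurable[OF f] schwartz_measurable[OF schwartz_pderiv_dir[OF f]]
  have [measurable]: "D k \<in> borel_measurable borel" for k unfolding D_def by measurable
  obtain C where C: "0 \<le> C" "\<And>x. norm (pderiv_dir i f x) \<le> C / quad_weight x"
    using schwartz_decay[OF schwartz_pderiv_dir[OF f]] by blast
  have D_lim: "(\<lambda>k. D k x) \<longlonglongrightarrow> pderiv_dir i f x" for x
  proof -
    have "((\<lambda>t. (f (x + t *\<^sub>R axis i 1) - f x) /\<^sub>R t) \<longlongrightarrow> pderiv_dir i f x) (at 0)"
      using has_vector_derivative_imp_quotient_limit[OF schwartz_line_derivative[OF f, of x i 0]] by simp
    from filterlim_compose[OF this e0'] show ?thesis by (simp add: D_def)
  qed
  have D_bound: "norm (D k x) \<le> 3 * C * (1 / quad_weight x)" for k x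
  proof -
    have "\<exists>\<theta>\<in>{0<..<e k}. norm (f (x + e k *\<^sub>R axis i 1) - f (x + 0 *\<^sub>R axis i 1))
        \<le> norm ((e k - 0) *\<^sub>R pderiv_dir i f (x + \<theta> *\<^sub>R axis i 1))"
      using schwartz_line_derivative[OF f, of x i] e[of k]
      by (intro mvt_general continuous_at_imp_continuous_on)
         (auto simp: has_vector_derivative_def intro: has_derivative_continuous)
    then obtain \<theta> where \<theta>: "0 < \<theta>" "\<theta> < e k"
      and le: "norm (f (x + e k *\<^sub>R axis i 1) - f x) \<le> e k * norm (pderiv_dir i f (x + \<theta> *\<^sub>R axis i 1))"
      using e[of k] by auto
    have "norm (D k x) \<le> norm (pderiv_dir i f (x + \<theta> *\<^sub>R axis i 1))"
    proof -
      have "norm (D k x) = norm (f (x + e k *\<^sub>R axis i 1) - f x) / e k"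
        using e[of k] by (simp add: D_def divide_inverse mult.commute)
      then show ?thesis using le e[of k] by (simp add: divide_le_eq mult.commute)
    qed
    also have "\<dots> \<le> C / quad_weight (x + \<theta> *\<^sub>R axis i 1)" by (rule C)
    also have "\<dots> \<le> 3 * C * (1 / quad_weight x)"
      using quad_weight_shift_le[of \<theta> x i] \<theta> e[of k] C
      by (simp add: field_simps mult_left_mono)
    finally show ?thesis .
  qed
  have "(\<lambda>k. LINT x|lborel. D k x * iexp (- (\<xi> \<bullet> x))) \<longlonglongrightarrow> (LINT x|lborel. pderiv_dir i f x * iexp (- (\<xi> \<bullet> x)))"
  proof (rule integral_dominated_convergence[where w = "\<lambda>x. 3 * C * (1 / quad_weight x)"])
    show "integrable lborel (\<lambda>x :: real^'n. 3 * C * (1 / quad_weight x))"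
      by (intro integrable_mult_right integrable_inverse_quad_weight)
    show "AE x in lborel. (\<lambda>k. D k x * iexp (- (\<xi> \<bullet> x))) \<longlonglongrightarrow> pderiv_dir i f x * iexp (- (\<xi> \<bullet> x))"
      by (intro AE_I2 tendsto_mult D_lim tendsto_const)
    show "AE x in lborel. norm (D k x * iexp (- (\<xi> \<bullet> x))) \<le> 3 * C * (1 / quad_weight x)" for k
      using D_bound by (simp add: norm_mult)
  qed measurable
  then have "(\<lambda>k. fourier_raw (D k) \<xi>) \<longlonglongrightarrow> fourier_raw (pderiv_dir i f) \<xi>"
    by (simp add: fourier_raw_def)
  moreover have "fourier_raw (D k) \<xi> = ((iexp (e k * \<xi> $ i) - 1) /\<^sub>R e k) * fourier_raw f \<xi>" for k
  proof -
    have fi: "integrable lborel f" using f by (rule schwartz_integrable)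
    have "integrable lborel (\<lambda>x. f (e k *\<^sub>R axis i 1 + x))"
      using fi by (subst (asm) lborel_distr_plus[of "e k *\<^sub>R axis i 1", symmetric])
                  (subst (asm) integrable_distr_eq, auto)
    then have fi2: "integrable lborel (\<lambda>x. f (x + e k *\<^sub>R axis i 1))"
      by (simp add: add.commute)
    have "fourier_raw (D k) \<xi> = (LINT x|lborel. (f (x + e k *\<^sub>R axis i 1) * iexp (- (\<xi> \<bullet> x)) - f x * iexp (- (\<xi> \<bullet> x))) /\<^sub>R e k)"
      by (simp add: fourier_raw_def D_def scaleR_conv_of_real algebra_simps)
    also have "\<dots> = (fourier_raw (\<lambda>x. f (x + e k *\<^sub>R axis i 1)) \<xi> - fourier_raw f \<xi>) /\<^sub>R e k"
      unfolding fourier_raw_def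
      using integrable_mult_iexp[OF fi, of "\<lambda>x. - (\<xi> \<bullet> x)"] integrable_mult_iexp[OF fi2, of "\<lambda>x. - (\<xi> \<bullet> x)"]
      by simp
    also have "\<dots> = ((iexp (e k * \<xi> $ i) - 1) /\<^sub>R e k) * fourier_raw f \<xi>"
    proof -
      have "\<xi> \<bullet> (e k *\<^sub>R axis i 1) = e k * \<xi> $ i" by (simp add: inner_axis)
      then have "fourier_raw (\<lambda>x. f (x + e k *\<^sub>R axis i 1)) \<xi> = iexp (e k * \<xi> $ i) * fourier_raw f \<xi>"
        by (simp only: fourier_raw_shift[OF schwartz_measurable[OF f]])
      then show ?thesis by (simp add: algebra_simps)
    qed
    finally show ?thesis .
  qed
  moreover have "(\<lambda>k. ((iexp (e k * \<xi> $ i) - 1) /\<^sub>R e k) * fourier_raw f \<xi>) \<longlonglongrightarrow> \<i> * (\<xi> $ i) * fourier_raw f \<xi>"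
  proof (intro tendsto_mult tendsto_const)
    have "((\<lambda>t. iexp (t * \<xi> $ i)) has_vector_derivative \<i> * (\<xi> $ i)) (at 0)"
    proof -
      have "((\<lambda>z. exp (z * (\<i> * (\<xi> $ i)))) has_field_derivative \<i> * (\<xi> $ i)) (at (of_real 0))"
        by (auto intro!: derivative_eq_intros)
      from has_vector_derivative_real_field[OF this] show ?thesis by (simp add: mult_ac)
    qed
    then have "((\<lambda>t. (iexp (t * \<xi> $ i) - 1) /\<^sub>R t) \<longlongrightarrow> \<i> * (\<xi> $ i)) (at 0)"
      using has_vector_derivative_imp_quotient_limit by fastforce
    from filterlim_compose[OF this e0'] show "(\<lambda>k. (iexp (e k * \<xi> $ i) - 1) /\<^sub>R e k) \<longlonglongrightarrow> \<i> * (\<xi> $ i)"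
      by simp
  qed
  ultimately show ?thesis using LIMSEQ_unique by fastforce
qed

lemma fourier_raw_pderiv_dir_power:
  assumes "schwartz f"
  shows "schwartz ((pderiv_dir i ^^ k) f) \<and> fourier_raw ((pderiv_dir i ^^ k) f) \<xi> = (\<i> * (\<xi> $ i)) ^ k * fourier_raw f \<xi>"
  by (induction k) (use assms in \<open>auto simp: schwartz_pderiv_dir fourier_raw_pderiv_dir\<close>)

text \<open>Some coordinate of \<open>\<xi>\<close> has modulus at least \<open>\<bar>\<xi>\<bar> / n\<close>, so that it suffices to bound
  \<open>\<bar>\<xi> $ i\<bar> ^ m\<close> times the transform, the transform of an iterated derivative, for each \<open>i\<close>.\<close>

lemma fourier_raw_decay:
  fixes f :: "real^'n::finite \<Rightarrow> complex"
  assumes f: "schwartz f"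
  obtains C where "0 \<le> C" "\<And>\<xi>. norm (fourier_raw f \<xi>) * (1 + norm \<xi>) ^ m \<le> C"
proof -
  define B where "B i k = (LINT x|lborel. norm ((pderiv_dir i ^^ k) f x))" for i k
  have B0: "0 \<le> B i k" for i k unfolding B_def by simp
  have B: "\<bar>\<xi> $ i\<bar> ^ k * norm (fourier_raw f \<xi>) \<le> B i k" for \<xi> i k
  proof -
    have s: "schwartz ((pderiv_dir i ^^ k) f)"
      and eq: "fourier_raw ((pderiv_dir i ^^ k) f) \<xi> = (\<i> * (\<xi> $ i)) ^ k * fourier_raw f \<xi>"
      using fourier_raw_pderiv_dir_power[OF f] by auto
    show ?thesis
      using norm_fourier_raw_le[OF schwartz_integrable[OF s], of \<xi>] unfolding eq B_def
      by (simp add: norm_mult norm_power)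
  qed
  let ?n = "real CARD('n)"
  define C where "C = 2 ^ m * (B undefined 0 + ?n ^ m * (\<Sum>i\<in>UNIV. B i m))"
  show ?thesis
  proof (rule that)
    show "0 \<le> C" unfolding C_def using B0 by (intro mult_nonneg_nonneg add_nonneg_nonneg sum_nonneg) auto
    fix \<xi> :: "real^'n"
    have "\<exists>i. norm \<xi> \<le> ?n * \<bar>\<xi> $ i\<bar>"
    proof (rule ccontr)
      assume "\<not> ?thesis"
      then have "\<bar>\<xi> $ i\<bar> < norm \<xi> / ?n" for i by (simp add: not_le field_simps)
      then have "(\<Sum>i\<in>UNIV. \<bar>\<xi> $ i\<bar>) < (\<Sum>i\<in>(UNIV :: 'n set). norm \<xi> / ?n)"
        by (intro sum_strict_mono) auto
      then show False using norm_le_l1_cart[of \<xi>] by simp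
    qed
    then obtain i where i: "norm \<xi> \<le> ?n * \<bar>\<xi> $ i\<bar>" by blast
    have "norm \<xi> ^ m * norm (fourier_raw f \<xi>) \<le> ?n ^ m * (\<bar>\<xi> $ i\<bar> ^ m * norm (fourier_raw f \<xi>))"
      using power_mono[OF i, of m] by (simp add: power_mult_distrib mult_right_mono mult.assoc[symmetric])
    also have "\<dots> \<le> ?n ^ m * (\<Sum>i\<in>UNIV. B i m)"
      using B[of \<xi> i m] member_le_sum[of i UNIV "\<lambda>i. B i m"] B0
      by (intro mult_left_mono) auto
    finally have 1: "norm \<xi> ^ m * norm (fourier_raw f \<xi>) \<le> ?n ^ m * (\<Sum>i\<in>UNIV. B i m)" .
    have "(1 + norm \<xi>) ^ m \<le> (2 * max 1 (norm \<xi>)) ^ m"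
      by (intro power_mono) auto
    also have "\<dots> \<le> 2 ^ m * (1 + norm \<xi> ^ m)"
      by (auto simp: power_mult_distrib max_def)
    finally have "norm (fourier_raw f \<xi>) * (1 + norm \<xi>) ^ m \<le> norm (fourier_raw f \<xi>) * (2 ^ m * (1 + norm \<xi> ^ m))"
      by (intro mult_left_mono) auto
    also have "\<dots> = 2 ^ m * (norm (fourier_raw f \<xi>) + norm \<xi> ^ m * norm (fourier_raw f \<xi>))"
      by (simp add: algebra_simps)
    also have "\<dots> \<le> C"
      unfolding C_def using 1 B[of \<xi> undefined 0] by (intro mult_left_mono add_mono) auto
    finally show "norm (fourier_raw f \<xi>) * (1 + norm \<xi>) ^ m \<le> C" .
  qed
qed

lemma quad_weight_le: "quad_weight x \<le> (1 + norm (x :: real^'n::finite)) ^ (2 * CARD('n))"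
proof -
  have "quad_weight x \<le> (\<Prod>j\<in>(UNIV :: 'n set). (1 + norm x)\<^sup>2)"
    unfolding quad_weight_def
  proof (intro prod_mono conjI)
    fix j
    have "1 + (x $ j)\<^sup>2 \<le> 1 + (norm x)\<^sup>2"
      using component_le_norm_cart[of x j] by (simp add: abs_le_square_iff[symmetric])
    also have "\<dots> \<le> (1 + norm x)\<^sup>2" by (simp add: power2_sum)
    finally show "1 + (x $ j)\<^sup>2 \<le> (1 + norm x)\<^sup>2" .
  qed auto
  then show ?thesis by (simp add: power_mult)
qed

lemma integrable_norm_power_fourier_raw:
  fixes f :: "real^'n::finite \<Rightarrow> complex"
  assumes f: "schwartz f"
  shows "integrable lborel (\<lambda>\<xi>. complex_of_real ((1 + norm \<xi>) ^ k) * fourier_raw f \<xi>)"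
proof -
  let ?m = "k + 2 * CARD('n)"
  obtain C where C: "0 \<le> C" "\<And>\<xi>. norm (fourier_raw f \<xi>) * (1 + norm \<xi>) ^ ?m \<le> C"
    using fourier_raw_decay[OF f] by blast
  note [measurable] = measurable_fourier_raw[OF schwartz_measurable[OF f]]
  show ?thesis
  proof (rule Bochner_Integration.integrable_bound)
    show "integrable lborel (\<lambda>x :: real^'n. C * (1 / quad_weight x))"
      by (intro integrable_mult_right integrable_inverse_quad_weight)
    show "AE \<xi> in lborel. norm (complex_of_real ((1 + norm \<xi>) ^ k) * fourier_raw f \<xi>) \<le> norm (C * (1 / quad_weight \<xi>))"
    proof (intro AE_I2)
      fix \<xi> :: "real^'n"
      have "norm (complex_of_real ((1 + norm \<xi>) ^ k) * fourier_raw f \<xi>) * quad_weight \<xi>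
          \<le> ((1 + norm \<xi>) ^ k * norm (fourier_raw f \<xi>)) * (1 + norm \<xi>) ^ (2 * CARD('n))"
        using quad_weight_le[of \<xi>]
        by (intro mult_mono) (auto simp: norm_mult less_imp_le simp del: of_real_power of_real_add)
      also have "\<dots> \<le> C" using C(2)[of \<xi>] by (simp add: power_add mult_ac)
      finally show "norm (complex_of_real ((1 + norm \<xi>) ^ k) * fourier_raw f \<xi>) \<le> norm (C * (1 / quad_weight \<xi>))"
        using C(1) by (simp add: field_simps less_imp_le)
    qed
  qed measurable
qed

lemma integrable_fourier_raw:
  fixes f :: "real^'n::finite \<Rightarrow> complex"
  assumes f: "schwartz f"
  shows "integrable lborel (fourier_raw f)"
  using integrable_norm_power_fourier_raw[OF f, of 0] by simp

lemma integrable_norm_powr_fourier_raw: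
  fixes f :: "real^'n::finite \<Rightarrow> complex"
  assumes f: "schwartz f" and s: "0 \<le> s"
  shows "integrable lborel (\<lambda>\<xi>. complex_of_real (norm \<xi> powr s) * fourier_raw f \<xi>)"
proof (rule Bochner_Integration.integrable_bound[OF integrable_norm_power_fourier_raw[OF f, of "nat \<lceil>s\<rceil>"]])
  note [measurable] = measurable_fourier_raw[OF schwartz_measurable[OF f]]
  show "(\<lambda>\<xi>. complex_of_real (norm \<xi> powr s) * fourier_raw f \<xi>) \<in> borel_measurable lborel"
    by measurable
  show "AE \<xi> in lborel. norm (complex_of_real (norm \<xi> powr s) * fourier_raw f \<xi>)
    \<le> norm (complex_of_real ((1 + norm \<xi>) ^ nat \<lceil>s\<rceil>) * fourier_raw f \<xi>)"
  proof (intro AE_I2)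
    fix \<xi> :: "real^'n"
    have "norm \<xi> powr s \<le> (1 + norm \<xi>) powr s" using s by (intro powr_mono2) auto
    also have "\<dots> \<le> (1 + norm \<xi>) powr real (nat \<lceil>s\<rceil>)"
      using s by (intro powr_mono) (auto simp: real_nat_ceiling_ge)
    also have "\<dots> = (1 + norm \<xi>) ^ nat \<lceil>s\<rceil>"
      by (rule powr_realpow) (simp add: add_pos_nonneg)
    finally show "norm (complex_of_real (norm \<xi> powr s) * fourier_raw f \<xi>)
      \<le> norm (complex_of_real ((1 + norm \<xi>) ^ nat \<lceil>s\<rceil>) * fourier_raw f \<xi>)"
      by (simp add: norm_mult norm_power mult_right_mono del: of_real_power)
  qed
qed

section \<open>Gaussian averages and Fourier inversion\<close>

definition gauss :: "real^'n::finite \<Rightarrow> real" where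
  "gauss y = (2 * pi) powr (- (real CARD('n) / 2)) * exp (- ((norm y)\<^sup>2 / 2))"

lemma gauss_pos: "0 < gauss y" and gauss_nonneg [simp]: "0 \<le> gauss y"
  by (auto simp: gauss_def intro: mult_pos_pos)

lemma gauss_le_0: "gauss (y :: real^'n::finite) \<le> gauss (0 :: real^'n)"
  by (auto simp: gauss_def intro!: mult_left_le)

lemma continuous_gauss: "continuous_on UNIV gauss"
  unfolding gauss_def by (intro continuous_intros) auto

lemma measurable_gauss [measurable]: "gauss \<in> borel_measurable borel"
  by (rule borel_measurable_continuous_onI[OF continuous_gauss])

lemma norm_vec_power2: "(norm (y :: real^'n::finite))\<^sup>2 = (\<Sum>j\<in>UNIV. (y $ j)\<^sup>2)"
  unfolding power2_norm_eq_inner inner_vec_def by (simp add: power2_eq_square)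

lemma gauss_prod:
  "gauss (y :: real^'n::finite) = (\<Prod>j\<in>UNIV. std_normal_density (y $ j))"
proof -
  have "(2 * pi) powr (- (real CARD('n) / 2)) = 1 / sqrt (2 * pi) ^ CARD('n)"
    by (simp add: powr_half_sqrt[symmetric] powr_minus_divide power_one_over powr_realpow[symmetric] powr_powr)
  then show ?thesis
    by (simp add: norm_vec_power2 std_normal_density_def gauss_def prod.distrib exp_sum[symmetric]
         sum_negf sum_divide_distrib prod_dividef power_one_over)
qed

lemma nn_integral_gauss: "(\<integral>\<^sup>+y. ennreal (gauss (y :: real^'n::finite)) \<partial>lborel) = 1"
proof -
  have "(\<integral>\<^sup>+t. ennreal (std_normal_density t) \<partial>lborel) = 1"
    using prob_space.emeasure_space_1[OF prob_space_normal_density[of 1 0]]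
    by (simp add: emeasure_density)
  moreover have "(\<integral>\<^sup>+y. ennreal (gauss (y :: real^'n)) \<partial>lborel)
      = (\<integral>\<^sup>+y. (\<Prod>j\<in>UNIV. ennreal (std_normal_density ((y :: real^'n) $ j))) \<partial>lborel)"
    by (simp add: gauss_prod prod_ennreal normal_density_nonneg)
  ultimately show ?thesis
    using nn_integral_lborel_prod_vec[of "\<lambda>(_ :: 'n) t. ennreal (std_normal_density t)"] by simp
qed

lemma integrable_gauss: "integrable lborel (gauss :: real^'n::finite \<Rightarrow> real)"
  by (rule integrableI_bounded) (auto simp: nn_integral_gauss)

lemma integrable_gauss_complex: "integrable lborel (\<lambda>y :: real^'n::finite. complex_of_real (gauss y))"
  using integrable_gauss by (rule integrable_of_real)

lemma integral_gauss: "(LINT y|lborel. gauss (y :: real^'n::finite)) = 1"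
  by (simp add: integral_eq_nn_integral nn_integral_gauss)

lemma integral_gauss_iexp:
  fixes \<xi> :: "real^'n::finite"
  shows "(LINT y|lborel. complex_of_real (gauss y) * iexp (\<xi> \<bullet> y)) = complex_of_real (exp (- ((norm \<xi>)\<^sup>2 / 2)))"
proof -
  let ?g = "\<lambda>c t. complex_of_real (std_normal_density t) * iexp (c * t)"
  have one: "(LINT t|lborel. ?g c t) = complex_of_real (exp (- (c\<^sup>2 / 2)))" for c
  proof -
    have "char std_normal_distribution c = (LINT t|lborel. ?g c t)"
      unfolding char_def by (subst integral_density) (auto simp: scaleR_conv_of_real normal_density_nonneg)
    then show ?thesis by (simp add: char_std_normal_distribution)
  qed
  have int: "integrable lborel (?g c)" for c
    by (rule integrable_mult_iexp) (auto intro!: integrable_of_real integrable_normal_density)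
  have "complex_of_real (gauss y) * iexp (\<xi> \<bullet> y) = (\<Prod>j\<in>UNIV. ?g (\<xi> $ j) (y $ j))" for y
    by (simp add: gauss_prod prod.distrib inner_vec_def exp_sum[symmetric] sum_distrib_left)
  then have "(LINT y|lborel. complex_of_real (gauss y) * iexp (\<xi> \<bullet> y)) = (LINT y|lborel. (\<Prod>j\<in>UNIV. ?g (\<xi> $ j) ((y :: real^'n) $ j)))"
    by (simp only:)
  also have "\<dots> = (\<Prod>j\<in>UNIV. complex_of_real (exp (- ((\<xi> $ j)\<^sup>2 / 2))))"
    unfolding one[symmetric] by (rule lborel_integral_prod_vec[OF int])
  also have "(\<Prod>j\<in>UNIV. complex_of_real (exp (- ((\<xi> $ j)\<^sup>2 / 2)))) = complex_of_real (exp (- ((norm \<xi>)\<^sup>2 / 2)))"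
    by (simp add: norm_vec_power2 exp_sum[symmetric] sum_negf sum_divide_distrib flip: of_real_prod)
  finally show ?thesis .
qed

lemma nn_integral_lborel_affine:
  fixes h :: "'a::euclidean_space \<Rightarrow> ennreal"
  assumes [measurable]: "h \<in> borel_measurable borel" and r: "0 < r"
  shows "(\<integral>\<^sup>+z. h z \<partial>lborel) = ennreal (r ^ DIM('a)) * (\<integral>\<^sup>+y. h (x + r *\<^sub>R y) \<partial>lborel)"
  using r by (subst lborel_affine[of r x]) (auto simp: nn_integral_density nn_integral_distr nn_integral_cmult)

lemma integral_lborel_affine:
  fixes h :: "'a::euclidean_space \<Rightarrow> complex"
  assumes [measurable]: "h \<in> borel_measurable borel" and r: "0 < r"
  shows "(LINT z|lborel. h z) = of_real (r ^ DIM('a)) * (LINT y|lborel. h (x + r *\<^sub>R y))"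
proof -
  have "(LINT z|lborel. h z) = (LINT z|density (distr lborel borel (\<lambda>y. x + r *\<^sub>R y)) (\<lambda>_. ennreal (\<bar>r\<bar> ^ DIM('a))). h z)"
    using lborel_affine[of r x] r by simp
  then show ?thesis using r
    by (simp add: integral_density integral_distr scaleR_conv_of_real del: of_real_power)
qed

lemma integrable_pair_mult_iexp:
  fixes F :: "'a::euclidean_space \<Rightarrow> complex" and G :: "'b::euclidean_space \<Rightarrow> complex"
  assumes F: "integrable lborel F" and G: "integrable lborel G"
    and [measurable]: "(\<lambda>(x, y). \<phi> x y) \<in> borel_measurable (borel \<Otimes>\<^sub>M borel)"
  shows "integrable (lborel \<Otimes>\<^sub>M lborel) (\<lambda>(x, y). F x * G y * iexp (\<phi> x y))"
proof (rule lborel_pair.Fubini_integrable)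
  have [measurable]: "F \<in> borel_measurable borel" "G \<in> borel_measurable borel" using F G by auto
  have [measurable]: "(\<lambda>y. \<phi> x y) \<in> borel_measurable borel" for x
    by measurable
  show "(\<lambda>(x, y). F x * G y * iexp (\<phi> x y)) \<in> borel_measurable (lborel \<Otimes>\<^sub>M lborel)"
    by measurable
  show "integrable lborel (\<lambda>x. LINT y|lborel. norm (case (x, y) of (x, y) \<Rightarrow> F x * G y * iexp (\<phi> x y)))"
    using F by (simp add: norm_mult)
  show "AE x in lborel. integrable lborel (\<lambda>y. case (x, y) of (x, y) \<Rightarrow> F x * G y * iexp (\<phi> x y))"
    using G by (auto intro!: AE_I2 integrable_mult_iexp)
qed

definition inv_fourier_raw :: "(real^'n::finite \<Rightarrow> complex) \<Rightarrow> real^'n \<Rightarrow> complex" where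
  "inv_fourier_raw F x = (LINT \<xi>|lborel. F \<xi> * iexp (\<xi> \<bullet> x))"

lemma measurable_inv_fourier_raw:
  fixes F :: "real^'n::finite \<Rightarrow> complex"
  assumes [measurable]: "F \<in> borel_measurable borel"
  shows "inv_fourier_raw F \<in> borel_measurable borel"
  unfolding inv_fourier_raw_def by measurable

lemma integral_gauss_scaled_iexp:
  fixes v :: "real^'n::finite"
  assumes r: "0 < r"
  shows "(LINT \<xi>|lborel. complex_of_real (gauss (r *\<^sub>R \<xi>)) * iexp (\<xi> \<bullet> v))
    = complex_of_real (exp (- ((norm ((1 / r) *\<^sub>R v))\<^sup>2 / 2)) / r ^ CARD('n))"
proof -
  have "complex_of_real (exp (- ((norm ((1 / r) *\<^sub>R v))\<^sup>2 / 2)))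
      = (LINT y|lborel. complex_of_real (gauss y) * iexp (((1 / r) *\<^sub>R v) \<bullet> y))"
    by (rule integral_gauss_iexp[symmetric])
  also have "\<dots> = of_real (r ^ DIM(real^'n)) * (LINT \<xi>|lborel. complex_of_real (gauss (0 + r *\<^sub>R \<xi>)) * iexp (((1 / r) *\<^sub>R v) \<bullet> (0 + r *\<^sub>R \<xi>)))"
    using r by (intro integral_lborel_affine) measurable
  also have "\<dots> = of_real (r ^ CARD('n)) * (LINT \<xi>|lborel. complex_of_real (gauss (r *\<^sub>R \<xi>)) * iexp (\<xi> \<bullet> v))"
    using r by (simp add: inner_commute)
  finally show ?thesis using r by (simp add: field_simps)
qed

text \<open>Damping the inversion integral by a wide Gaussian makes the double integral absolutely convergent;
  the Gaussian is its own Fourier transform, so Fubini's theorem yields an average of \<open>f\<close> over a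
  Gaussian of width \<open>r\<close> around \<open>x\<close>.\<close>

lemma gauss_regularised_inversion:
  fixes f :: "real^'n::finite \<Rightarrow> complex"
  assumes f: "integrable lborel f" and r: "0 < r"
  shows "(LINT \<xi>|lborel. fourier_raw f \<xi> * iexp (\<xi> \<bullet> x) * complex_of_real (gauss (r *\<^sub>R \<xi>)))
    = (LINT y|lborel. f (x + r *\<^sub>R y) * complex_of_real (exp (- ((norm y)\<^sup>2 / 2))))"
proof -
  have [measurable]: "f \<in> borel_measurable borel" using f by auto
  let ?c = "\<lambda>\<xi>. complex_of_real (gauss (r *\<^sub>R (\<xi> :: real^'n)))"
  have gi: "integrable lborel ?c"
  proof -
    have "(\<integral>\<^sup>+\<xi>. ennreal (gauss (r *\<^sub>R (\<xi> :: real^'n))) \<partial>lborel) < \<infinity>"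
      using nn_integral_lborel_affine[of "\<lambda>y :: real^'n. ennreal (gauss y)" r 0] r
      by (auto simp: nn_integral_gauss ennreal_mult_eq_top_iff less_top[symmetric])
    then show ?thesis by (intro integrable_of_real integrableI_bounded) auto
  qed
  have "(LINT \<xi>|lborel. fourier_raw f \<xi> * iexp (\<xi> \<bullet> x) * ?c \<xi>)
      = (LINT \<xi>|lborel. (LINT y|lborel. f y * ?c \<xi> * iexp (\<xi> \<bullet> (x - y))))"
  proof (intro Bochner_Integration.integral_cong refl)
    fix \<xi> :: "real^'n"
    have "fourier_raw f \<xi> * iexp (\<xi> \<bullet> x) * ?c \<xi> = (LINT y|lborel. f y * iexp (- (\<xi> \<bullet> y)) * (iexp (\<xi> \<bullet> x) * ?c \<xi>))"
      unfolding fourier_raw_def mult.assoc[of "integral\<^sup>L lborel _"] by (rule integral_mult_left_zero[symmetric])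
    also have "\<dots> = (LINT y|lborel. f y * ?c \<xi> * iexp (\<xi> \<bullet> (x - y)))"
      by (intro Bochner_Integration.integral_cong refl)
         (simp add: inner_diff_right exp_diff exp_minus field_simps)
    finally show "fourier_raw f \<xi> * iexp (\<xi> \<bullet> x) * ?c \<xi> = (LINT y|lborel. f y * ?c \<xi> * iexp (\<xi> \<bullet> (x - y)))" .
  qed
  also have "\<dots> = (LINT y|lborel. (LINT \<xi>|lborel. f y * ?c \<xi> * iexp (\<xi> \<bullet> (x - y))))"
    using integrable_pair_mult_iexp[OF f gi, of "\<lambda>y \<xi>. \<xi> \<bullet> (x - y)"]
    by (intro lborel_pair.Fubini_integral) (auto simp: split_beta')
  also have "\<dots> = (LINT y|lborel. f y * complex_of_real (exp (- ((norm ((1 / r) *\<^sub>R (x - y)))\<^sup>2 / 2)) / r ^ CARD('n)))"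
    by (intro Bochner_Integration.integral_cong refl)
       (simp only: integral_gauss_scaled_iexp[OF r, symmetric] mult.assoc integral_mult_right_zero)
  also have "\<dots> = of_real (r ^ DIM(real^'n)) * (LINT y|lborel. f (x + r *\<^sub>R y) *
      complex_of_real (exp (- ((norm ((1 / r) *\<^sub>R (x - (x + r *\<^sub>R y))))\<^sup>2 / 2)) / r ^ CARD('n)))"
    using r by (intro integral_lborel_affine) measurable
  also have "\<dots> = of_real (r ^ CARD('n)) * (LINT y|lborel. (f (x + r *\<^sub>R y) * complex_of_real (exp (- ((norm y)\<^sup>2 / 2)))) / of_real (r ^ CARD('n)))"
    using r by simp
  also have "\<dots> = (LINT y|lborel. f (x + r *\<^sub>R y) * complex_of_real (exp (- ((norm y)\<^sup>2 / 2))))"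
    using r by (subst integral_divide_zero) simp
  finally show ?thesis .
qed

text \<open>Both sides of the regularised formula converge by dominated convergence as \<open>r \<rightarrow> 0\<close>: the left one
  since the transform is integrable, the right one since \<open>f\<close> is bounded and continuous.\<close>

lemma fourier_inversion:
  fixes f :: "real^'n::finite \<Rightarrow> complex"
  assumes f: "schwartz f"
  shows "complex_of_real ((gauss (0 :: real^'n))\<^sup>2) * inv_fourier_raw (fourier_raw f) x = f x"
proof -
  define e where "e k = inverse (real (Suc k))" for k
  have e: "0 < e k" for k by (auto simp: e_def)
  have e0: "e \<longlonglongrightarrow> 0" unfolding e_def by (rule LIMSEQ_inverse_real_of_nat)
  note [measurable] = schwartz_measurable[OF f] measurable_fourier_raw[OF schwartz_measurable[OF f]]
  have fi: "integrable lborel (fourier_raw f)" by (rule integrable_fourier_raw[OF f])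
  have g0: "0 < gauss (0 :: real^'n)" by (rule gauss_pos)
  have g_exp: "exp (- ((norm y)\<^sup>2 / 2)) = gauss y / gauss (0 :: real^'n)" for y :: "real^'n"
    by (simp add: gauss_def)
  obtain C where C: "0 \<le> C" "\<And>x. norm (f x) \<le> C / quad_weight x"
    using schwartz_decay[OF f] by blast
  have fC: "norm (f x) \<le> C" for x
  proof -
    have "C / quad_weight x \<le> C"
      using mult_left_mono[OF quad_weight_ge_1[of x] C(1)] by (simp add: divide_le_eq)
    then show ?thesis using C(2)[of x] by linarith
  qed
  have "(\<lambda>k. LINT \<xi>|lborel. fourier_raw f \<xi> * iexp (\<xi> \<bullet> x) * complex_of_real (gauss (e k *\<^sub>R \<xi>)))
      \<longlonglongrightarrow> (LINT \<xi>|lborel. fourier_raw f \<xi> * iexp (\<xi> \<bullet> x) * complex_of_real (gauss (0 :: real^'n)))"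
  proof (rule integral_dominated_convergence[where w = "\<lambda>\<xi>. norm (fourier_raw f \<xi>) * gauss (0 :: real^'n)"])
    show "AE \<xi> in lborel. (\<lambda>k. fourier_raw f \<xi> * iexp (\<xi> \<bullet> x) * complex_of_real (gauss (e k *\<^sub>R \<xi>)))
       \<longlonglongrightarrow> fourier_raw f \<xi> * iexp (\<xi> \<bullet> x) * complex_of_real (gauss (0 :: real^'n))"
    proof (intro AE_I2 tendsto_mult tendsto_const tendsto_of_real)
      fix \<xi> :: "real^'n"
      have "(\<lambda>k. e k *\<^sub>R \<xi>) \<longlonglongrightarrow> 0" using tendsto_scaleR[OF e0 tendsto_const[of \<xi>]] by simp
      moreover have "isCont gauss (0 :: real^'n)"
        using continuous_on_interior[OF continuous_gauss, of "0 :: real^'n"] by simp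
      ultimately show "(\<lambda>k. gauss (e k *\<^sub>R \<xi>)) \<longlonglongrightarrow> gauss (0 :: real^'n)"
        by (rule isCont_tendsto_compose[rotated])
    qed
    show "AE \<xi> in lborel. norm (fourier_raw f \<xi> * iexp (\<xi> \<bullet> x) * complex_of_real (gauss (e k *\<^sub>R \<xi>))) \<le> norm (fourier_raw f \<xi>) * gauss (0 :: real^'n)" for k
      by (auto simp: norm_mult intro!: mult_left_mono gauss_le_0)
  qed (use fi in \<open>auto\<close>)
  moreover have "(\<lambda>k. LINT \<xi>|lborel. fourier_raw f \<xi> * iexp (\<xi> \<bullet> x) * complex_of_real (gauss (e k *\<^sub>R \<xi>)))
      \<longlonglongrightarrow> (LINT y|lborel. f x * complex_of_real (exp (- ((norm (y :: real^'n))\<^sup>2 / 2))))"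
    unfolding gauss_regularised_inversion[OF schwartz_integrable[OF f] e]
  proof (rule integral_dominated_convergence[where w = "\<lambda>y. C * (gauss y / gauss (0 :: real^'n))"])
    show "integrable lborel (\<lambda>y :: real^'n. C * (gauss y / gauss (0 :: real^'n)))"
      by (intro integrable_mult_right integrable_divide integrable_gauss)
    show "AE y in lborel. (\<lambda>k. f (x + e k *\<^sub>R y) * complex_of_real (exp (- ((norm y)\<^sup>2 / 2))))
       \<longlonglongrightarrow> f x * complex_of_real (exp (- ((norm y)\<^sup>2 / 2)))"
    proof (intro AE_I2 tendsto_mult tendsto_const)
      fix y :: "real^'n"
      have "(\<lambda>k. x + e k *\<^sub>R y) \<longlonglongrightarrow> x" using tendsto_add[OF tendsto_const[of x] tendsto_scaleR[OF e0 tendsto_const[of y]]] by simp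
      moreover have "isCont f x"
        using schwartz_continuous[OF f] by (simp add: continuous_on_eq_continuous_at)
      ultimately show "(\<lambda>k. f (x + e k *\<^sub>R y)) \<longlonglongrightarrow> f x"
        by (rule isCont_tendsto_compose[rotated])
    qed
    show "AE y in lborel. norm (f (x + e k *\<^sub>R y) * complex_of_real (exp (- ((norm y)\<^sup>2 / 2)))) \<le> C * (gauss y / gauss (0 :: real^'n))" for k
    proof (intro AE_I2)
      fix y :: "real^'n"
      show "norm (f (x + e k *\<^sub>R y) * complex_of_real (exp (- ((norm y)\<^sup>2 / 2)))) \<le> C * (gauss y / gauss (0 :: real^'n))"
        unfolding g_exp norm_mult norm_of_real using g0 by (intro mult_mono fC) (auto simp: C)
    qed
  qed measurable
  ultimately have "(LINT \<xi>|lborel. fourier_raw f \<xi> * iexp (\<xi> \<bullet> x) * complex_of_real (gauss (0 :: real^'n)))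
      = (LINT y|lborel. f x * complex_of_real (gauss (y :: real^'n) / gauss (0 :: real^'n)))"
    unfolding g_exp by (rule LIMSEQ_unique)
  then have "inv_fourier_raw (fourier_raw f) x * complex_of_real (gauss (0 :: real^'n)) = f x / gauss (0 :: real^'n)"
    by (simp add: inv_fourier_raw_def integral_gauss)
  then show ?thesis using g0 by (simp add: field_simps power2_eq_square)
qed

text \<open>Convolution with a Gaussian of width \<open>r\<close> multiplies the Fourier transform by
  \<open>exp (-r\<^sup>2 |\<xi>|\<^sup>2 / 2)\<close>.\<close>

lemma gauss_average_inv_fourier_raw:
  fixes F :: "real^'n::finite \<Rightarrow> complex"
  assumes F: "integrable lborel F"
  shows "(LINT y|lborel. complex_of_real (gauss y) * inv_fourier_raw F (x + r *\<^sub>R y))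
    = (LINT \<xi>|lborel. F \<xi> * iexp (\<xi> \<bullet> x) * complex_of_real (exp (- ((r * norm \<xi>)\<^sup>2 / 2))))"
proof -
  have [measurable]: "F \<in> borel_measurable borel" using F by auto
  have "(LINT y|lborel. complex_of_real (gauss y) * inv_fourier_raw F (x + r *\<^sub>R y))
      = (LINT y|lborel. (LINT \<xi>|lborel. F \<xi> * complex_of_real (gauss y) * iexp (\<xi> \<bullet> (x + r *\<^sub>R y))))"
  proof (intro Bochner_Integration.integral_cong refl)
    fix y :: "real^'n"
    have "complex_of_real (gauss y) * inv_fourier_raw F (x + r *\<^sub>R y)
        = (LINT \<xi>|lborel. complex_of_real (gauss y) * (F \<xi> * iexp (\<xi> \<bullet> (x + r *\<^sub>R y))))"
      unfolding inv_fourier_raw_def by (rule integral_mult_right_zero[symmetric])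
    then show "complex_of_real (gauss y) * inv_fourier_raw F (x + r *\<^sub>R y)
        = (LINT \<xi>|lborel. F \<xi> * complex_of_real (gauss y) * iexp (\<xi> \<bullet> (x + r *\<^sub>R y)))"
      by (simp only: mult_ac)
  qed
  also have "\<dots> = (LINT \<xi>|lborel. (LINT y|lborel. F \<xi> * complex_of_real (gauss y) * iexp (\<xi> \<bullet> (x + r *\<^sub>R y))))"
    using integrable_pair_mult_iexp[OF F integrable_gauss_complex, of "\<lambda>\<xi> y. \<xi> \<bullet> (x + r *\<^sub>R y)"]
    by (intro lborel_pair.Fubini_integral) (auto simp: split_beta')
  also have "\<dots> = (LINT \<xi>|lborel. F \<xi> * iexp (\<xi> \<bullet> x) * complex_of_real (exp (- ((r * norm \<xi>)\<^sup>2 / 2))))"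
  proof (intro Bochner_Integration.integral_cong refl)
    fix \<xi> :: "real^'n"
    have "(LINT y|lborel. F \<xi> * complex_of_real (gauss y) * iexp (\<xi> \<bullet> (x + r *\<^sub>R y)))
        = (LINT y|lborel. (F \<xi> * iexp (\<xi> \<bullet> x)) * (complex_of_real (gauss y) * iexp ((r *\<^sub>R \<xi>) \<bullet> y)))"
      by (intro Bochner_Integration.integral_cong refl) (simp add: inner_add_right exp_add algebra_simps)
    also have "\<dots> = (F \<xi> * iexp (\<xi> \<bullet> x)) * complex_of_real (exp (- ((norm (r *\<^sub>R \<xi>))\<^sup>2 / 2)))"
      unfolding integral_mult_right_zero by (simp only: integral_gauss_iexp)
    finally show "(LINT y|lborel. F \<xi> * complex_of_real (gauss y) * iexp (\<xi> \<bullet> (x + r *\<^sub>R y)))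
        = F \<xi> * iexp (\<xi> \<bullet> x) * complex_of_real (exp (- ((r * norm \<xi>)\<^sup>2 / 2)))"
      by (simp add: power_mult_distrib)
  qed
  finally show ?thesis .
qed

section \<open>The pointwise bound by a Riesz potential\<close>

text \<open>The density \<open>r^(s-1)\<close> over the widths \<open>r > 0\<close> of Gaussians, whose superposition is the Riesz kernel
  of order \<open>s\<close>.\<close>

definition radial_weight :: "real \<Rightarrow> real \<Rightarrow> real" where
  "radial_weight s r = (if 0 < r then r powr (s - 1) else 0)"

lemma radial_weight_nonneg [simp]: "0 \<le> radial_weight s r"
  by (simp add: radial_weight_def)

lemma measurable_radial_weight [measurable]: "radial_weight s \<in> borel_measurable borel"
  unfolding radial_weight_def by measurable

definition gauss_moment :: "real \<Rightarrow> real" where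
  "gauss_moment s = (LINT r|lborel. radial_weight s r * exp (- (r\<^sup>2 / 2)))"

lemma integrable_radial_gauss:
  assumes "0 < s" shows "integrable lborel (\<lambda>r. radial_weight s r * exp (- (r\<^sup>2 / 2)))"
proof (rule integrableI_bounded)
  have "(\<integral>\<^sup>+r. ennreal (norm (radial_weight s r * exp (- (r\<^sup>2 / 2)))) \<partial>lborel)
      = (\<integral>\<^sup>+r\<in>{0<..}. ennreal (r powr (s - 1) * exp (- (r\<^sup>2 / 2))) \<partial>lborel)"
    by (intro nn_integral_cong) (auto simp: radial_weight_def indicator_def)
  then show "(\<integral>\<^sup>+r. ennreal (norm (radial_weight s r * exp (- (r\<^sup>2 / 2)))) \<partial>lborel) < \<infinity>"
    using nn_integral_powr_exp_finite[OF assms] by simp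
qed measurable

lemma gauss_moment_pos:
  assumes "0 < s" shows "0 < gauss_moment s"
proof -
  have "gauss_moment s \<noteq> 0"
  proof
    assume "gauss_moment s = 0"
    then have "AE r in lborel. radial_weight s r * exp (- (r\<^sup>2 / 2)) = 0"
      using integral_nonneg_eq_0_iff_AE[OF integrable_radial_gauss[OF assms]]
      by (simp add: gauss_moment_def)
    then have "AE r in lborel. \<not> (r \<in> {0<..<1::real})"
      by eventually_elim (auto simp: radial_weight_def)
    then have "emeasure lborel {0<..<1::real} = 0"
      by (subst (asm) AE_iff_measurable[of "{0<..<1::real}"]) auto
    then show False by simp
  qed
  moreover have "0 \<le> gauss_moment s" unfolding gauss_moment_def by simp
  ultimately show ?thesis by simp
qed

lemma radial_weight_scale:
  assumes "0 < a" shows "radial_weight s (a * r) = a powr (s - 1) * radial_weight s r"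
  using assms by (auto simp: radial_weight_def powr_mult zero_less_mult_iff)

lemma radial_gauss_scaled:
  assumes s: "0 < s" and a: "0 < a"
  shows "integrable lborel (\<lambda>r. radial_weight s r * exp (- ((r * a)\<^sup>2 / 2)))"
    and "a powr s * (LINT r|lborel. radial_weight s r * exp (- ((r * a)\<^sup>2 / 2))) = gauss_moment s"
proof -
  have eq: "radial_weight s (0 + a * r) * exp (- ((0 + a * r)\<^sup>2 / 2))
      = a powr (s - 1) * (radial_weight s r * exp (- ((r * a)\<^sup>2 / 2)))" for r
    using radial_weight_scale[OF a, of s r] by (simp add: mult.commute[of r])
  have "integrable lborel (\<lambda>r. radial_weight s (0 + a * r) * exp (- ((0 + a * r)\<^sup>2 / 2)))"
    using a by (intro lborel_integrable_real_affine integrable_radial_gauss s) auto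
  then show "integrable lborel (\<lambda>r. radial_weight s r * exp (- ((r * a)\<^sup>2 / 2)))"
    unfolding eq using a by simp
  have "gauss_moment s = a *\<^sub>R (LINT r|lborel. radial_weight s (0 + a * r) * exp (- ((0 + a * r)\<^sup>2 / 2)))"
    unfolding gauss_moment_def using a by (subst lborel_integral_real_affine[where c=a and t=0]) auto
  also have "\<dots> = a * a powr (s - 1) * (LINT r|lborel. radial_weight s r * exp (- ((r * a)\<^sup>2 / 2)))"
    unfolding eq by simp
  also have "a * a powr (s - 1) = a powr s" using a by (simp add: powr_diff)
  finally show "a powr s * (LINT r|lborel. radial_weight s r * exp (- ((r * a)\<^sup>2 / 2))) = gauss_moment s" ..
qed

lemma Lambda_eq_inv_fourier_raw:
  fixes f :: "real^'n::finite \<Rightarrow> complex"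
  shows "Lambda s f x = complex_of_real ((gauss (0 :: real^'n))\<^sup>2) *
    inv_fourier_raw (\<lambda>\<xi>. complex_of_real (norm \<xi> powr s) * fourier_raw f \<xi>) x"
proof -
  have g: "gauss (0 :: real^'n) = (2 * pi) powr (- (real CARD('n) / 2))" by (simp add: gauss_def)
  have "fourier f \<xi> = complex_of_real (gauss (0 :: real^'n)) * fourier_raw f \<xi>" for \<xi>
    unfolding fourier_def fourier_raw_def g by simp
  then have "Lambda s f x = complex_of_real (gauss (0 :: real^'n)) * (LINT \<xi>|lborel. complex_of_real (gauss (0 :: real^'n)) *
      (complex_of_real (norm \<xi> powr s) * fourier_raw f \<xi> * iexp (\<xi> \<bullet> x)))"
    unfolding Lambda_def inv_fourier_def g by (simp add: mult_ac)
  then show ?thesis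
    unfolding inv_fourier_raw_def integral_mult_right_zero by (simp add: power2_eq_square)
qed

lemma measurable_Lambda:
  fixes f :: "real^'n::finite \<Rightarrow> complex"
  assumes [measurable]: "f \<in> borel_measurable borel"
  shows "Lambda s f \<in> borel_measurable borel"
proof -
  note [measurable] = measurable_fourier_raw[OF assms]
  have [measurable]: "inv_fourier_raw (\<lambda>\<xi>. complex_of_real (norm \<xi> powr s) * fourier_raw f \<xi>) \<in> borel_measurable borel"
    by (rule measurable_inv_fourier_raw) measurable
  show ?thesis unfolding Lambda_eq_inv_fourier_raw[abs_def] by measurable
qed

text \<open>Since \<open>\<integral>\<^sub>0\<^sup>\<infinity> r^(s-1) exp (-r\<^sup>2 |\<xi>|\<^sup>2 / 2) dr\<close> is a constant multiple of \<open>|\<xi>|^(-s)\<close>, integrating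
  the Gaussian averages of \<open>\<Lambda>\<^sup>s f\<close> over their width \<open>r\<close> with the weight \<open>r^(s-1)\<close> undoes the
  multiplier \<open>|\<xi>|^s\<close> and leaves the Fourier inversion formula for \<open>f\<close>.  The integrals interchanged are those on
  the Fourier side, which converge absolutely; absolute values are taken only afterwards, so that the
  right-hand side may be infinite.\<close>

lemma schwartz_le_gauss_averages:
  fixes f :: "real^'n::finite \<Rightarrow> complex"
  assumes f: "schwartz f" and s: "0 < s"
  shows "ennreal (gauss_moment s) * ennreal (norm (f x))
    \<le> (\<integral>\<^sup>+r. ennreal (radial_weight s r) *
        (\<integral>\<^sup>+y. ennreal (gauss y) * ennreal (norm (Lambda s f (x + r *\<^sub>R y))) \<partial>lborel) \<partial>lborel)"
proof -
  define F where "F \<xi> = complex_of_real (norm \<xi> powr s) * fourier_raw f \<xi>" for \<xi> :: "real^'n"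
  note [measurable] = schwartz_measurable[OF f] measurable_fourier_raw[OF schwartz_measurable[OF f]]
  have [measurable]: "F \<in> borel_measurable borel" unfolding F_def by measurable
  have F_int: "integrable lborel F"
    unfolding F_def using f s by (intro integrable_norm_powr_fourier_raw) auto
  let ?c = "gauss (0 :: real^'n)"
  have c: "0 < ?c" by (rule gauss_pos)
  have L: "Lambda s f z = complex_of_real (?c\<^sup>2) * inv_fourier_raw F z" for z
    by (simp only: Lambda_eq_inv_fourier_raw F_def[abs_def])
  let ?E = "\<lambda>\<xi> r. radial_weight s r * exp (- ((r * norm (\<xi> :: real^'n))\<^sup>2 / 2))"
  let ?P = "\<lambda>\<xi> r. (F \<xi> * iexp (\<xi> \<bullet> x)) * complex_of_real (?E \<xi> r)"
  have E_nonneg: "0 \<le> ?E \<xi> r" for \<xi> r by simp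
  have P_int: "integrable lborel (\<lambda>r. ?P \<xi> r)" for \<xi>
  proof (cases "\<xi> = 0")
    case False
    then show ?thesis using radial_gauss_scaled(1)[OF s, of "norm \<xi>"]
      by (intro integrable_mult_right integrable_of_real) auto
  qed (simp add: F_def)
  have P_val: "(LINT r|lborel. ?P \<xi> r) = complex_of_real (gauss_moment s) * (fourier_raw f \<xi> * iexp (\<xi> \<bullet> x))"
    if "\<xi> \<noteq> 0" for \<xi>
  proof -
    have "(LINT r|lborel. ?P \<xi> r) = (F \<xi> * iexp (\<xi> \<bullet> x)) * complex_of_real (LINT r|lborel. ?E \<xi> r)"
      by (simp only: integral_mult_right_zero integral_complex_of_real)
    also have "\<dots> = complex_of_real (norm \<xi> powr s * (LINT r|lborel. ?E \<xi> r)) * (fourier_raw f \<xi> * iexp (\<xi> \<bullet> x))"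
      by (simp add: F_def)
    also have "norm \<xi> powr s * (LINT r|lborel. ?E \<xi> r) = gauss_moment s"
      using that by (intro radial_gauss_scaled s) auto
    finally show ?thesis .
  qed
  have Ppair: "integrable (lborel \<Otimes>\<^sub>M lborel) (\<lambda>(\<xi>, r). ?P \<xi> r)"
  proof (rule lborel_pair.Fubini_integrable)
    show "(\<lambda>(\<xi>, r). ?P \<xi> r) \<in> borel_measurable (lborel \<Otimes>\<^sub>M lborel)" by measurable
    show "AE \<xi> in lborel. integrable lborel (\<lambda>r. case (\<xi>, r) of (\<xi>, r) \<Rightarrow> ?P \<xi> r)"
      using P_int by auto
    have "integrable lborel (\<lambda>\<xi>. LINT r|lborel. norm (?P \<xi> r))"
    proof (rule Bochner_Integration.integrable_bound)
      show "integrable lborel (\<lambda>\<xi>. complex_of_real (gauss_moment s) * fourier_raw f \<xi>)"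
        by (intro integrable_mult_right integrable_fourier_raw f)
      show "AE \<xi> in lborel. norm (LINT r|lborel. norm (?P \<xi> r)) \<le> norm (complex_of_real (gauss_moment s) * fourier_raw f \<xi>)"
        using AE_lborel_singleton[of "0 :: real^'n"]
      proof eventually_elim
        case (elim \<xi>)
        have "(LINT r|lborel. norm (?P \<xi> r)) = (LINT r|lborel. norm (F \<xi>) * ?E \<xi> r)"
          by (simp add: norm_mult)
        also have "\<dots> = norm (fourier_raw f \<xi>) * (norm \<xi> powr s * (LINT r|lborel. ?E \<xi> r))"
          by (simp add: F_def norm_mult)
        also have "norm \<xi> powr s * (LINT r|lborel. ?E \<xi> r) = gauss_moment s"
          using elim by (intro radial_gauss_scaled s) auto
        finally show ?case using gauss_moment_pos[OF s] by (simp add: norm_mult)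
      qed
    qed measurable
    then show "integrable lborel (\<lambda>\<xi>. LINT r|lborel. norm (case (\<xi>, r) of (\<xi>, r) \<Rightarrow> ?P \<xi> r))"
      by simp
  qed
  have swap: "(LINT r|lborel. (LINT \<xi>|lborel. ?P \<xi> r)) = complex_of_real (gauss_moment s) * inv_fourier_raw (fourier_raw f) x"
  proof -
    have "(LINT r|lborel. (LINT \<xi>|lborel. ?P \<xi> r)) = (LINT \<xi>|lborel. (LINT r|lborel. ?P \<xi> r))"
      by (rule lborel_pair.Fubini_integral[OF Ppair])
    also have "\<dots> = (LINT \<xi>|lborel. complex_of_real (gauss_moment s) * (fourier_raw f \<xi> * iexp (\<xi> \<bullet> x)))"
    proof (rule integral_cong_AE)
      show "AE \<xi> in lborel. (LINT r|lborel. ?P \<xi> r) = complex_of_real (gauss_moment s) * (fourier_raw f \<xi> * iexp (\<xi> \<bullet> x))"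
        using AE_lborel_singleton[of "0 :: real^'n"] by eventually_elim (rule P_val)
    qed measurable
    finally show ?thesis unfolding inv_fourier_raw_def integral_mult_right_zero .
  qed
  have inner: "ennreal (?c\<^sup>2) * ennreal (norm (LINT \<xi>|lborel. ?P \<xi> r))
      \<le> ennreal (radial_weight s r) * (\<integral>\<^sup>+y. ennreal (gauss y) * ennreal (norm (Lambda s f (x + r *\<^sub>R y))) \<partial>lborel)" for r
  proof -
    let ?G = "\<lambda>y. complex_of_real (gauss y) * inv_fourier_raw F (x + r *\<^sub>R y)"
    have "(LINT \<xi>|lborel. ?P \<xi> r) = complex_of_real (radial_weight s r) *
        (LINT \<xi>|lborel. F \<xi> * iexp (\<xi> \<bullet> x) * complex_of_real (exp (- ((r * norm \<xi>)\<^sup>2 / 2))))"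
      by (subst integral_mult_right_zero[symmetric]) (simp add: mult_ac)
    also have "\<dots> = complex_of_real (radial_weight s r) * (LINT y|lborel. ?G y)"
      by (simp only: gauss_average_inv_fourier_raw[OF F_int])
    finally have eq: "norm (LINT \<xi>|lborel. ?P \<xi> r) = radial_weight s r * norm (LINT y|lborel. ?G y)"
      by (simp add: norm_mult)
    have "ennreal (norm (LINT y|lborel. ?G y)) \<le> (\<integral>\<^sup>+y. ennreal (norm (?G y)) \<partial>lborel)"
      by (cases "integrable lborel ?G") (auto intro: integral_norm_bound_ennreal simp: not_integrable_integral_eq)
    then have "ennreal (?c\<^sup>2) * ennreal (norm (LINT y|lborel. ?G y)) \<le> ennreal (?c\<^sup>2) * (\<integral>\<^sup>+y. ennreal (norm (?G y)) \<partial>lborel)"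
      by (rule mult_left_mono) simp
    also have "\<dots> = (\<integral>\<^sup>+y. ennreal (?c\<^sup>2) * ennreal (norm (?G y)) \<partial>lborel)"
    proof -
      note [measurable] = measurable_inv_fourier_raw[OF \<open>F \<in> borel_measurable borel\<close>]
      show ?thesis by (rule nn_integral_cmult[symmetric]) measurable
    qed
    also have "\<dots> = (\<integral>\<^sup>+y. ennreal (gauss y) * ennreal (norm (Lambda s f (x + r *\<^sub>R y))) \<partial>lborel)"
      by (intro nn_integral_cong)
         (simp add: L norm_mult norm_power ennreal_mult[symmetric] mult_ac)
    finally have "ennreal (radial_weight s r) * (ennreal (?c\<^sup>2) * ennreal (norm (LINT y|lborel. ?G y)))
        \<le> ennreal (radial_weight s r) * (\<integral>\<^sup>+y. ennreal (gauss y) * ennreal (norm (Lambda s f (x + r *\<^sub>R y))) \<partial>lborel)"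
      by (rule mult_left_mono) simp
    then show ?thesis unfolding eq by (simp add: ennreal_mult mult_ac)
  qed
  have "norm (f x) = ?c\<^sup>2 * norm (inv_fourier_raw (fourier_raw f) x)"
    using arg_cong[OF fourier_inversion[OF f, of x], of norm] by (simp add: norm_mult norm_power)
  moreover have "norm (LINT r|lborel. (LINT \<xi>|lborel. ?P \<xi> r)) = gauss_moment s * norm (inv_fourier_raw (fourier_raw f) x)"
    using arg_cong[OF swap, of norm] gauss_moment_pos[OF s] by (simp only: norm_mult norm_of_real abs_of_pos)
  ultimately have "gauss_moment s * norm (f x) = ?c\<^sup>2 * norm (LINT r|lborel. (LINT \<xi>|lborel. ?P \<xi> r))"
    by simp
  then have "ennreal (gauss_moment s) * ennreal (norm (f x)) = ennreal (?c\<^sup>2) * ennreal (norm (LINT r|lborel. (LINT \<xi>|lborel. ?P \<xi> r)))"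
    using gauss_moment_pos[OF s] by (simp add: ennreal_mult[symmetric])
  also have "\<dots> \<le> ennreal (?c\<^sup>2) * (\<integral>\<^sup>+r. ennreal (norm (LINT \<xi>|lborel. ?P \<xi> r)) \<partial>lborel)"
    by (intro mult_left_mono integral_norm_bound_ennreal lborel_pair.integrable_snd[OF Ppair]) simp
  also have "\<dots> = (\<integral>\<^sup>+r. ennreal (?c\<^sup>2) * ennreal (norm (LINT \<xi>|lborel. ?P \<xi> r)) \<partial>lborel)"
    by (rule nn_integral_cmult[symmetric]) measurable
  also have "\<dots> \<le> (\<integral>\<^sup>+r. ennreal (radial_weight s r) *
        (\<integral>\<^sup>+y. ennreal (gauss y) * ennreal (norm (Lambda s f (x + r *\<^sub>R y))) \<partial>lborel) \<partial>lborel)"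
    by (intro nn_integral_mono inner)
  finally show ?thesis .
qed

text \<open>Tonelli's theorem turns the superposition of Gaussian averages into a Riesz potential: for fixed
  \<open>z\<close> the remaining integral over \<open>r\<close> scales like \<open>|z - x|^(s-n)\<close>, and it converges at
  \<open>r = \<infinity>\<close> because \<open>s < n\<close>.\<close>

lemma gauss_averages_eq_riesz:
  assumes s: "0 < s" "s < real CARD('n::finite)"
  obtains k :: real where "0 \<le> k" and
    "\<And>(x :: real^'n) h. h \<in> borel_measurable borel \<Longrightarrow>
      (\<integral>\<^sup>+r. ennreal (radial_weight s r) * (\<integral>\<^sup>+y. ennreal (gauss y) * h (x + r *\<^sub>R y) \<partial>lborel) \<partial>lborel)
      = ennreal k * (\<integral>\<^sup>+z. ennreal (norm (z - x) powr (s - real CARD('n))) * h z \<partial>lborel)"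
proof -
  let ?n = "real CARD('n)"
  let ?c = "gauss (0 :: real^'n)"
  define I where "I = (\<integral>\<^sup>+r\<in>{0<..}. ennreal (r powr (s - 1 - ?n) * exp (- (1 / (2 * r\<^sup>2)))) \<partial>lborel)"
  have "I < \<infinity>" unfolding I_def using s by (intro nn_integral_powr_exp_inverse_finite) auto
  then obtain J where J: "I = ennreal J" "0 \<le> J" by (cases I) auto
  have c: "0 < ?c" by (rule gauss_pos)
  have radial: "(\<integral>\<^sup>+r. ennreal (radial_weight s r * r powr (- ?n) * gauss ((1 / r) *\<^sub>R v)) \<partial>lborel)
      = ennreal (?c * J) * ennreal (norm v powr (s - ?n))" if v: "v \<noteq> 0" for v :: "real^'n"
  proof -
    let ?a = "norm v"
    have a: "0 < ?a" using v by simp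
    have "(\<integral>\<^sup>+r. ennreal (radial_weight s r * r powr (- ?n) * gauss ((1 / r) *\<^sub>R v)) \<partial>lborel)
        = ennreal ?a * (\<integral>\<^sup>+r. ennreal (radial_weight s (?a * r) * (?a * r) powr (- ?n) * gauss ((1 / (?a * r)) *\<^sub>R v)) \<partial>lborel)"
      using a by (subst nn_integral_lborel_stretch[where c = ?a]) auto
    also have "(\<integral>\<^sup>+r. ennreal (radial_weight s (?a * r) * (?a * r) powr (- ?n) * gauss ((1 / (?a * r)) *\<^sub>R v)) \<partial>lborel)
        = (\<integral>\<^sup>+r. ennreal (?c * ?a powr (s - 1 - ?n)) * (ennreal (r powr (s - 1 - ?n) * exp (- (1 / (2 * r\<^sup>2)))) * indicator {0<..} r) \<partial>lborel)"
    proof (intro nn_integral_cong)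
      fix r :: real
      show "ennreal (radial_weight s (?a * r) * (?a * r) powr (- ?n) * gauss ((1 / (?a * r)) *\<^sub>R v))
        = ennreal (?c * ?a powr (s - 1 - ?n)) * (ennreal (r powr (s - 1 - ?n) * exp (- (1 / (2 * r\<^sup>2)))) * indicator {0<..} r)"
      proof (cases "0 < r")
        case True
        have "norm ((1 / (?a * r)) *\<^sub>R v) = 1 / r" using True a by simp
        then have "gauss ((1 / (?a * r)) *\<^sub>R v) = ?c * exp (- (1 / (2 * r\<^sup>2)))"
          unfolding gauss_def by (simp add: power_one_over field_simps)
        moreover have "radial_weight s (?a * r) * (?a * r) powr (- ?n) = ?a powr (s - 1 - ?n) * r powr (s - 1 - ?n)"
          using a True by (simp add: radial_weight_def powr_mult[symmetric] powr_add[symmetric])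
        ultimately show ?thesis using True c by (simp add: ennreal_mult[symmetric] mult_ac)
      next
        case False
        then have "\<not> 0 < ?a * r" using a by (simp add: zero_less_mult_iff)
        then show ?thesis using False by (simp add: radial_weight_def)
      qed
    qed
    also have "\<dots> = ennreal (?c * ?a powr (s - 1 - ?n)) * I"
      unfolding I_def by (rule nn_integral_cmult) measurable
    also have "ennreal ?a * (ennreal (?c * ?a powr (s - 1 - ?n)) * I) = ennreal (?c * J) * ennreal (?a * ?a powr (s - 1 - ?n))"
      using c J by (simp add: ennreal_mult[symmetric] mult_ac)
    also have "?a * ?a powr (s - 1 - ?n) = ?a powr (s - ?n)" using a by (simp add: powr_diff)
    finally show ?thesis .
  qed
  show ?thesis
  proof (rule that[of "?c * J"])
    show "0 \<le> ?c * J" using c J by simp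
    fix x :: "real^'n" and h :: "real^'n \<Rightarrow> ennreal"
    assume [measurable]: "h \<in> borel_measurable borel"
    let ?W = "\<lambda>r z. ennreal (radial_weight s r * r powr (- ?n) * gauss ((1 / r) *\<^sub>R (z - x)))"
    have "ennreal (radial_weight s r) * (\<integral>\<^sup>+y. ennreal (gauss y) * h (x + r *\<^sub>R y) \<partial>lborel)
        = (\<integral>\<^sup>+z. ?W r z * h z \<partial>lborel)" for r
    proof (cases "0 < r")
      case True
      have "(\<integral>\<^sup>+z. ?W r z * h z \<partial>lborel) = ennreal (r ^ DIM(real^'n)) * (\<integral>\<^sup>+y. ?W r (x + r *\<^sub>R y) * h (x + r *\<^sub>R y) \<partial>lborel)"
        using True by (intro nn_integral_lborel_affine) measurable
      also have "(\<integral>\<^sup>+y. ?W r (x + r *\<^sub>R y) * h (x + r *\<^sub>R y) \<partial>lborel)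
          = (\<integral>\<^sup>+y. ennreal (radial_weight s r * r powr (- ?n)) * (ennreal (gauss y) * h (x + r *\<^sub>R y)) \<partial>lborel)"
        using True by (intro nn_integral_cong) (simp add: ennreal_mult mult.assoc)
      also have "\<dots> = ennreal (radial_weight s r * r powr (- ?n)) * (\<integral>\<^sup>+y. ennreal (gauss y) * h (x + r *\<^sub>R y) \<partial>lborel)"
        by (rule nn_integral_cmult) measurable
      also have "ennreal (r ^ DIM(real^'n)) * \<dots> = ennreal (radial_weight s r * (r ^ CARD('n) * r powr (- ?n))) * (\<integral>\<^sup>+y. ennreal (gauss y) * h (x + r *\<^sub>R y) \<partial>lborel)"
      proof -
        have "ennreal (r ^ DIM(real^'n)) * ennreal (radial_weight s r * r powr (- ?n)) = ennreal (radial_weight s r * (r ^ CARD('n) * r powr (- ?n)))"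
          using True by (subst ennreal_mult[symmetric]) (auto simp: mult.left_commute)
        then show ?thesis by (simp only: mult.assoc[symmetric])
      qed
      also have "r ^ CARD('n) * r powr (- ?n) = 1"
        using True by (simp add: powr_realpow[symmetric] powr_add[symmetric])
      finally show ?thesis by simp
    qed (simp add: radial_weight_def)
    then have "(\<integral>\<^sup>+r. ennreal (radial_weight s r) * (\<integral>\<^sup>+y. ennreal (gauss y) * h (x + r *\<^sub>R y) \<partial>lborel) \<partial>lborel)
        = (\<integral>\<^sup>+r. (\<integral>\<^sup>+z. ?W r z * h z \<partial>lborel) \<partial>lborel)" by simp
    also have "\<dots> = (\<integral>\<^sup>+z. (\<integral>\<^sup>+r. ?W r z * h z \<partial>lborel) \<partial>lborel)"
      by (rule lborel_pair.Fubini'[symmetric]) measurable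
    also have "\<dots> = (\<integral>\<^sup>+z. ennreal (?c * J) * (ennreal (norm (z - x) powr (s - ?n)) * h z) \<partial>lborel)"
    proof (rule nn_integral_cong_AE)
      show "AE z in lborel. (\<integral>\<^sup>+r. ?W r z * h z \<partial>lborel) = ennreal (?c * J) * (ennreal (norm (z - x) powr (s - ?n)) * h z)"
        using AE_lborel_singleton[of x]
      proof eventually_elim
        case (elim z)
        have "(\<integral>\<^sup>+r. ?W r z * h z \<partial>lborel) = (\<integral>\<^sup>+r. ?W r z \<partial>lborel) * h z"
          by (rule nn_integral_multc) measurable
        then show ?case using radial[of "z - x"] elim by (simp add: mult.assoc)
      qed
    qed
    also have "\<dots> = ennreal (?c * J) * (\<integral>\<^sup>+z. ennreal (norm (z - x) powr (s - ?n)) * h z \<partial>lborel)"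
      by (rule nn_integral_cmult) measurable
    finally show "(\<integral>\<^sup>+r. ennreal (radial_weight s r) * (\<integral>\<^sup>+y. ennreal (gauss y) * h (x + r *\<^sub>R y) \<partial>lborel) \<partial>lborel)
      = ennreal (?c * J) * (\<integral>\<^sup>+z. ennreal (norm (z - x) powr (s - ?n)) * h z \<partial>lborel)" .
  qed
qed

lemma norm_powr_le_prod:
  fixes v :: "real^'n::finite"
  assumes \<sigma>: "\<sigma> \<le> 0" and v: "\<And>j. v $ j \<noteq> 0"
  shows "norm v powr (\<sigma> * real CARD('n)) \<le> (\<Prod>j\<in>UNIV. \<bar>v $ j\<bar> powr \<sigma>)"
proof -
  have "v \<noteq> 0" using v by auto
  then have "norm v powr (\<sigma> * real CARD('n)) = (\<Prod>j\<in>(UNIV :: 'n set). norm v powr \<sigma>)"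
    by (simp add: powr_powr[symmetric] powr_realpow)
  also have "\<dots> \<le> (\<Prod>j\<in>UNIV. \<bar>v $ j\<bar> powr \<sigma>)"
    using \<sigma> v component_le_norm_cart[of v]
    by (intro prod_mono conjI powr_mono2') auto
  finally show ?thesis .
qed

text \<open>Both powers of norms are bounded by products of powers of the coordinates; after substituting
  \<open>z = scale_coords u x\<close> all powers of the coordinates of \<open>x\<close> cancel, because the kernel is
  homogeneous.\<close>

lemma hardy_quotient_le_dilates:
  assumes s: "0 < s" "s < real CARD('n::finite)"
  obtains C :: real where "0 \<le> C" and
    "\<And>(f :: real^'n \<Rightarrow> complex) x. schwartz f \<Longrightarrow> (\<And>j. x $ j \<noteq> 0) \<Longrightarrow>
      ennreal (norm (f x / complex_of_real (norm x powr s))) \<le> ennreal C *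
        (\<integral>\<^sup>+u. ennreal (\<Prod>i\<in>UNIV. \<bar>1 - u $ i\<bar> powr (s / real CARD('n) - 1)) *
           ennreal (norm (Lambda s f (scale_coords u x))) \<partial>lborel)"
proof -
  let ?n = "real CARD('n)"
  define \<sigma> where "\<sigma> = s / ?n"
  have \<sigma>: "0 < \<sigma>" "\<sigma> < 1" "\<sigma> * ?n = s" using s by (auto simp: \<sigma>_def)
  obtain k where k: "0 \<le> k" and riesz: "\<And>(x :: real^'n) h. h \<in> borel_measurable borel \<Longrightarrow>
      (\<integral>\<^sup>+r. ennreal (radial_weight s r) * (\<integral>\<^sup>+y. ennreal (gauss y) * h (x + r *\<^sub>R y) \<partial>lborel) \<partial>lborel)
      = ennreal k * (\<integral>\<^sup>+z. ennreal (norm (z - x) powr (s - ?n)) * h z \<partial>lborel)"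
    using gauss_averages_eq_riesz[OF s] by blast
  let ?m = "gauss_moment s"
  have m: "0 < ?m" using s by (intro gauss_moment_pos)
  show ?thesis
  proof (rule that[of "k / ?m"])
    show "0 \<le> k / ?m" using k m by simp
    fix f :: "real^'n \<Rightarrow> complex" and x :: "real^'n"
    assume f: "schwartz f" and x: "\<And>j. x $ j \<noteq> 0"
    note [measurable] = measurable_Lambda[OF schwartz_measurable[OF f], of s]
    let ?h = "\<lambda>z. ennreal (norm (Lambda s f z))"
    let ?K = "\<lambda>u. \<Prod>i\<in>UNIV. \<bar>1 - (u :: real^'n) $ i\<bar> powr (\<sigma> - 1)"
    let ?X = "\<Prod>j\<in>UNIV. \<bar>x $ j\<bar>"
    have X: "0 \<le> ?X" by (simp add: prod_nonneg)
    have x0: "0 < norm x" using x by auto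
    have "ennreal ?m * ennreal (norm (f x)) \<le> ennreal k * (\<integral>\<^sup>+z. ennreal (norm (z - x) powr (s - ?n)) * ?h z \<partial>lborel)"
      using schwartz_le_gauss_averages[OF f s(1), of x] riesz[of ?h x] by simp
    then have "ennreal (norm x powr (- s) / ?m) * (ennreal ?m * ennreal (norm (f x)))
        \<le> ennreal (norm x powr (- s) / ?m) * (ennreal k * (\<integral>\<^sup>+z. ennreal (norm (z - x) powr (s - ?n)) * ?h z \<partial>lborel))"
      by (rule mult_left_mono) simp
    moreover have "ennreal (norm (f x / complex_of_real (norm x powr s)))
        = ennreal (norm x powr (- s) / ?m) * (ennreal ?m * ennreal (norm (f x)))"
      using m by (simp add: ennreal_mult[symmetric] norm_divide powr_minus_divide)
    ultimately have "ennreal (norm (f x / complex_of_real (norm x powr s)))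
        \<le> ennreal (k / ?m) * (ennreal (norm x powr (- s)) * (\<integral>\<^sup>+z. ennreal (norm (z - x) powr (s - ?n)) * ?h z \<partial>lborel))"
      using k m by (simp add: ennreal_mult[symmetric] mult.assoc[symmetric]) (simp add: mult.commute)
    also have "ennreal (norm x powr (- s)) * (\<integral>\<^sup>+z. ennreal (norm (z - x) powr (s - ?n)) * ?h z \<partial>lborel)
        = ennreal (norm x powr (- s)) * (ennreal ?X * (\<integral>\<^sup>+u. ennreal (norm (scale_coords u x - x) powr (s - ?n)) * ?h (scale_coords u x) \<partial>lborel))"
      using x by (subst nn_integral_lborel_scale_coords) auto
    also have "\<dots> = (\<integral>\<^sup>+u. ennreal (norm x powr (- s) * ?X * norm (scale_coords u x - x) powr (s - ?n)) * ?h (scale_coords u x) \<partial>lborel)"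
      using X by (simp add: nn_integral_cmult[symmetric] ennreal_mult mult.assoc)
    also have "\<dots> \<le> (\<integral>\<^sup>+u. ennreal (?K u) * ?h (scale_coords u x) \<partial>lborel)"
    proof (rule nn_integral_mono_AE)
      have "AE u in lborel. \<forall>j\<in>(UNIV :: 'n set). (u :: real^'n) $ j \<noteq> 1"
        by (intro AE_finite_allI) (auto intro: AE_lborel_nth_neq)
      then show "AE u in lborel. ennreal (norm x powr (- s) * ?X * norm (scale_coords u x - x) powr (s - ?n)) * ?h (scale_coords u x)
          \<le> ennreal (?K u) * ?h (scale_coords u x)"
      proof eventually_elim
        case (elim u)
        have nz: "(scale_coords u x - x) $ j \<noteq> 0" for j
          using elim x[of j] by (simp add: vector_minus_component)
        have "norm x powr (- s) \<le> (\<Prod>j\<in>UNIV. \<bar>x $ j\<bar> powr (- \<sigma>))"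
          using norm_powr_le_prod[of "- \<sigma>" x] \<sigma> x by simp
        moreover have "norm (scale_coords u x - x) powr (s - ?n) \<le> (\<Prod>j\<in>UNIV. \<bar>(scale_coords u x - x) $ j\<bar> powr (\<sigma> - 1))"
          using norm_powr_le_prod[of "\<sigma> - 1" "scale_coords u x - x"] \<sigma> nz by (simp add: left_diff_distrib)
        ultimately have "norm x powr (- s) * ?X * norm (scale_coords u x - x) powr (s - ?n)
            \<le> (\<Prod>j\<in>UNIV. \<bar>x $ j\<bar> powr (- \<sigma>)) * ?X * (\<Prod>j\<in>UNIV. \<bar>(scale_coords u x - x) $ j\<bar> powr (\<sigma> - 1))"
          by (intro mult_mono mult_nonneg_nonneg prod_nonneg) auto
        also have "\<dots> = (\<Prod>j\<in>UNIV. \<bar>x $ j\<bar> powr (- \<sigma>) * \<bar>x $ j\<bar> * \<bar>(scale_coords u x - x) $ j\<bar> powr (\<sigma> - 1))"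
          by (simp only: prod.distrib)
        also have "\<dots> = ?K u"
        proof (intro prod.cong refl)
          fix j
          have "\<bar>(scale_coords u x - x) $ j\<bar> = \<bar>x $ j\<bar> * \<bar>1 - u $ j\<bar>"
            by (simp add: abs_mult[symmetric] algebra_simps abs_minus_commute)
          moreover have "\<bar>x $ j\<bar> powr (- \<sigma>) * \<bar>x $ j\<bar> * \<bar>x $ j\<bar> powr (\<sigma> - 1) = 1"
            using x[of j] by (simp add: powr_minus powr_diff)
          ultimately show "\<bar>x $ j\<bar> powr (- \<sigma>) * \<bar>x $ j\<bar> * \<bar>(scale_coords u x - x) $ j\<bar> powr (\<sigma> - 1) = \<bar>1 - u $ j\<bar> powr (\<sigma> - 1)"
            by (simp add: powr_mult mult.assoc[symmetric])
        qed
        finally show ?case by (intro mult_right_mono ennreal_leI) auto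
      qed
    qed
    finally show "ennreal (norm (f x / complex_of_real (norm x powr s))) \<le> ennreal (k / ?m) *
        (\<integral>\<^sup>+u. ennreal (\<Prod>i\<in>UNIV. \<bar>1 - u $ i\<bar> powr (s / ?n - 1)) * ?h (scale_coords u x) \<partial>lborel)"
      by (simp add: \<sigma>_def mult_left_mono)
  qed
qed

section \<open>The Hardy--Rellich inequality in mixed Lorentz spaces\<close>

theorem theorem1p1:
  fixes p q :: "'n::{finite,linorder} \<Rightarrow> real" and s :: real
  assumes "\<And>i. 1 < p i" and "\<And>i. 1 < q i"
    and "0 < s" and "\<And>i. s < real CARD('n) / p i"
  shows "\<exists>C::real. C > 0 \<and>
    (\<forall>f :: real^'n::{finite,linorder} \<Rightarrow> complex. schwartz f \<longrightarrow>
       mixed_lorentz_norm p q (\<lambda>x. f x / complex_of_real (norm x powr s))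
         \<le> ennreal C * mixed_lorentz_norm p q (Lambda s f))"
proof -
  let ?n = "real CARD('n)"
  have s_n: "s / ?n < 1 / p i" for i
    using assms(4)[of i] assms(1)[of i] by (simp add: field_simps)
  have "1 / p undefined < 1" using assms(1)[of undefined] by simp
  then have "s / ?n < 1" using s_n[of undefined] by linarith
  then have "s < ?n" by simp
  then obtain C :: real where C: "0 \<le> C" and
    le: "\<And>(f :: real^'n::{finite,linorder} \<Rightarrow> complex) x. schwartz f \<Longrightarrow> (\<And>j. x $ j \<noteq> 0) \<Longrightarrow>
      ennreal (norm (f x / complex_of_real (norm x powr s))) \<le> ennreal C *
        (\<integral>\<^sup>+u. ennreal (\<Prod>i\<in>UNIV. \<bar>1 - u $ i\<bar> powr (s / ?n - 1)) *
           ennreal (norm (Lambda s f (scale_coords u x))) \<partial>lborel)"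
    using hardy_quotient_le_dilates[OF assms(3), where 'n = 'n] by blast
  obtain D :: real where "D > 0" and
    D: "\<And>f h :: real^'n::{finite,linorder} \<Rightarrow> complex. h \<in> borel_measurable borel \<Longrightarrow>
     (\<forall>x. (\<forall>j. x $ j \<noteq> 0) \<longrightarrow> ennreal (norm (f x)) \<le> ennreal C *
       (\<integral>\<^sup>+u. ennreal (\<Prod>i\<in>UNIV. \<bar>1 - u $ i\<bar> powr (s / ?n - 1)) * ennreal (norm (h (scale_coords u x))) \<partial>lborel)) \<Longrightarrow>
     mixed_lorentz_norm p q f \<le> ennreal D * mixed_lorentz_norm p q h"
    using mixed_lorentz_dilates_bounded[of p q "s / ?n" C] assms s_n C by auto
  show ?thesis
  proof (intro exI[of _ D] conjI allI impI)
    fix f :: "real^'n::{finite,linorder} \<Rightarrow> complex"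
    assume f: "schwartz f"
    show "mixed_lorentz_norm p q (\<lambda>x. f x / complex_of_real (norm x powr s))
         \<le> ennreal D * mixed_lorentz_norm p q (Lambda s f)"
      by (intro D measurable_Lambda schwartz_measurable f allI impI le) blast
  qed (rule \<open>D > 0\<close>)
qed

end
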